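(* Let $\omega \in \mathcal{DTBM}(\mathbb{R}^d)$ and let $\nu=\widehat{\omega}$. Then there exists a function $h\in B(\mathbb{R}^d)\subset C_{\mathsf u}(\mathbb{R}^d)$ such that: (a) $\mu:=h\lambda$ is a translation bounded measure and hence a tempered distribution. (b) For every $\varphi\in C_{\mathsf c}(\mathbb{R}^d)$, $$\mu(\varphi)=\int_{\mathbb{R}^d}\frac{\check{\varphi}(x)}{(2\pi i x_1)^{2d}+\ldots+(2\pi i x_d)^{2d}+(-1)^d}\,d\nu(x).$$ (c) Let $\Psi_d:=(\partial_{x_1})^{2d}+\ldots+(\partial_{x_d})^{2d}+(-1)^d$. Then $\Psi_d\mu$ is a tempered distribution and $\Psi_d\mu=\omega$. (d) For all $f\in\mathcal{S}(\mathbb{R}^d)$, $$|\omega(f)|\le \|h\|_\infty\Big(\|f\|_1+\sum_{j=1}^d\|(\partial_{x_j})^{2d}f\|_1\Big).$$ (e) $\omega$ is a distribution of order at most $2d$.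
   Context: $\lambda$ is Lebesgue measure on $\mathbb{R}^d$; $C_{\mathsf u}(\mathbb{R}^d)$ is the space of bounded uniformly continuous functions, $C_{\mathsf c}(\mathbb{R}^d)$ the space of compactly supported continuous functions, $\mathcal{S}(\mathbb{R}^d)$ the Schwartz space. A measure is a (complex) Radon measure, i.e. a linear functional on $C_{\mathsf c}(\mathbb{R}^d)$ bounded with respect to $\|\cdot\|_\infty$ on functions supported in any fixed compact set; $|\mu|$ is its total variation. A measure $\mu$ is translation bounded if $\|\mu\|_K:=\sup_{t\in\mathbb{R}^d}|\mu|(t+K)<\infty$ for every compact $K$; $\mathcal{M}^\infty(\mathbb{R}^d)$ is the space of such measures. Every $\mu\in\mathcal{M}^\infty(\mathbb{R}^d)$ defines a tempered distribution $f\mapsto\int f\,d\mu$. Fourier transform: $\widehat{f}(x)=\int e^{-2\pi i x\cdot y}f(y)\,dy$, $\check{f}(x)=\widehat{f}(-x)$ for $f \in L^1(\mathbb{R}^d)$; for a finite measure $\rho$ (complex, with $|\rho|(\mathbb{R}^d)<\infty$) $\widehat{\rho}(x)=\int e^{-2\pi i x\cdot y}d\rho(y)$; for a tempered distribution $\widehat{\omega}(f)=\omega(\widehat{f})$. $\mathcal{DTBM}(\mathbb{R}^d):=\{\omega\in\mathcal{S}'(\mathbb{R}^d):\widehat{\omega}\in\mathcal{M}^\infty(\mathbb{R}^d)\}$, and $B(\mathbb{R}^d):=\{\widehat{\rho}:\rho\text{ a finite measure on }\mathbb{R}^d\}$ (Fourier–Stieltjes algebra). A distribution $\omega$ has order at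 most $m$ if for every compact $K$ there is $C_K$ with $|\omega(\phi)|\le C_K\sum_{|\alpha|\le m}\|\partial^\alpha\phi\|_\infty$ for all $\phi\in C_{\mathsf c}^\infty(\mathbb{R}^d)$ supported in $K$. *)

theory Defs
  imports "HOL-Analysis.Analysis"
begin

text \<open>The space \<open>\<real>\<^sup>d\<close> is \<^typ>\<open>real ^ 'n\<close> with \<open>d = CARD('n)\<close>. Functionals on a function space
  \<open>V\<close> (Radon measures on \<open>C\<^sub>c\<close>, tempered distributions on the Schwartz space) are represented by total
  functions; only their values on \<open>V\<close> matter, and equality of two functionals is equality on \<open>V\<close>.\<close>

type_synonym 'n cfun = "real ^ 'n \<Rightarrow> complex"
type_synonym 'n functional = "'n cfun \<Rightarrow> complex"

definition linear_functional_on :: "'n cfun set \<Rightarrow> 'n functional \<Rightarrow> bool" where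
  "linear_functional_on V T \<longleftrightarrow>
     (\<forall>f\<in>V. \<forall>g\<in>V. T (\<lambda>x. f x + g x) = T f + T g) \<and>
     (\<forall>c. \<forall>f\<in>V. T (\<lambda>x. c * f x) = c * T f)"


section \<open>Function spaces and norms\<close>

definition supp :: "'n cfun \<Rightarrow> (real ^ 'n) set" where
  "supp f = closure {x. f x \<noteq> 0}"

definition sup_norm :: "'n cfun \<Rightarrow> real" where
  "sup_norm f = (SUP x. norm (f x))"

definition L1_norm :: "'n::finite cfun \<Rightarrow> real" where
  "L1_norm f = (\<integral>x. norm (f x) \<partial>lborel)"

definition C_c :: "'n::finite cfun set" where
  "C_c = {f. continuous_on UNIV f \<and> compact (supp f)}"

definition C_u :: "'n::finite cfun set" where
  "C_u = {f. bounded (range f) \<and> uniformly_continuous_on UNIV f}"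

definition partial_deriv :: "'n::finite \<Rightarrow> 'n cfun \<Rightarrow> 'n cfun" where
  "partial_deriv j f = (\<lambda>x. frechet_derivative f (at x) (axis j 1))"

text \<open>\<open>C\<^sup>\<infinity>\<close>: every iterated partial derivative, in whatever order, is differentiable everywhere
  (and therefore also continuous).\<close>

definition smooth :: "'n::finite cfun \<Rightarrow> bool" where
  "smooth f \<longleftrightarrow> (\<forall>js x. foldr partial_deriv js f differentiable (at x))"

definition multi_indices :: "nat \<Rightarrow> ('n::finite \<Rightarrow> nat) set" where
  "multi_indices m = {\<alpha>. (\<Sum>j\<in>UNIV. \<alpha> j) \<le> m}"

definition monomial :: "('n::finite \<Rightarrow> nat) \<Rightarrow> real ^ 'n \<Rightarrow> real" where
  "monomial \<beta> x = (\<Prod>j\<in>UNIV. (x $ j) ^ \<beta> j)"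

text \<open>The derivative \<open>\<partial>\<^sup>\<alpha>\<close>. The coordinates are processed in some arbitrary fixed order; for smooth
  functions the order is immaterial by the symmetry of mixed partial derivatives.\<close>

definition multi_deriv :: "('n::finite \<Rightarrow> nat) \<Rightarrow> 'n cfun \<Rightarrow> 'n cfun" where
  "multi_deriv \<alpha> =
     foldr (\<lambda>j. partial_deriv j ^^ \<alpha> j) (SOME js. distinct js \<and> set js = UNIV)"

definition test_functions :: "'n::finite cfun set" where
  "test_functions = {f. smooth f \<and> compact (supp f)}"

definition schwartz :: "'n::finite cfun set" where
  "schwartz = {f. smooth f \<and>
     (\<forall>\<alpha> \<beta>. bounded (range (\<lambda>x. of_real (monomial \<beta> x) * multi_deriv \<alpha> f x)))}"


section \<open>Radon measures\<close>

definition radon_measure :: "'n::finite functional \<Rightarrow> bool" where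
  "radon_measure \<mu> \<longleftrightarrow> linear_functional_on C_c \<mu> \<and>
     (\<forall>K. compact K \<longrightarrow>
        (\<exists>C. \<forall>\<phi>\<in>C_c. supp \<phi> \<subseteq> K \<longrightarrow> norm (\<mu> \<phi>) \<le> C * sup_norm \<phi>))"

text \<open>The upper integral \<open>|\<mu>|\<^sup>*(g)\<close> of a function \<open>g \<ge> 0\<close> with respect to the total variation \<open>|\<mu>|\<close>,
  as in Bourbaki. The total variation is the positive functional
  \<open>|\<mu>|(\<phi>) = sup {|\<mu>(\<psi>)| | \<psi> \<in> C\<^sub>c, |\<psi>| \<le> \<phi>}\<close> for \<open>0 \<le> \<phi> \<in> C\<^sub>c\<close>; for lower semicontinuous \<open>g\<close> one sets
  \<open>|\<mu>|\<^sup>*(g) = sup {|\<mu>|(\<phi>) | \<phi> \<in> C\<^sub>c, 0 \<le> \<phi> \<le> g}\<close> (the two suprema are combined below), and then takes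
  the infimum over the lower semicontinuous majorants of a general \<open>g\<close>.\<close>

definition variation_lsc :: "'n::finite functional \<Rightarrow> (real ^ 'n \<Rightarrow> ennreal) \<Rightarrow> ennreal" where
  "variation_lsc \<mu> g =
     (SUP \<psi>\<in>{\<psi>\<in>C_c. \<forall>x. ennreal (norm (\<psi> x)) \<le> g x}. ennreal (norm (\<mu> \<psi>)))"

definition lower_semicontinuous :: "(real ^ 'n \<Rightarrow> ennreal) \<Rightarrow> bool" where
  "lower_semicontinuous g \<longleftrightarrow> (\<forall>c. open {x. c < g x})"

definition variation_upper_integral ::
    "'n::finite functional \<Rightarrow> (real ^ 'n \<Rightarrow> ennreal) \<Rightarrow> ennreal" where
  "variation_upper_integral \<mu> f =
     (INF g\<in>{g. lower_semicontinuous g \<and> (\<forall>x. f x \<le> g x)}. variation_lsc \<mu> g)"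

text \<open>\<open>|\<mu>|(A)\<close>; it is meant for Borel sets \<open>A\<close>, on which this outer measure is the measure \<open>|\<mu>|\<close>.\<close>

definition total_variation :: "'n::finite functional \<Rightarrow> (real ^ 'n) set \<Rightarrow> ennreal" where
  "total_variation \<mu> A = variation_upper_integral \<mu> (indicator A)"

text \<open>\<open>L\<^sup>1(|\<mu>|)\<close> is the closure of \<open>C\<^sub>c\<close> under the seminorm \<open>f \<mapsto> |\<mu>|\<^sup>*(|f|)\<close>, and the integral with
  respect to \<open>\<mu>\<close> is the continuous extension of \<open>\<mu>\<close> from \<open>C\<^sub>c\<close> to \<open>L\<^sup>1(|\<mu>|)\<close>.\<close>

definition radon_has_integral :: "'n::finite functional \<Rightarrow> 'n cfun \<Rightarrow> complex \<Rightarrow> bool" where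
  "radon_has_integral \<mu> f I \<longleftrightarrow>
     (\<exists>\<phi> :: nat \<Rightarrow> 'n cfun. (\<forall>k. \<phi> k \<in> C_c) \<and>
        (\<lambda>k. variation_upper_integral \<mu> (\<lambda>x. ennreal (norm (f x - \<phi> k x)))) \<longlonglongrightarrow> 0 \<and>
        (\<lambda>k. \<mu> (\<phi> k)) \<longlonglongrightarrow> I)"

definition radon_integrable :: "'n::finite functional \<Rightarrow> 'n cfun \<Rightarrow> bool" where
  "radon_integrable \<mu> f \<longleftrightarrow> (\<exists>I. radon_has_integral \<mu> f I)"

definition radon_integral :: "'n::finite functional \<Rightarrow> 'n cfun \<Rightarrow> complex" where
  "radon_integral \<mu> f = (THE I. radon_has_integral \<mu> f I)"

definition finite_radon_measure :: "'n::finite functional \<Rightarrow> bool" where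
  "finite_radon_measure \<rho> \<longleftrightarrow> radon_measure \<rho> \<and> total_variation \<rho> UNIV < \<infinity>"

definition translation_bounded_measures :: "'n::finite functional set" where
  "translation_bounded_measures = {\<mu>. radon_measure \<mu> \<and>
     (\<forall>K. compact K \<longrightarrow> (SUP t. total_variation \<mu> ((\<lambda>x. t + x) ` K)) < \<infinity>)}"

text \<open>The measure \<open>h\<lambda>\<close>.\<close>

definition lebesgue_density :: "'n::finite cfun \<Rightarrow> 'n functional" where
  "lebesgue_density h = (\<lambda>\<phi>. \<integral>x. \<phi> x * h x \<partial>lborel)"


section \<open>Distributions\<close>

text \<open>Continuity is with respect to the topology generated by the seminorms
  \<open>f \<mapsto> sup |x\<^sup>\<beta> \<partial>\<^sup>\<alpha>f(x)|\<close>.\<close>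

definition tempered_distributions :: "'n::finite functional set" where
  "tempered_distributions = {T. linear_functional_on schwartz T \<and>
     (\<exists>N C. \<forall>f\<in>schwartz. norm (T f) \<le>
        C * (\<Sum>\<alpha>\<in>multi_indices N. \<Sum>\<beta>\<in>multi_indices N.
               sup_norm (\<lambda>x. of_real (monomial \<beta> x) * multi_deriv \<alpha> f x)))}"

definition measure_distribution :: "'n::finite functional \<Rightarrow> 'n functional" where
  "measure_distribution \<mu> = (\<lambda>f. radon_integral \<mu> f)"

definition dist_partial_deriv :: "'n::finite \<Rightarrow> 'n functional \<Rightarrow> 'n functional" where
  "dist_partial_deriv j T = (\<lambda>f. - T (partial_deriv j f))"

definition Psi :: "'n::finite functional \<Rightarrow> 'n functional" where
  "Psi T = (\<lambda>f. (\<Sum>j\<in>UNIV. (dist_partial_deriv j ^^ (2 * CARD('n))) T f) +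
                  (- 1) ^ CARD('n) * T f)"

definition has_order_at_most :: "nat \<Rightarrow> 'n::finite functional \<Rightarrow> bool" where
  "has_order_at_most m T \<longleftrightarrow>
     (\<forall>K. compact K \<longrightarrow> (\<exists>C. \<forall>\<phi>\<in>test_functions. supp \<phi> \<subseteq> K \<longrightarrow>
        norm (T \<phi>) \<le> C * (\<Sum>\<alpha>\<in>multi_indices m. sup_norm (multi_deriv \<alpha> \<phi>))))"


section \<open>Fourier transforms\<close>

definition fourier :: "'n::finite cfun \<Rightarrow> 'n cfun" where
  "fourier f x = (\<integral>y. exp (- 2 * of_real pi * \<i> * of_real (x \<bullet> y)) * f y \<partial>lborel)"

definition inv_fourier :: "'n::finite cfun \<Rightarrow> 'n cfun" where
  "inv_fourier f x = fourier f (- x)"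

definition fourier_measure :: "'n::finite functional \<Rightarrow> 'n cfun" where
  "fourier_measure \<rho> x = radon_integral \<rho> (\<lambda>y. exp (- 2 * of_real pi * \<i> * of_real (x \<bullet> y)))"

definition fourier_dist :: "'n::finite functional \<Rightarrow> 'n functional" where
  "fourier_dist T = (\<lambda>f. T (fourier f))"

definition fourier_stieltjes :: "'n::finite cfun set" where
  "fourier_stieltjes = {fourier_measure \<rho> | \<rho>. finite_radon_measure \<rho>}"

text \<open>The measure \<open>\<nu>\<close> is the Fourier transform of \<open>\<omega>\<close>, as an equality of tempered distributions.\<close>

definition fourier_is_measure :: "'n::finite functional \<Rightarrow> 'n functional \<Rightarrow> bool" where
  "fourier_is_measure \<omega> \<nu> \<longleftrightarrow>
     (\<forall>f\<in>schwartz. fourier_dist \<omega> f = measure_distribution \<nu> f)"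

definition DTBM :: "'n::finite functional set" where
  "DTBM = {\<omega>\<in>tempered_distributions.
     \<exists>\<nu>\<in>translation_bounded_measures. fourier_is_measure \<omega> \<nu>}"

end

theory Submission
  imports Defs "HOL-Probability.Sinc_Integral"
begin

text \<open>
  Write \<open>d = CARD('n)\<close> and \<open>P(x) = \<Sum>\<^sub>j (2\<pi>ix\<^sub>j)\<^sup>2\<^sup>d + (-1)\<^sup>d\<close>. This is the symbol of the operator
  \<open>\<Psi>\<^sub>d\<close>: the even order \<open>2d\<close> makes \<open>P\<close> even, and since \<open>i\<^sup>2\<^sup>d = (-1)\<^sup>d\<close> all its terms have the same
  sign, so that \<open>|P(x)| = 1 + \<Sum>\<^sub>j (2\<pi>x\<^sub>j)\<^sup>2\<^sup>d\<close>. In particular \<open>P\<close> has no zero, and \<open>1/|P|\<close> is at most a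
  constant multiple of \<open>w(x) = \<Prod>\<^sub>j 1/(1+x\<^sub>j\<^sup>2)\<close>, which is integrable and varies by a bounded factor
  over unit balls. For these two reasons translation bounded measures integrate \<open>w\<close>
  (\<open>variation_weight_finite\<close>), so \<open>\<nu>/P\<close> is a finite measure. Let \<open>\<rho>\<close> be its reflection and
  \<open>h = fourier_measure \<rho>\<close>. The function \<open>h\<close> is bounded and uniformly continuous, which gives (a).

  Everything then follows from the duality \<open>\<integral> f h d\<lambda> = \<integral> fourier f d\<rho> = \<integral> inv_fourier f / P d\<nu>\<close>,
  valid for continuous integrable \<open>f\<close> (\<open>fourier_duality\<close>). For \<open>f \<in> C\<^sub>c\<close> it is (b). For a Schwartz
  function \<open>f\<close> it is applied to \<open>\<Psi>\<^sub>d f\<close>: integration by parts gives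
  \<open>inv_fourier (\<Psi>\<^sub>d f) = P * inv_fourier f\<close>, the factor \<open>P\<close> cancels, and
  \<open>(\<Psi>\<^sub>d \<mu>)(f) = \<integral> (\<Psi>\<^sub>d f) h d\<lambda> = \<nu>(inv_fourier f) = \<omega>(fourier (inv_fourier f)) = \<omega>(f)\<close>
  by Fourier inversion; this is (c). The integral of \<open>(\<Psi>\<^sub>d f) h\<close> is at most \<open>\<parallel>h\<parallel>\<^sub>\<infinity> \<parallel>\<Psi>\<^sub>d f\<parallel>\<^sub>1\<close>, which gives (d),
  and (e) is (d) together with \<open>\<parallel>g\<parallel>\<^sub>1 \<le> \<lambda>(K) \<parallel>g\<parallel>\<^sub>\<infinity>\<close> for \<open>g\<close> supported in \<open>K\<close>.

  Radon measures are treated as functionals throughout, without representing them by measures on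
  Borel sets. All integrands that occur are continuous, and for continuous \<open>f\<close> the upper integral
  of \<open>|f|\<close> is the supremum of \<open>|\<nu>(\<psi>)|\<close> over \<open>\<psi> \<in> C\<^sub>c\<close> with \<open>|\<psi>| \<le> |f|\<close>. This seminorm, here called
  \<open>variation \<nu> f\<close>, is subadditive, and if it is finite, then \<open>f\<close> has small variation
  outside a large ball, so that integrals can be approximated by cutting off. Interchanging \<open>\<nu>\<close> with a Lebesgue integral
  (\<open>radon_lebesgue_interchange\<close>) amounts to the fact that a bounded linear map commutes with the
  integral of a continuous function with values in a Banach space, here a space of bounded
  continuous functions. It is used twice: to average over translates in the proof that \<open>\<nu>/P\<close> is
  finite, and for the duality.

  On the side of Fourier analysis it has to be shown that the Schwartz space is invariant under the
  Fourier transform and that the inversion formula holds. The latter is proved by inserting the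
  factor \<open>\<Prod>\<^sub>j exp(-\<epsilon>|x\<^sub>j|)\<close>, whose Fourier transform is a product of Poisson kernels, that is, a
  rescaled multiple of the weight \<open>w\<close>.
\<close>


section \<open>Compactly supported continuous functions\<close>

lemma C_cI:
  fixes f :: "'n::finite cfun"
  assumes "continuous_on UNIV f" and "\<And>x. R < norm x \<Longrightarrow> f x = 0"
  shows "f \<in> C_c"
proof -
  have "{x. f x \<noteq> 0} \<subseteq> cball 0 R" using assms(2) by (force simp: dist_norm)
  then have "supp f \<subseteq> cball 0 R" unfolding supp_def by (simp add: closure_minimal)
  then have "bounded (supp f)" by (rule bounded_subset[OF bounded_cball])
  then have "compact (supp f)" by (simp add: compact_eq_bounded_closed supp_def)
  then show ?thesis using assms(1) by (simp add: C_c_def)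
qed

lemma C_cD_cont: "f \<in> C_c \<Longrightarrow> continuous_on UNIV f"
  by (simp add: C_c_def)

lemma supp_zero: "x \<notin> supp f \<Longrightarrow> f x = 0"
  using closure_subset[of "{x. f x \<noteq> 0}"] by (auto simp: supp_def)

lemma C_cE:
  fixes f :: "'n::finite cfun"
  assumes "f \<in> C_c"
  obtains R where "0 < R" "\<And>x. R < norm x \<Longrightarrow> f x = 0"
proof -
  have "bounded (supp f)" using assms by (simp add: C_c_def compact_imp_bounded)
  then obtain R where "\<And>x. x \<in> supp f \<Longrightarrow> norm x \<le> R" by (auto simp: bounded_iff)
  then have "\<And>x. max R 1 < norm x \<Longrightarrow> f x = 0" using supp_zero by (smt (verit))
  with that[of "max R 1"] show ?thesis by auto
qed

lemma C_c_dominated: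
  fixes f g :: "'n::finite cfun"
  assumes "f \<in> C_c" "continuous_on UNIV g" "\<And>x. f x = 0 \<Longrightarrow> g x = 0"
  shows "g \<in> C_c"
proof -
  obtain R where "\<And>x. R < norm x \<Longrightarrow> f x = 0" using C_cE[OF assms(1)] by blast
  then show ?thesis using assms by (intro C_cI[of g R]) auto
qed

lemma C_c_bounded:
  fixes f :: "'n::finite cfun"
  assumes "f \<in> C_c"
  shows "bounded (range f)"
proof -
  obtain R where R: "\<And>x. R < norm x \<Longrightarrow> f x = 0" using C_cE[OF assms] by blast
  have "compact (f ` cball 0 R)"
    by (intro compact_continuous_image continuous_on_subset[OF C_cD_cont[OF assms]]) auto
  then have "bounded (insert 0 (f ` cball 0 R))" by (simp add: compact_imp_bounded)
  moreover have "range f \<subseteq> insert 0 (f ` cball 0 R)" using R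
    by (smt (verit) image_eqI image_subsetI insertCI mem_cball_0)
  ultimately show ?thesis by (rule bounded_subset)
qed

lemma C_c_add: "f \<in> C_c \<Longrightarrow> g \<in> C_c \<Longrightarrow> (\<lambda>x. f x + g x) \<in> C_c" for f :: "'n::finite cfun"
proof -
  assume f: "f \<in> C_c" and g: "g \<in> C_c"
  obtain R where R: "\<And>x. R < norm x \<Longrightarrow> f x = 0" using C_cE[OF f] by blast
  obtain S where S: "\<And>x. S < norm x \<Longrightarrow> g x = 0" using C_cE[OF g] by blast
  show ?thesis using f g R S
    by (intro C_cI[where R = "max R S"]) (use C_cD_cont[OF f] C_cD_cont[OF g] in \<open>auto intro: continuous_on_add\<close>)
qed

lemma C_c_mult: "f \<in> C_c \<Longrightarrow> continuous_on UNIV g \<Longrightarrow> (\<lambda>x. g x * f x) \<in> C_c" for f :: "'n::finite cfun"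
  by (rule C_c_dominated[of f "\<lambda>x. g x * f x"]) (use C_cD_cont[of f] in \<open>auto intro: continuous_on_mult\<close>)

lemma C_c_scale: "f \<in> C_c \<Longrightarrow> (\<lambda>x. c * f x) \<in> C_c" for f :: "'n::finite cfun"
  by (intro C_c_mult continuous_intros)

lemma C_c_diff: "f \<in> C_c \<Longrightarrow> g \<in> C_c \<Longrightarrow> (\<lambda>x. f x - g x) \<in> C_c" for f :: "'n::finite cfun"
  using C_c_add[of f "\<lambda>x. -1 * g x"] C_c_scale[of g "-1"] by simp

text \<open>A Lipschitz function that is \<open>1\<close> on the ball of radius \<open>R\<close> and \<open>0\<close> outside that of radius \<open>R + 1\<close>.\<close>

definition cutoff :: "real \<Rightarrow> 'n::finite cfun" where
  "cutoff R x = of_real (max 0 (min 1 (R + 1 - norm x)))"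

lemma cutoff_cont[continuous_intros]: "continuous_on S (cutoff R)"
  unfolding cutoff_def by (intro continuous_intros)

lemma cutoff_C_c: "cutoff R \<in> C_c"
  by (rule C_cI[of _ "R+1"]) (auto intro: cutoff_cont, auto simp: cutoff_def)

lemma cutoff_eq_1: "norm x \<le> R \<Longrightarrow> cutoff R x = 1"
  by (auto simp: cutoff_def)

lemma cutoff_eq_0: "R + 1 \<le> norm x \<Longrightarrow> cutoff R x = 0"
  by (auto simp: cutoff_def)

lemma norm_cutoff_le_1: "norm (cutoff R x) \<le> 1"
  by (auto simp: cutoff_def)

lemma norm_one_minus_cutoff_le_1: "norm (1 - cutoff R x) \<le> 1"
proof -
  have "1 - cutoff R x = complex_of_real (1 - max 0 (min 1 (R + 1 - norm x)))" by (simp add: cutoff_def)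
  then show ?thesis by (simp only: norm_of_real)
qed

lemma sup_norm_upper: "bounded (range f) \<Longrightarrow> norm (f x) \<le> sup_norm f"
  unfolding sup_norm_def by (rule cSUP_upper) (auto simp: bounded_iff bdd_above_def)

lemma sup_norm_le: "(\<And>x. norm (f x) \<le> C) \<Longrightarrow> sup_norm f \<le> C"
  unfolding sup_norm_def by (rule cSUP_least) auto

lemma sup_norm_nonneg: "bounded (range f) \<Longrightarrow> 0 \<le> sup_norm f"
  using sup_norm_upper[of f undefined] norm_ge_zero order_trans by blast


section \<open>The variation seminorm of a Radon measure\<close>

text \<open>The upper integral of \<open>|f|\<close> with respect to the total variation, in the form in which it can be
  computed when \<open>|f|\<close> is lower semicontinuous, for example when \<open>f\<close> is continuous.\<close>

definition variation :: "'n::finite functional \<Rightarrow> 'n cfun \<Rightarrow> ennreal" where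
  "variation \<nu> f = variation_lsc \<nu> (\<lambda>x. ennreal (norm (f x)))"

lemma radon_add: "radon_measure \<nu> \<Longrightarrow> f \<in> C_c \<Longrightarrow> g \<in> C_c \<Longrightarrow> \<nu> (\<lambda>x. f x + g x) = \<nu> f + \<nu> g"
  and radon_scale: "radon_measure \<nu> \<Longrightarrow> f \<in> C_c \<Longrightarrow> \<nu> (\<lambda>x. c * f x) = c * \<nu> f"
  by (auto simp: radon_measure_def linear_functional_on_def)

lemma radon_bounded:
  "radon_measure \<nu> \<Longrightarrow> compact K \<Longrightarrow> \<exists>C. \<forall>\<phi>\<in>C_c. supp \<phi> \<subseteq> K \<longrightarrow> norm (\<nu> \<phi>) \<le> C * sup_norm \<phi>"
  by (simp add: radon_measure_def)

lemma radon_diff: "radon_measure \<nu> \<Longrightarrow> f \<in> C_c \<Longrightarrow> g \<in> C_c \<Longrightarrow> \<nu> (\<lambda>x. f x - g x) = \<nu> f - \<nu> g"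
  using radon_add[of \<nu> f "\<lambda>x. -1 * g x"] radon_scale[of \<nu> g "-1"] C_c_scale[of g "-1"] by simp

lemma variation_upper:
  assumes "\<psi> \<in> C_c" "\<And>x. norm (\<psi> x) \<le> norm (f x)"
  shows "ennreal (norm (\<nu> \<psi>)) \<le> variation \<nu> f"
  unfolding variation_def variation_lsc_def
  by (rule SUP_upper) (use assms in \<open>auto intro: ennreal_leI\<close>)

lemma variation_least:
  assumes "\<And>\<psi>. \<psi> \<in> C_c \<Longrightarrow> (\<And>x. norm (\<psi> x) \<le> norm (f x)) \<Longrightarrow> ennreal (norm (\<nu> \<psi>)) \<le> C"
  shows "variation \<nu> f \<le> C"
  unfolding variation_def variation_lsc_def
  by (rule SUP_least) (use assms in \<open>auto simp: ennreal_le_iff\<close>)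

lemma variation_mono: "(\<And>x. norm (f x) \<le> norm (g x)) \<Longrightarrow> variation \<nu> f \<le> variation \<nu> g"
  by (intro variation_least variation_upper) (auto intro: order_trans)

lemma variation_scale_le:
  fixes f g :: "'n::finite cfun"
  assumes \<nu>: "radon_measure \<nu>" and "0 \<le> c" "\<And>x. norm (f x) \<le> c * norm (g x)"
  shows "variation \<nu> f \<le> ennreal c * variation \<nu> g"
proof (rule variation_least)
  fix \<psi> :: "'n cfun" assume \<psi>: "\<psi> \<in> C_c" and le: "\<And>x. norm (\<psi> x) \<le> norm (f x)"
  show "ennreal (norm (\<nu> \<psi>)) \<le> ennreal c * variation \<nu> g"
  proof (cases "c = 0")
    case True
    have "\<psi> = (\<lambda>x. 0 * \<psi> x)" 
    proof
      fix x
      have "norm (\<psi> x) \<le> 0" using order_trans[OF le assms(3), of x] True by simp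
      then show "\<psi> x = 0 * \<psi> x" by simp
    qed
    then have "\<nu> \<psi> = 0 * \<nu> \<psi>" using radon_scale[OF \<nu> \<psi>, of 0] by metis
    then show ?thesis by simp
  next
    case False
    then have c: "c > 0" using assms(2) by simp
    have "ennreal (norm (\<nu> (\<lambda>x. of_real (1/c) * \<psi> x))) \<le> variation \<nu> g"
    proof (rule variation_upper[OF C_c_scale[OF \<psi>]])
      fix x
      show "norm (of_real (1/c) * \<psi> x) \<le> norm (g x)"
        using order_trans[OF le assms(3), of x] c by (simp add: norm_mult norm_divide field_simps)
    qed
    then have "ennreal (norm (\<nu> \<psi>) / c) \<le> variation \<nu> g"
      using c by (simp only: radon_scale[OF \<nu> \<psi>]) (simp add: norm_mult norm_divide)
    then have "ennreal c * ennreal (norm (\<nu> \<psi>) / c) \<le> ennreal c * variation \<nu> g"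
      by (rule mult_left_mono) simp
    then show ?thesis using c by (simp add: ennreal_mult[symmetric])
  qed
qed

text \<open>A bounded factor \<open>q\<close> may be discontinuous where \<open>\<psi>\<close> vanishes without destroying the continuity
  of \<open>q \<psi>\<close>. This is needed for \<open>q = |f| / (|f| + |g|)\<close> at the common zeros of \<open>f\<close> and \<open>g\<close>.\<close>

lemma continuous_on_if_zero_dominated:
  fixes \<psi> q :: "'n::finite cfun"
  assumes \<psi>: "continuous_on UNIV \<psi>" and q: "continuous_on {x. p x \<noteq> 0} q"
    and p: "continuous_on UNIV (p :: real^'n \<Rightarrow> real)"
    and le: "\<And>x. norm (q x) \<le> 1" and z: "\<And>x. p x = 0 \<Longrightarrow> \<psi> x = 0"
  shows "continuous_on UNIV (\<lambda>x. q x * \<psi> x)"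
proof (rule continuous_at_imp_continuous_on, intro ballI)
  fix x :: "real^'n"
  show "isCont (\<lambda>x. q x * \<psi> x) x"
  proof (cases "p x = 0")
    case True
    have "(\<psi> \<longlongrightarrow> 0) (at x)"
      using \<psi> z[OF True] by (metis UNIV_I continuous_on_def open_UNIV tendsto_within_open)
    then have "((\<lambda>x. q x * \<psi> x) \<longlongrightarrow> 0) (at x)"
    proof (rule Lim_null_comparison[rotated, OF tendsto_norm_zero])
      show "\<forall>\<^sub>F y in at x. norm (q y * \<psi> y) \<le> norm (\<psi> y)"
        using le by (intro always_eventually) (simp add: norm_mult mult_left_le_one_le)
    qed
    then show ?thesis using z[OF True] by (simp add: isCont_def)
  next
    case False
    have "open {x. p x \<noteq> 0}"
      using p by (simp add: open_Collect_neq)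
    then have "isCont q x" using q False by (simp add: continuous_on_eq_continuous_at)
    moreover have "isCont \<psi> x" using \<psi> by (simp add: continuous_on_eq_continuous_at)
    ultimately show ?thesis by (rule continuous_mult)
  qed
qed

text \<open>A competitor \<open>\<psi>\<close> for \<open>h\<close> splits as \<open>\<psi> = \<psi> |f|/(|f|+|g|) + \<psi> |g|/(|f|+|g|)\<close> into competitors for
  \<open>f\<close> and for \<open>g\<close>.\<close>

lemma variation_triangle:
  fixes f g h :: "'n::finite cfun"
  assumes \<nu>: "radon_measure \<nu>" and f: "continuous_on UNIV f" and g: "continuous_on UNIV g"
    and h: "\<And>x. norm (h x) \<le> norm (f x) + norm (g x)"
  shows "variation \<nu> h \<le> variation \<nu> f + variation \<nu> g"
proof (rule variation_least)
  fix \<psi> :: "'n cfun" assume \<psi>: "\<psi> \<in> C_c" and le: "\<And>x. norm (\<psi> x) \<le> norm (h x)"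
  define p where "p x = norm (f x) + norm (g x)" for x
  have le': "norm (\<psi> x) \<le> p x" for x using order_trans[OF le h] by (simp add: p_def)
  have z: "\<psi> x = 0" if "p x = 0" for x using le'[of x] that by simp
  have p0: "p x \<ge> 0" for x by (simp add: p_def)
  have pc: "continuous_on UNIV p" unfolding p_def using f g by (intro continuous_intros)
  have split: "(\<lambda>x. of_real (norm (u x) / p x) * \<psi> x) \<in> C_c
       \<and> ennreal (norm (\<nu> (\<lambda>x. of_real (norm (u x) / p x) * \<psi> x))) \<le> variation \<nu> u"
    if u: "continuous_on UNIV u" "\<And>x. norm (u x) \<le> p x" for u :: "'n cfun"
  proof
    have 1: "norm (u x) / p x \<le> 1" for x using u(2)[of x] p0[of x]
      by (cases "p x = 0") (auto simp: divide_le_eq_1)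
    have "continuous_on {x. p x \<noteq> 0} (\<lambda>x. complex_of_real (norm (u x) / p x))"
      using u(1) pc by (intro continuous_intros) (auto intro: continuous_on_subset)
    then have "continuous_on UNIV (\<lambda>x. of_real (norm (u x) / p x) * \<psi> x)"
      by (rule continuous_on_if_zero_dominated[OF C_cD_cont[OF \<psi>] _ pc])
        (use 1 p0 z in \<open>auto simp: norm_divide\<close>)
    then show C: "(\<lambda>x. of_real (norm (u x) / p x) * \<psi> x) \<in> C_c"
      using C_c_dominated[OF \<psi>] by simp
    show "ennreal (norm (\<nu> (\<lambda>x. of_real (norm (u x) / p x) * \<psi> x))) \<le> variation \<nu> u"
    proof (rule variation_upper[OF C])
      fix x
      have "norm (u x) / p x * norm (\<psi> x) \<le> norm (u x)"
      proof (cases "p x = 0")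
        case False
        have "norm (u x) / p x * norm (\<psi> x) \<le> norm (u x) / p x * p x"
          using p0 le' by (intro mult_left_mono) auto
        then show ?thesis using False by simp
      qed simp
      then show "norm (of_real (norm (u x) / p x) * \<psi> x) \<le> norm (u x)"
        using p0 by (simp add: norm_mult norm_divide)
    qed
  qed
  note F = split[OF f] and G = split[OF g]
  have Fp: "norm (f x) \<le> p x" and Gp: "norm (g x) \<le> p x" for x by (auto simp: p_def)
  have "\<psi> = (\<lambda>x. of_real (norm (f x) / p x) * \<psi> x + of_real (norm (g x) / p x) * \<psi> x)"
  proof
    fix x
    show "\<psi> x = of_real (norm (f x) / p x) * \<psi> x + of_real (norm (g x) / p x) * \<psi> x"
    proof (cases "p x = 0")
      case False
      have "of_real (norm (f x) / p x) * \<psi> x + of_real (norm (g x) / p x) * \<psi> x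
          = of_real ((norm (f x) + norm (g x)) / p x) * \<psi> x"
        by (simp add: add_divide_distrib ring_distribs)
      also have "\<dots> = \<psi> x" using False by (simp add: p_def flip: of_real_add)
      finally show ?thesis by simp
    qed (use z in auto)
  qed
  then have "\<nu> \<psi> = \<nu> (\<lambda>x. of_real (norm (f x) / p x) * \<psi> x) + \<nu> (\<lambda>x. of_real (norm (g x) / p x) * \<psi> x)"
    using radon_add[OF \<nu>, of "\<lambda>x. of_real (norm (f x) / p x) * \<psi> x" "\<lambda>x. of_real (norm (g x) / p x) * \<psi> x"]
      F[OF Fp] G[OF Gp] by metis
  then have "ennreal (norm (\<nu> \<psi>)) \<le> ennreal (norm (\<nu> (\<lambda>x. of_real (norm (f x) / p x) * \<psi> x)))
     + ennreal (norm (\<nu> (\<lambda>x. of_real (norm (g x) / p x) * \<psi> x)))"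
    by (simp add: norm_triangle_ineq flip: ennreal_plus)
  also have "\<dots> \<le> variation \<nu> f + variation \<nu> g"
    using F[OF Fp] G[OF Gp] by (intro add_mono) auto
  finally show "ennreal (norm (\<nu> \<psi>)) \<le> variation \<nu> f + variation \<nu> g" .
qed

text \<open>The infimum over lower semicontinuous majorants is attained at \<open>|f|\<close> itself.\<close>

lemma variation_upper_integral_continuous:
  fixes f :: "'n::finite cfun"
  assumes "continuous_on UNIV f"
  shows "variation_upper_integral \<nu> (\<lambda>x. ennreal (norm (f x))) = variation \<nu> f"
proof (rule antisym)
  have "open {x. c < ennreal (norm (f x))}" for c
  proof (cases c)
    case (real r)
    then have "{x. c < ennreal (norm (f x))} = {x. r < norm (f x)}"
      by (auto simp: ennreal_less_iff)
    then show ?thesis using assms by (simp add: open_Collect_less continuous_intros)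
  qed simp
  then have "lower_semicontinuous (\<lambda>x. ennreal (norm (f x)))"
    unfolding lower_semicontinuous_def by simp
  then show "variation_upper_integral \<nu> (\<lambda>x. ennreal (norm (f x))) \<le> variation \<nu> f"
    unfolding variation_upper_integral_def variation_def by (intro INF_lower) auto
  show "variation \<nu> f \<le> variation_upper_integral \<nu> (\<lambda>x. ennreal (norm (f x)))"
    unfolding variation_upper_integral_def variation_def variation_lsc_def
    by (intro INF_greatest SUP_subset_mono) (auto intro: order_trans[OF ennreal_leI])
qed

lemma variation_C_c_finite:
  fixes f :: "'n::finite cfun"
  assumes \<nu>: "radon_measure \<nu>" and f: "f \<in> C_c"
  shows "variation \<nu> f < \<infinity>"
proof -
  have "compact (supp f)" using f by (simp add: C_c_def)
  then obtain C where C: "\<And>\<psi>. \<psi> \<in> C_c \<Longrightarrow> supp \<psi> \<subseteq> supp f \<Longrightarrow> norm (\<nu> \<psi>) \<le> C * sup_norm \<psi>"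
    using radon_bounded[OF \<nu>] by metis
  have "variation \<nu> f \<le> ennreal (\<bar>C\<bar> * sup_norm f)"
  proof (rule variation_least, rule ennreal_leI)
    fix \<psi> :: "'n cfun" assume \<psi>: "\<psi> \<in> C_c" and le: "\<And>x. norm (\<psi> x) \<le> norm (f x)"
    have "{x. \<psi> x \<noteq> 0} \<subseteq> {x. f x \<noteq> 0}" 
    proof safe
      fix x assume "f x = 0" "\<psi> x \<noteq> 0"
      then show False using le[of x] by simp
    qed
    then have "norm (\<nu> \<psi>) \<le> C * sup_norm \<psi>" using C[OF \<psi>] by (simp add: supp_def closure_mono)
    also have "\<dots> \<le> \<bar>C\<bar> * sup_norm \<psi>" using sup_norm_nonneg[OF C_c_bounded[OF \<psi>]]
      by (intro mult_right_mono) auto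
    also have "\<dots> \<le> \<bar>C\<bar> * sup_norm f"
      by (intro mult_left_mono sup_norm_le order_trans[OF le sup_norm_upper] C_c_bounded f) auto
    finally show "norm (\<nu> \<psi>) \<le> \<bar>C\<bar> * sup_norm f" .
  qed
  then show ?thesis by (simp add: le_less_trans)
qed


section \<open>Integration of continuous functions\<close>

text \<open>Tightness. If \<open>\<psi>\<close> almost attains the supremum that defines \<open>variation \<nu> f\<close>, and \<open>\<psi>'\<close> is a competitor
  for the part of \<open>f\<close> outside the support of \<open>\<psi>\<close>, then \<open>\<psi> + c \<psi>'\<close> with \<open>|c| = 1\<close> is again a competitor
  for \<open>f\<close>. For a suitable phase \<open>c\<close> its value has modulus \<open>|\<nu> \<psi>| + |\<nu> \<psi>'|\<close>, so \<open>|\<nu> \<psi>'|\<close> is small.\<close>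

lemma variation_tail_le:
  fixes f :: "'n::finite cfun"
  assumes \<nu>: "radon_measure \<nu>" and fin: "variation \<nu> f < \<infinity>" and e: "0 < e"
  obtains R where "\<And>S. R \<le> S \<Longrightarrow> variation \<nu> (\<lambda>x. (1 - cutoff S x) * f x) \<le> ennreal e"
proof (cases "variation \<nu> f = 0")
  case True
  have "variation \<nu> (\<lambda>x. (1 - cutoff S x) * f x) \<le> ennreal e" for S
  proof -
    have "variation \<nu> (\<lambda>x. (1 - cutoff S x) * f x) \<le> variation \<nu> f"
      by (rule variation_mono) (simp add: norm_mult mult_left_le_one_le norm_one_minus_cutoff_le_1)
    then show ?thesis using True by simp
  qed
  then show ?thesis using that by blast
next
  case False
  obtain V where V: "variation \<nu> f = ennreal V" "0 \<le> V" using fin by (cases "variation \<nu> f") auto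
  have "V > 0" using False V by (cases "V = 0") auto
  \<comment> \<open>The minimum keeps \<open>V - e'\<close> nonnegative, which forces \<open>\<nu> \<psi> \<noteq> 0\<close> below.\<close>
  define e' where "e' = min e V"
  have "ennreal (V - e') < variation \<nu> f" using V e \<open>V > 0\<close> unfolding V e'_def
    by (subst ennreal_less_iff) auto
  then obtain \<psi> where \<psi>: "\<psi> \<in> C_c" "\<And>x. norm (\<psi> x) \<le> norm (f x)" and gt: "V - e' < norm (\<nu> \<psi>)"
  proof -
    assume a: "\<And>\<psi>. \<psi> \<in> C_c \<Longrightarrow> (\<And>x. norm (\<psi> x) \<le> norm (f x)) \<Longrightarrow> V - e' < norm (\<nu> \<psi>) \<Longrightarrow> thesis"
    show thesis
    proof (rule ccontr)
      assume "\<not> thesis"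
      then have "variation \<nu> f \<le> ennreal (V - e')"
        using a by (intro variation_least ennreal_leI) (meson not_le)
      then show False using \<open>ennreal (V - e') < variation \<nu> f\<close> by simp
    qed
  qed
  obtain R where R: "\<And>x. R < norm x \<Longrightarrow> \<psi> x = 0" using C_cE[OF \<psi>(1)] by blast
  have "variation \<nu> (\<lambda>x. (1 - cutoff S x) * f x) \<le> ennreal e" if S: "R \<le> S" for S
  proof (rule variation_least, rule ennreal_leI)
    fix \<psi>' :: "'n cfun" assume \<psi>': "\<psi>' \<in> C_c" and le: "\<And>x. norm (\<psi>' x) \<le> norm ((1 - cutoff S x) * f x)"
    define c where "c = (if \<nu> \<psi>' = 0 then 1 else sgn (\<nu> \<psi>) / sgn (\<nu> \<psi>'))"
    have "V - e' \<ge> 0" by (simp add: e'_def)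
    then have nz: "\<nu> \<psi> \<noteq> 0" using gt by force
    have nc: "norm c = 1" using nz by (auto simp: c_def norm_divide norm_sgn)
    have "norm (\<nu> (\<lambda>x. \<psi> x + c * \<psi>' x)) = norm (\<nu> \<psi>) + norm (\<nu> \<psi>')"
    proof -
      have s: "norm z *\<^sub>R sgn z = z" for z :: complex by (cases "z=0") (auto simp: sgn_div_norm)
      have "\<nu> (\<lambda>x. \<psi> x + c * \<psi>' x) = \<nu> \<psi> + c * \<nu> \<psi>'"
        using radon_add[OF \<nu> \<psi>(1) C_c_scale[OF \<psi>']] radon_scale[OF \<nu> \<psi>'] by metis
      also have "c * \<nu> \<psi>' = norm (\<nu> \<psi>') *\<^sub>R sgn (\<nu> \<psi>)"
      proof (cases "\<nu> \<psi>' = 0")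
        case False
        have "c * \<nu> \<psi>' = sgn (\<nu> \<psi>) / sgn (\<nu> \<psi>') * (norm (\<nu> \<psi>') *\<^sub>R sgn (\<nu> \<psi>'))"
          using False by (simp only: s c_def if_False)
        also have "\<dots> = norm (\<nu> \<psi>') *\<^sub>R sgn (\<nu> \<psi>)"
          using False by (simp add: sgn_zero_iff)
        finally show ?thesis .
      qed simp
      also have "\<nu> \<psi> + norm (\<nu> \<psi>') *\<^sub>R sgn (\<nu> \<psi>) = (norm (\<nu> \<psi>) + norm (\<nu> \<psi>')) *\<^sub>R sgn (\<nu> \<psi>)"
        by (simp add: scaleR_add_left s)
      finally show ?thesis using nz by (simp add: norm_sgn)
    qed
    moreover have "ennreal (norm (\<nu> (\<lambda>x. \<psi> x + c * \<psi>' x))) \<le> variation \<nu> f"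
    proof (rule variation_upper[OF C_c_add[OF \<psi>(1) C_c_scale[OF \<psi>']]])
      fix x
      show "norm (\<psi> x + c * \<psi>' x) \<le> norm (f x)"
      proof (cases "norm x \<le> S")
        case True
        then have "\<psi>' x = 0" using le[of x] by (simp add: cutoff_eq_1)
        then show ?thesis using \<psi>(2) by simp
      next
        case False
        then have "\<psi> x = 0" using S R by simp
        moreover have "norm (\<psi>' x) \<le> norm (f x)"
          using le[of x] norm_one_minus_cutoff_le_1[of S x]
          by (smt (verit) mult_left_le_one_le norm_ge_zero norm_mult)
        ultimately show ?thesis using nc by (simp add: norm_mult)
      qed
    qed
    ultimately have "norm (\<nu> \<psi>) + norm (\<nu> \<psi>') \<le> V"
      using V ennreal_le_iff by metis
    then show "norm (\<nu> \<psi>') \<le> e" using gt norm_ge_zero[of "\<nu> \<psi>"] unfolding e'_def min_def by (smt (verit))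
  qed
  then show ?thesis using that by blast
qed

lemma radon_has_integralE:
  assumes "radon_has_integral \<nu> f I"
  obtains \<phi> where "\<And>k. \<phi> k \<in> C_c"
    "(\<lambda>k. variation_upper_integral \<nu> (\<lambda>x. ennreal (norm (f x - \<phi> k x)))) \<longlonglongrightarrow> 0"
    "(\<lambda>k. \<nu> (\<phi> k)) \<longlonglongrightarrow> I"
  using assms by (auto simp: radon_has_integral_def)

lemma radon_has_integral_bound:
  fixes f :: "'n::finite cfun"
  assumes \<nu>: "radon_measure \<nu>" and f: "continuous_on UNIV f" and I: "radon_has_integral \<nu> f I"
  shows "ennreal (norm I) \<le> variation \<nu> f"
proof -
  obtain \<phi> where \<phi>: "\<And>k. \<phi> k \<in> C_c"
    and lim0: "(\<lambda>k. variation_upper_integral \<nu> (\<lambda>x. ennreal (norm (f x - \<phi> k x)))) \<longlonglongrightarrow> 0"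
    and lim: "(\<lambda>k. \<nu> (\<phi> k)) \<longlonglongrightarrow> I"
    using radon_has_integralE[OF I] by blast
  have eq: "variation_upper_integral \<nu> (\<lambda>x. ennreal (norm (f x - \<phi> k x))) = variation \<nu> (\<lambda>x. f x - \<phi> k x)" for k
    using variation_upper_integral_continuous[of "\<lambda>x. f x - \<phi> k x" \<nu>] C_cD_cont[OF \<phi>] f
    by (simp add: continuous_intros)
  have "(\<lambda>k. variation \<nu> f + variation \<nu> (\<lambda>x. f x - \<phi> k x)) \<longlonglongrightarrow> variation \<nu> f + 0"
    using lim0 unfolding eq by (intro tendsto_add tendsto_const)
  moreover have "(\<lambda>k. ennreal (norm (\<nu> (\<phi> k)))) \<longlonglongrightarrow> ennreal (norm I)"
    using lim by (intro tendsto_ennrealI tendsto_norm)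
  moreover have "ennreal (norm (\<nu> (\<phi> k))) \<le> variation \<nu> f + variation \<nu> (\<lambda>x. f x - \<phi> k x)" for k
  proof -
    have "ennreal (norm (\<nu> (\<phi> k))) \<le> variation \<nu> (\<phi> k)" by (rule variation_upper) (auto simp: \<phi>)
    also have "\<dots> \<le> variation \<nu> f + variation \<nu> (\<lambda>x. f x - \<phi> k x)"
      using C_cD_cont[OF \<phi>] f
      by (intro variation_triangle[OF \<nu>]) (auto intro!: continuous_intros, metis norm_minus_commute norm_triangle_sub)
    finally show ?thesis .
  qed
  ultimately have "ennreal (norm I) \<le> variation \<nu> f + 0" by (blast intro: LIMSEQ_le)
  then show ?thesis by simp
qed

lemma radon_has_integral_add:
  fixes f g :: "'n::finite cfun"
  assumes \<nu>: "radon_measure \<nu>" and f: "continuous_on UNIV f" and g: "continuous_on UNIV g"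
    and I: "radon_has_integral \<nu> f I" and J: "radon_has_integral \<nu> g J"
  shows "radon_has_integral \<nu> (\<lambda>x. f x + c * g x) (I + c * J)"
proof -
  obtain \<phi> where \<phi>: "\<And>k. \<phi> k \<in> C_c"
    and \<phi>0: "(\<lambda>k. variation_upper_integral \<nu> (\<lambda>x. ennreal (norm (f x - \<phi> k x)))) \<longlonglongrightarrow> 0"
    and limI: "(\<lambda>k. \<nu> (\<phi> k)) \<longlonglongrightarrow> I"
    using radon_has_integralE[OF I] by blast
  obtain \<psi> where \<psi>: "\<And>k. \<psi> k \<in> C_c"
    and \<psi>0: "(\<lambda>k. variation_upper_integral \<nu> (\<lambda>x. ennreal (norm (g x - \<psi> k x)))) \<longlonglongrightarrow> 0"
    and limJ: "(\<lambda>k. \<nu> (\<psi> k)) \<longlonglongrightarrow> J"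
    using radon_has_integralE[OF J] by blast
  have fc: "continuous_on UNIV (\<lambda>x. f x - \<phi> k x)" and gc: "continuous_on UNIV (\<lambda>x. g x - \<psi> k x)" for k
    using f g C_cD_cont[OF \<phi>] C_cD_cont[OF \<psi>] by (auto intro!: continuous_intros)
  define \<theta> where "\<theta> k x = \<phi> k x + c * \<psi> k x" for k x
  have \<theta>: "\<theta> k \<in> C_c" for k unfolding \<theta>_def by (intro C_c_add C_c_scale \<phi> \<psi>)
  have hc: "continuous_on UNIV (\<lambda>x. (f x + c * g x) - \<theta> k x)" for k
    using f g C_cD_cont[OF \<theta>] by (intro continuous_intros)
  have bd: "variation \<nu> (\<lambda>x. (f x + c * g x) - \<theta> k x)
      \<le> variation \<nu> (\<lambda>x. f x - \<phi> k x) + ennreal (norm c) * variation \<nu> (\<lambda>x. g x - \<psi> k x)" for k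
  proof -
    have "variation \<nu> (\<lambda>x. (f x + c * g x) - \<theta> k x) \<le> variation \<nu> (\<lambda>x. f x - \<phi> k x) + variation \<nu> (\<lambda>x. c * (g x - \<psi> k x))"
    proof (rule variation_triangle[OF \<nu> fc])
      show "norm (f x + c * g x - \<theta> k x) \<le> norm (f x - \<phi> k x) + norm (c * (g x - \<psi> k x))" for x
        unfolding \<theta>_def by (rule order_trans[OF _ norm_triangle_ineq]) (simp add: algebra_simps)
    qed (intro continuous_intros gc)
    also have "variation \<nu> (\<lambda>x. c * (g x - \<psi> k x)) \<le> ennreal (norm c) * variation \<nu> (\<lambda>x. g x - \<psi> k x)"
      by (rule variation_scale_le[OF \<nu>]) (auto simp: norm_mult)
    finally show ?thesis by (simp add: add_left_mono)
  qed
  have "(\<lambda>k. variation \<nu> (\<lambda>x. f x - \<phi> k x) + ennreal (norm c) * variation \<nu> (\<lambda>x. g x - \<psi> k x)) \<longlonglongrightarrow> 0 + ennreal (norm c) * 0"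
    using \<phi>0 \<psi>0 unfolding variation_upper_integral_continuous[OF fc] variation_upper_integral_continuous[OF gc]
    by (intro tendsto_add tendsto_mult_ennreal tendsto_const) auto
  then have lim0: "(\<lambda>k. variation \<nu> (\<lambda>x. f x - \<phi> k x) + ennreal (norm c) * variation \<nu> (\<lambda>x. g x - \<psi> k x)) \<longlonglongrightarrow> 0"
    by simp
  have "(\<lambda>k. variation \<nu> (\<lambda>x. (f x + c * g x) - \<theta> k x)) \<longlonglongrightarrow> 0"
    by (rule tendsto_sandwich[OF _ _ tendsto_const lim0]) (simp_all add: bd)
  moreover have "(\<lambda>k. \<nu> (\<theta> k)) \<longlonglongrightarrow> I + c * J"
    unfolding \<theta>_def radon_add[OF \<nu> \<phi> C_c_scale[OF \<psi>]] radon_scale[OF \<nu> \<psi>]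
    by (intro tendsto_intros limI limJ)
  ultimately show ?thesis
    unfolding radon_has_integral_def using \<theta>
    by (intro exI[of _ \<theta>]) (simp add: variation_upper_integral_continuous[OF hc])
qed

lemma radon_has_integral_C_c:
  fixes f :: "'n::finite cfun"
  assumes "radon_measure \<nu>" "f \<in> C_c"
  shows "radon_has_integral \<nu> f (\<nu> f)"
proof -
  have "variation \<nu> (\<lambda>x. 0 :: complex) = 0"
  proof -
    have "variation \<nu> (\<lambda>x. 0) \<le> ennreal 0 * variation \<nu> f" by (rule variation_scale_le[OF assms(1)]) auto
    then show ?thesis by simp
  qed
  then have "variation_upper_integral \<nu> (\<lambda>x. ennreal (norm (f x - f x))) = 0"
    using variation_upper_integral_continuous[of "\<lambda>x. 0" \<nu>] by simp
  then show ?thesis unfolding radon_has_integral_def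
    using assms(2) by (intro exI[of _ "\<lambda>_. f"]) simp
qed

text \<open>By linearity \<open>I - J\<close> is an integral of the zero function, whose variation is \<open>0\<close>.\<close>

lemma radon_has_integral_unique:
  fixes f :: "'n::finite cfun"
  assumes \<nu>: "radon_measure \<nu>" and f: "continuous_on UNIV f"
    and "radon_has_integral \<nu> f I" "radon_has_integral \<nu> f J"
  shows "I = J"
proof -
  have "radon_has_integral \<nu> (\<lambda>x. f x + (-1) * f x) (I + (-1) * J)"
    using assms by (intro radon_has_integral_add)
  then have "radon_has_integral \<nu> (\<lambda>x. 0) (I - J)" by simp
  then have "ennreal (norm (I - J)) \<le> variation \<nu> (\<lambda>x. 0)"
    by (intro radon_has_integral_bound[OF \<nu>]) auto
  also have "\<dots> \<le> ennreal 0 * variation \<nu> f" by (rule variation_scale_le[OF \<nu>]) auto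
  finally show ?thesis by (simp add: ennreal_eq_0_iff)
qed

lemma radon_integral_eqI:
  fixes f :: "'n::finite cfun"
  assumes "radon_measure \<nu>" "continuous_on UNIV f" "radon_has_integral \<nu> f I"
  shows "radon_integral \<nu> f = I"
  unfolding radon_integral_def using assms radon_has_integral_unique by blast

lemma radon_integral_C_c:
  "radon_measure \<nu> \<Longrightarrow> f \<in> C_c \<Longrightarrow> radon_integral \<nu> f = \<nu> f"
  by (intro radon_integral_eqI radon_has_integral_C_c C_cD_cont)

text \<open>The cutoffs of \<open>f\<close> converge to \<open>f\<close> in the variation seminorm by tightness, so their integrals
  form a Cauchy sequence.\<close>

lemma radon_has_integral_radon_integral:
  fixes f :: "'n::finite cfun"
  assumes \<nu>: "radon_measure \<nu>" and f: "continuous_on UNIV f" and fin: "variation \<nu> f < \<infinity>"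
  shows "radon_has_integral \<nu> f (radon_integral \<nu> f)"
proof -
  define \<phi> where "\<phi> k x = cutoff (real k) x * f x" for k :: nat and x
  have \<phi>: "\<phi> k \<in> C_c" for k
    unfolding \<phi>_def using C_c_mult[OF cutoff_C_c f] by (simp add: mult.commute)
  have dc: "continuous_on UNIV (\<lambda>x. f x - \<phi> k x)" for k
    using f C_cD_cont[OF \<phi>] by (intro continuous_intros)
  have tail: "\<exists>N. \<forall>k\<ge>N. variation \<nu> (\<lambda>x. f x - \<phi> k x) \<le> ennreal e" if e: "0 < e" for e
  proof -
    obtain R where R: "\<And>S. R \<le> S \<Longrightarrow> variation \<nu> (\<lambda>x. (1 - cutoff S x) * f x) \<le> ennreal e"
      using variation_tail_le[OF \<nu> fin e] by blast
    have "variation \<nu> (\<lambda>x. f x - \<phi> k x) \<le> ennreal e" if "k \<ge> nat \<lceil>R\<rceil>" for k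
      using R[of "real k"] that by (simp add: \<phi>_def algebra_simps nat_ceiling_le_eq)
    then show ?thesis by blast
  qed
  have lim0: "(\<lambda>k. variation \<nu> (\<lambda>x. f x - \<phi> k x)) \<longlonglongrightarrow> 0"
  proof (rule order_tendstoI)
    fix a :: ennreal assume "0 < a"
    then obtain b where b: "0 < b" "b < a" using dense by blast
    then obtain e where e: "b = ennreal e" "0 < e" by (cases b) auto
    show "\<forall>\<^sub>F k in sequentially. variation \<nu> (\<lambda>x. f x - \<phi> k x) < a"
      using tail[OF e(2)] b e by (meson eventually_sequentially le_less_trans)
  qed simp
  have "Cauchy (\<lambda>k. \<nu> (\<phi> k))"
  proof (rule CauchyI)
    fix e :: real assume "0 < e"
    then have "0 < e / 3" by simp
    then obtain N where N: "\<And>k. k \<ge> N \<Longrightarrow> variation \<nu> (\<lambda>x. f x - \<phi> k x) \<le> ennreal (e/3)"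
      using tail by blast
    have "norm (\<nu> (\<phi> m) - \<nu> (\<phi> n)) < e" if "m \<ge> N" "n \<ge> N" for m n
    proof -
      have "ennreal (norm (\<nu> (\<lambda>x. \<phi> m x - \<phi> n x))) \<le> variation \<nu> (\<lambda>x. \<phi> m x - \<phi> n x)"
        by (rule variation_upper) (auto intro: C_c_diff \<phi>)
      also have "\<dots> \<le> variation \<nu> (\<lambda>x. f x - \<phi> n x) + variation \<nu> (\<lambda>x. f x - \<phi> m x)"
        by (rule variation_triangle[OF \<nu> dc dc]) (rule order_trans[OF _ norm_triangle_ineq4], simp)
      also have "\<dots> \<le> ennreal (e/3) + ennreal (e/3)" using N that by (intro add_mono) auto
      also have "\<dots> = ennreal (2*e/3)" using \<open>0 < e\<close> by (simp flip: ennreal_plus)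
      finally have "norm (\<nu> (\<lambda>x. \<phi> m x - \<phi> n x)) \<le> 2*e/3" using \<open>0 < e\<close> by (simp add: ennreal_le_iff)
      then show ?thesis using \<open>0 < e\<close> by (simp add: radon_diff[OF \<nu> \<phi> \<phi>])
    qed
    then show "\<exists>M. \<forall>m\<ge>M. \<forall>n\<ge>M. norm (\<nu> (\<phi> m) - \<nu> (\<phi> n)) < e" by blast
  qed
  then obtain I where I: "(\<lambda>k. \<nu> (\<phi> k)) \<longlonglongrightarrow> I" using Cauchy_convergent_iff convergent_def by blast
  have "radon_has_integral \<nu> f I"
    unfolding radon_has_integral_def
    using \<phi> I lim0 variation_upper_integral_continuous[OF dc] by (intro exI[of _ \<phi>]) auto
  then show ?thesis using radon_integral_eqI[OF \<nu> f] by simp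
qed

lemma radon_integrable_continuous:
  "radon_measure \<nu> \<Longrightarrow> continuous_on UNIV f \<Longrightarrow> variation \<nu> f < \<infinity> \<Longrightarrow> radon_integrable \<nu> f"
  unfolding radon_integrable_def using radon_has_integral_radon_integral by blast

lemma radon_integral_bound:
  "radon_measure \<nu> \<Longrightarrow> continuous_on UNIV f \<Longrightarrow> variation \<nu> f < \<infinity> \<Longrightarrow>
    ennreal (norm (radon_integral \<nu> f)) \<le> variation \<nu> f"
  using radon_has_integral_bound radon_has_integral_radon_integral by blast

lemma radon_integral_add_scale:
  fixes f g :: "'n::finite cfun"
  assumes "radon_measure \<nu>" "continuous_on UNIV f" "variation \<nu> f < \<infinity>" "continuous_on UNIV g" "variation \<nu> g < \<infinity>"
  shows "radon_integral \<nu> (\<lambda>x. f x + c * g x) = radon_integral \<nu> f + c * radon_integral \<nu> g"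
  using assms
  by (intro radon_integral_eqI radon_has_integral_add radon_has_integral_radon_integral continuous_intros)

lemma radon_integral_truncation_bound:
  fixes f :: "'n::finite cfun"
  assumes \<nu>: "radon_measure \<nu>" and f: "continuous_on UNIV f"
    and fin: "variation \<nu> f < \<infinity>" and e: "0 \<le> e"
    and tail: "variation \<nu> (\<lambda>x. (1 - cutoff R x) * f x) \<le> ennreal e"
  shows "norm (radon_integral \<nu> f - \<nu> (\<lambda>x. f x * cutoff R x)) \<le> e"
proof -
  have C: "(\<lambda>x. f x * cutoff R x) \<in> C_c" by (intro C_c_mult cutoff_C_c f)
  have tc: "continuous_on UNIV (\<lambda>x. (1 - cutoff R x) * f x)" by (intro continuous_intros f)
  have "radon_integral \<nu> (\<lambda>x. f x + (-1) * (f x * cutoff R x))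
      = radon_integral \<nu> f + (-1) * radon_integral \<nu> (\<lambda>x. f x * cutoff R x)"
    by (intro radon_integral_add_scale \<nu> f fin C_cD_cont[OF C] variation_C_c_finite[OF \<nu> C])
  then have "radon_integral \<nu> f - \<nu> (\<lambda>x. f x * cutoff R x) = radon_integral \<nu> (\<lambda>x. (1 - cutoff R x) * f x)"
    by (simp add: radon_integral_C_c[OF \<nu> C] algebra_simps)
  moreover have "ennreal (norm (radon_integral \<nu> (\<lambda>x. (1 - cutoff R x) * f x))) \<le> ennreal e"
    using tail by (intro order_trans[OF radon_integral_bound[OF \<nu> tc] tail]) (simp add: le_less_trans)
  ultimately show ?thesis using e by (simp add: ennreal_le_iff)
qed

lemma radon_integral_limit_cutoff:
  fixes f :: "'n::finite cfun"
  assumes \<nu>: "radon_measure \<nu>" and f: "continuous_on UNIV f" and fin: "variation \<nu> f < \<infinity>"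
  shows "(\<lambda>k. \<nu> (\<lambda>x. f x * cutoff (real k) x)) \<longlonglongrightarrow> radon_integral \<nu> f"
proof (rule LIMSEQ_I)
  fix e :: real assume e: "0 < e"
  then have "0 < e / 2" by simp
  from variation_tail_le[OF \<nu> fin this]
  obtain R where R: "\<And>S. R \<le> S \<Longrightarrow> variation \<nu> (\<lambda>x. (1 - cutoff S x) * f x) \<le> ennreal (e / 2)" by blast
  have "norm (\<nu> (\<lambda>x. f x * cutoff (real k) x) - radon_integral \<nu> f) < e" if "k \<ge> nat \<lceil>R\<rceil>" for k
    using radon_integral_truncation_bound[OF \<nu> f fin _ R[of "real k"]] that e
    by (simp add: nat_ceiling_le_eq norm_minus_commute)
  then show "\<exists>no. \<forall>n\<ge>no. norm (\<nu> (\<lambda>x. f x * cutoff (real n) x) - radon_integral \<nu> f) < e" by blast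
qed


section \<open>Lebesgue integrals on Euclidean space and an integrable weight\<close>

text \<open>The product formulas for \<open>Pi\<^sub>M\<close>, with the product indexed by the coordinates instead of by the
  standard basis vectors.\<close>

lemma
  fixes f :: "'n::finite \<Rightarrow> real \<Rightarrow> 'b::{real_normed_field, banach, second_countable_topology}"
  assumes int: "\<And>j. integrable lborel (f j)"
  shows integrable_prod_coordinates: "integrable lborel (\<lambda>x::real^'n. \<Prod>j\<in>UNIV. f j (x $ j))" (is ?A)
    and integral_prod_coordinates:
      "(\<integral>x. (\<Prod>j\<in>UNIV. f j (x $ j)) \<partial>(lborel :: (real^'n) measure)) = (\<Prod>j\<in>UNIV. \<integral>x. f j x \<partial>lborel)" (is ?B)
proof -
  interpret product_sigma_finite "\<lambda>b::real^'n. (lborel :: real measure)" ..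
  define idx :: "real^'n \<Rightarrow> 'n" where "idx b = (THE j. b = axis j 1)" for b
  have idx: "idx (axis j 1) = j" for j
    unfolding idx_def by (rule the_equality) (auto simp: axis_eq_axis)
  have Basis: "(Basis :: (real^'n) set) = (\<lambda>j. axis j 1) ` UNIV"
    by (auto simp: Basis_vec_def)
  have inj: "inj (\<lambda>j::'n. axis j (1::real))" by (auto simp: inj_on_def axis_eq_axis)
  have prod: "(\<Prod>b\<in>Basis. F b) = (\<Prod>j\<in>UNIV. F (axis j 1))" for F :: "real^'n \<Rightarrow> 'b"
    unfolding Basis by (subst prod.reindex[OF inj]) simp
  have meas [measurable]: "f j \<in> borel_measurable borel" for j using int[of j] by simp
  have comp: "(\<Sum>b\<in>Basis. y b *\<^sub>R b) $ j = y (axis j 1)" for y :: "real^'n \<Rightarrow> real" and j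
    unfolding Basis
    by (subst sum.reindex[OF inj]) (simp add: axis_def if_distrib sum.delta cong: if_cong)
  have eq: "(\<Prod>j\<in>UNIV. f j ((\<Sum>b\<in>Basis. y b *\<^sub>R b) $ j)) = (\<Prod>b\<in>Basis. f (idx b) (y b))" for y :: "real^'n \<Rightarrow> real"
    unfolding comp prod idx ..
  have [measurable]: "(\<lambda>x::real^'n. x $ j) \<in> borel_measurable borel" for j
    by (intro borel_measurable_continuous_onI continuous_intros)
  have m: "(\<lambda>x::real^'n. \<Prod>j\<in>UNIV. f j (x $ j)) \<in> borel_measurable borel"
    by measurable
  have s: "(\<lambda>y. \<Sum>b\<in>Basis. y b *\<^sub>R b) \<in> (\<Pi>\<^sub>M b\<in>(Basis :: (real^'n) set). lborel) \<rightarrow>\<^sub>M borel"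
    by measurable
  show ?A
    by (subst lborel_eq, subst integrable_distr_eq[OF s m], unfold eq)
      (intro product_integrable_prod int finite_Basis)
  show ?B
    by (subst lborel_eq, subst integral_distr[OF s m], unfold eq)
      (subst product_integral_prod, auto intro: int simp: prod idx)
qed

definition weight :: "real^'n \<Rightarrow> real" where
  "weight x = (\<Prod>j\<in>UNIV. inverse (1 + (x $ j)\<^sup>2))"

lemma one_plus_square_pos: "0 < 1 + (t::real)\<^sup>2" by (simp add: add_pos_nonneg)

lemma weight_pos: "0 < weight x"
  unfolding weight_def by (intro prod_pos) (simp add: one_plus_square_pos)

lemma weight_nonneg: "0 \<le> weight x"
  using weight_pos[of x] by simp

lemma weight_continuous[continuous_intros]: "continuous_on S (weight :: real^'n::finite \<Rightarrow> real)"
  unfolding weight_def using one_plus_square_pos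
  by (intro continuous_intros) (simp add: add_nonneg_eq_0_iff)

lemma has_bochner_integral_inverse_1_plus_square:
  "has_bochner_integral lborel (\<lambda>x::real. inverse (1 + x\<^sup>2)) pi"
proof -
  have "interval_lebesgue_integral lborel (-\<infinity>) \<infinity> (\<lambda>x::real. inverse (1 + x\<^sup>2))
      = (\<integral>x. inverse (1 + x\<^sup>2) \<partial>(lborel :: real measure))"
    by (simp add: interval_lebesgue_integral_def einterval_def set_lebesgue_integral_def)
  moreover have "integrable lborel (\<lambda>x::real. inverse (1 + x\<^sup>2))"
    using integrable_inverse_1_plus_square by (simp add: einterval_def set_integrable_def)
  ultimately show ?thesis
    using LBINT_inverse_1_plus_square by (simp add: has_bochner_integral_iff)
qed

lemma weight_integrable: "integrable lborel (weight :: real^'n::finite \<Rightarrow> real)"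
  and weight_integral: "integral\<^sup>L lborel (weight :: real^'n::finite \<Rightarrow> real) = pi ^ CARD('n)"
proof -
  have "integrable lborel (\<lambda>x::real. inverse (1 + x\<^sup>2))" "(\<integral>x. inverse (1 + x\<^sup>2) \<partial>(lborel :: real measure)) = pi"
    using has_bochner_integral_inverse_1_plus_square by (simp_all add: has_bochner_integral_iff)
  then show "integrable lborel (weight :: real^'n::finite \<Rightarrow> real)"
    "integral\<^sup>L lborel (weight :: real^'n::finite \<Rightarrow> real) = pi ^ CARD('n)"
    unfolding weight_def using integrable_prod_coordinates[of "\<lambda>_ x. inverse (1 + x\<^sup>2)"]
      integral_prod_coordinates[of "\<lambda>_ x. inverse (1 + x\<^sup>2)"] by simp_all
qed

text \<open>In each coordinate \<open>1 + t\<^sup>2 \<le> 3 (1 + s\<^sup>2)\<close> if \<open>|s - t| \<le> 1\<close>.\<close>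

lemma weight_slowly_varying:
  fixes x y :: "real^'n::finite"
  assumes "norm (x - y) \<le> 1"
  shows "weight x \<le> 3 ^ CARD('n) * weight y"
proof -
  have "inverse (1 + (x $ j)\<^sup>2) \<le> 3 * inverse (1 + (y $ j)\<^sup>2)" for j
  proof -
    have "\<bar>(x - y) $ j\<bar> \<le> 1" using component_le_norm_cart[of "x - y" j] assms by linarith
    then have "(y $ j - x $ j)\<^sup>2 \<le> 1" using abs_square_le_1[of "(x - y) $ j"]
      by (simp add: power2_commute)
    \<comment> \<open>The square is \<open>2 (y\<^sub>j - x\<^sub>j)\<^sup>2 + 2 x\<^sub>j\<^sup>2 - y\<^sub>j\<^sup>2\<close>.\<close>
    moreover have "0 \<le> (y $ j - 2 * x $ j)\<^sup>2" by simp
    ultimately have "(y $ j)\<^sup>2 \<le> 2 + 2 * (x $ j)\<^sup>2" by (simp add: power2_eq_square algebra_simps)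
    then have "1 + (y $ j)\<^sup>2 \<le> 3 * (1 + (x $ j)\<^sup>2)" using zero_le_power2[of "x $ j"] unfolding ring_distribs by linarith
    then show ?thesis using one_plus_square_pos[of "x $ j"] one_plus_square_pos[of "y $ j"]
      by (simp add: field_simps)
  qed
  then have "weight x \<le> (\<Prod>j\<in>UNIV. 3 * inverse (1 + (y $ j)\<^sup>2))"
    unfolding weight_def by (intro prod_mono) (auto simp: add_nonneg_nonneg)
  then show ?thesis by (simp add: weight_def prod.distrib)
qed

lemma C_c_integrable:
  fixes f :: "'n::finite cfun"
  assumes "f \<in> C_c"
  shows "integrable lborel f"
proof -
  have "compact (supp f)" using assms by (simp add: C_c_def)
  then have "integrable lborel (\<lambda>x. indicator (supp f) x *\<^sub>R f x)"
    using C_cD_cont[OF assms] by (intro borel_integrable_compact) (auto intro: continuous_on_subset)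
  moreover have "(\<lambda>x. indicator (supp f) x *\<^sub>R f x) = f"
    using supp_zero[of _ f] by (auto simp: fun_eq_iff indicator_def)
  ultimately show ?thesis by simp
qed

lemma integrable_weight_dominated:
  fixes f :: "'n::finite cfun"
  assumes "continuous_on UNIV f" and "\<And>x. norm (f x) \<le> C * weight x"
  shows "integrable lborel f"
proof (rule Bochner_Integration.integrable_bound[of _ "\<lambda>x. C * weight x"])
  show "f \<in> borel_measurable lborel" using assms(1) by (simp add: borel_measurable_continuous_onI)
  show "integrable lborel (\<lambda>x::real^'n. C * weight x)" by (intro integrable_mult_right weight_integrable)
  show "AE x in lborel. norm (f x) \<le> norm (C * weight x)"
    using assms(2) by (intro always_eventually allI) (metis abs_ge_self order_trans real_norm_def)
qed

lemma
  fixes f :: "real^'n::finite \<Rightarrow> 'b::{banach, second_countable_topology}"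
  assumes f: "integrable lborel f" and c: "c \<noteq> 0"
  shows integrable_affine: "integrable lborel (\<lambda>x. f (t + c *\<^sub>R x))"
    and integral_affine: "integral\<^sup>L lborel f = \<bar>c\<bar> ^ CARD('n) *\<^sub>R (\<integral>x. f (t + c *\<^sub>R x) \<partial>lborel)"
proof -
  have [measurable]: "f \<in> borel_measurable borel" using f by simp
  have eq: "(lborel :: (real^'n) measure)
      = density (distr lborel borel (\<lambda>x. t + c *\<^sub>R x)) (\<lambda>_. ennreal (\<bar>c\<bar> ^ CARD('n)))"
    using lborel_affine[OF c, of t] by (simp add: ennreal_power)
  have "integrable (density (distr lborel borel (\<lambda>x. t + c *\<^sub>R x)) (\<lambda>_. ennreal (\<bar>c\<bar> ^ CARD('n)))) f"
    using f unfolding eq[symmetric] .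
  then have "integrable lborel (\<lambda>x. \<bar>c\<bar> ^ CARD('n) *\<^sub>R f (t + c *\<^sub>R x))"
    by (subst (asm) integrable_density) (auto simp: integrable_distr_eq)
  from integrable_scaleR_right[OF this, of "inverse (\<bar>c\<bar> ^ CARD('n))"]
  show "integrable lborel (\<lambda>x. f (t + c *\<^sub>R x))" using c by simp
  show "integral\<^sup>L lborel f = \<bar>c\<bar> ^ CARD('n) *\<^sub>R (\<integral>x. f (t + c *\<^sub>R x) \<partial>lborel)"
    by (subst eq, subst integral_density) (auto simp: integral_distr)
qed


section \<open>Plane waves\<close>

definition wave :: "real^'n::finite \<Rightarrow> 'n cfun" where
  "wave x y = exp (- 2 * of_real pi * \<i> * of_real (x \<bullet> y))"

lemma wave_exp: "wave x y = exp (\<i> * of_real (- 2 * pi * (x \<bullet> y)))"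
  by (simp add: wave_def mult_ac)

lemma norm_wave[simp]: "norm (wave x y) = 1"
  unfolding wave_exp by (rule norm_exp_i_times)

lemma wave_commute: "wave x y = wave y x"
  by (simp add: wave_def inner_commute)

lemma wave_add: "wave (x + x') y = wave x y * wave x' y"
  by (simp add: wave_def inner_add_left ring_distribs exp_add[symmetric])

lemma wave_minus_left: "wave (- x) y = wave x (- y)"
  by (simp add: wave_def)

lemma wave_zero[simp]: "wave 0 y = 1"
  by (simp add: wave_def)

lemma wave_continuous[continuous_intros]:
  "continuous_on S f \<Longrightarrow> continuous_on S g \<Longrightarrow> continuous_on S (\<lambda>x. wave (f x) (g x))"
  unfolding wave_def by (intro continuous_intros)

lemma wave_measurable[measurable (raw)]:
  "f \<in> borel_measurable M \<Longrightarrow> g \<in> borel_measurable M \<Longrightarrow> (\<lambda>x. wave (f x) (g x)) \<in> borel_measurable M"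
  unfolding wave_def by measurable

lemma wave_taylor:
  fixes x v y :: "real^'n::finite"
  shows "norm (wave v y - 1) \<le> 2 * pi * \<bar>v \<bullet> y\<bar>"
    and "norm (wave v y - 1 + 2 * of_real pi * \<i> * of_real (v \<bullet> y)) \<le> (2 * pi * \<bar>v \<bullet> y\<bar>)\<^sup>2"
proof -
  define z where "z = \<i> * complex_of_real (- 2 * pi * (v \<bullet> y))"
  have z: "Re z = 0" "norm z = 2 * pi * \<bar>v \<bullet> y\<bar>" by (auto simp: z_def norm_mult abs_mult)
  have w: "wave v y = exp z" by (simp add: wave_exp z_def)
  show "norm (wave v y - 1) \<le> 2 * pi * \<bar>v \<bullet> y\<bar>" using Taylor_exp[of z 0] z w by simp
  have "2 * of_real pi * \<i> * of_real (v \<bullet> y) = - z" by (simp add: z_def)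
  then show "norm (wave v y - 1 + 2 * of_real pi * \<i> * of_real (v \<bullet> y)) \<le> (2 * pi * \<bar>v \<bullet> y\<bar>)\<^sup>2"
    using Taylor_exp[of z 1] z w by (simp add: power2_eq_square algebra_simps)
qed

lemma wave_lipschitz: "norm (wave x y - wave x' y) \<le> 2 * pi * norm (x - x') * norm y"
proof -
  have "wave x y - wave x' y = wave x' y * (wave (x - x') y - 1)"
    using wave_add[of "x - x'" x' y] by (simp add: algebra_simps)
  then have "norm (wave x y - wave x' y) = norm (wave (x - x') y - 1)" by (simp add: norm_mult)
  also have "\<dots> \<le> 2 * pi * \<bar>(x - x') \<bullet> y\<bar>" by (rule wave_taylor)
  also have "\<dots> \<le> 2 * pi * (norm (x - x') * norm y)"
    using Cauchy_Schwarz_ineq2 by (intro mult_left_mono) auto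
  finally show ?thesis by (simp add: mult.assoc)
qed

lemma fourier_wave: "fourier f x = (\<integral>y. wave x y * f y \<partial>lborel)"
  by (simp add: fourier_def wave_def)

lemma inv_fourier_wave: "inv_fourier f x = (\<integral>y. wave (- x) y * f y \<partial>lborel)"
  by (simp add: inv_fourier_def fourier_wave)

lemma fourier_measure_wave: "fourier_measure \<rho> x = radon_integral \<rho> (wave x)"
  by (simp add: fourier_measure_def wave_def[abs_def])

lemma wave_integrable: "integrable lborel f \<Longrightarrow> integrable lborel (\<lambda>y. wave x y * f y)"
  by (rule Bochner_Integration.integrable_bound[of _ f]) (auto simp: norm_mult)

lemma fourier_bounded: "norm (fourier f x) \<le> L1_norm f"
  unfolding fourier_wave L1_norm_def
  by (rule order_trans[OF integral_norm_bound]) (simp add: norm_mult)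

lemma fourier_continuous:
  fixes f :: "'n::finite cfun"
  assumes "integrable lborel f"
  shows "continuous_on S (fourier f)"
proof -
  have "isCont (fourier f) x" for x
    unfolding fourier_wave[abs_def] continuous_at_sequentially comp_def
  proof (intro allI impI)
    fix u :: "nat \<Rightarrow> real^'n" assume u: "u \<longlonglongrightarrow> x"
    show "(\<lambda>n. \<integral>y. wave (u n) y * f y \<partial>lborel) \<longlonglongrightarrow> (\<integral>y. wave x y * f y \<partial>lborel)"
    proof (rule integral_dominated_convergence[where w = "\<lambda>y. norm (f y)"])
      have "(\<lambda>n. wave (u n) y * f y) \<longlonglongrightarrow> wave x y * f y" for y
        unfolding wave_def by (intro tendsto_intros u)
      then show "AE y in lborel. (\<lambda>n. wave (u n) y * f y) \<longlonglongrightarrow> wave x y * f y" by simp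
    qed (use assms in \<open>auto simp: norm_mult\<close>)
  qed
  then show ?thesis by (simp add: continuous_at_imp_continuous_on)
qed

lemma fourier_add_scale:
  "integrable lborel f \<Longrightarrow> integrable lborel g \<Longrightarrow>
    fourier (\<lambda>y. f y + c * g y) x = fourier f x + c * fourier g x"
  unfolding fourier_wave
  by (simp add: ring_distribs mult.left_commute[of _ c] wave_integrable)


section \<open>Interchanging a Radon measure with a Lebesgue integral\<close>

instance bcontfun :: (metric_space, banach) banach ..

lemma C_c_integral_cbox:
  fixes f :: "'n::finite cfun"
  assumes "f \<in> C_c" "\<And>x. x \<notin> cbox a b \<Longrightarrow> f x = 0"
  shows "integral (cbox a b) f = integral\<^sup>L lborel f"
proof -
  have "(f has_integral integral\<^sup>L lborel f) UNIV"
    by (rule has_integral_integral_lborel[OF C_c_integrable[OF assms(1)]])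
  moreover have "f = (\<lambda>x. if x \<in> cbox a b then f x else 0)" using assms(2) by auto
  ultimately have "(f has_integral integral\<^sup>L lborel f) (cbox a b)"
    using has_integral_restrict_UNIV by metis
  then show ?thesis by (rule integral_unique)
qed

text \<open>The map \<open>t \<mapsto> G t\<close> is continuous and compactly supported with values in the Banach space of bounded
  continuous functions. On that space \<open>u \<mapsto> \<nu>(u \<chi>)\<close> is bounded and linear, where \<open>\<chi>\<close> is a cutoff that
  equals \<open>1\<close> on the supports of all \<open>G t\<close>, so it commutes with the integral over \<open>t\<close>; so do the
  evaluations, which identify the integral of \<open>G\<close> with the pointwise one. The vector-valued integral
  is that of Henstock and Kurzweil, which does not ask for a separable range space.\<close>

lemma radon_lebesgue_interchange:
  fixes \<nu> :: "'n::finite functional" and G :: "real^'n \<Rightarrow> 'n cfun"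
  assumes \<nu>: "radon_measure \<nu>"
    and cont: "continuous_on UNIV (\<lambda>(t, x). G t x)"
    and zero: "\<And>t x. R < norm t \<or> S < norm x \<Longrightarrow> G t x = 0"
  shows "(\<lambda>t. \<nu> (G t)) \<in> C_c"
    and "(\<lambda>x. \<integral>t. G t x \<partial>lborel) \<in> C_c"
    and "\<nu> (\<lambda>x. \<integral>t. G t x \<partial>lborel) = (\<integral>t. \<nu> (G t) \<partial>lborel)"
proof -
  have Gx: "continuous_on UNIV (G t)" for t
    using continuous_on_compose2[OF cont, of UNIV "\<lambda>x. (t, x)"] by (simp add: continuous_intros)
  have Gt: "continuous_on UNIV (\<lambda>t. G t x)" for x
    using continuous_on_compose2[OF cont, of UNIV "\<lambda>t. (t, x)"] by (simp add: continuous_intros)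
  have GC: "G t \<in> C_c" for t using Gx zero by (intro C_cI[of _ S]) auto
  have GtC: "(\<lambda>t. G t x) \<in> C_c" for x using Gt zero by (intro C_cI[of _ R]) auto
  define F where "F t = Bcontfun (G t)" for t
  have F: "apply_bcontfun (F t) = G t" for t
    unfolding F_def using Gx[of t] C_c_bounded[OF GC[of t]] by (intro Bcontfun_inverse) (simp add: bcontfun_def)
  have Fc: "continuous_on UNIV F"
  proof (unfold continuous_on_iff, intro ballI allI impI)
    fix t0 :: "real^'n" and e :: real assume e: "0 < e"
    then have e2: "e / 2 > 0" by simp
    obtain X0 where X0: "t0 \<in> X0" "open X0"
      and le: "\<forall>t\<in>X0 \<inter> UNIV. \<forall>x\<in>cball 0 S. dist ((\<lambda>(t, x). G t x) (t, x)) ((\<lambda>(t, x). G t x) (t0, x)) \<le> e / 2"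
      by (rule continuous_on_prod_compactE[OF continuous_on_subset[OF cont subset_UNIV] compact_cball UNIV_I e2])
    obtain d where d: "d > 0" "\<And>t. dist t t0 < d \<Longrightarrow> t \<in> X0"
      using X0 by (metis open_dist)
    have "dist (F t) (F t0) < e" if "dist t t0 < d" for t
    proof -
      have "dist (F t) (F t0) \<le> e / 2"
      proof (rule dist_bound)
        fix x show "dist (F t x) (F t0 x) \<le> e / 2"
          using le d(2)[OF that] zero[of _ x] e unfolding F by (cases "S < norm x") (auto simp: not_less)
      qed
      then show ?thesis using e by simp
    qed
    then show "\<exists>d>0. \<forall>t\<in>UNIV. dist t t0 < d \<longrightarrow> dist (F t) (F t0) < e" using d(1) by blast
  qed
  define L where "L u = \<nu> (\<lambda>x. apply_bcontfun u x * cutoff S x)" for u :: "(real^'n) \<Rightarrow>\<^sub>C complex"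
  have LC: "(\<lambda>x. apply_bcontfun u x * cutoff S x) \<in> C_c" for u
    by (intro C_c_mult cutoff_C_c continuous_on_apply_bcontfun)
  obtain V where V: "variation \<nu> (cutoff S) = ennreal V" "0 \<le> V"
    using variation_C_c_finite[OF \<nu> cutoff_C_c, of S] by (cases "variation \<nu> (cutoff S)") auto
  have L: "bounded_linear L"
  proof (rule bounded_linear_intro[where K = V])
    show "L (u + v) = L u + L v" for u v
      unfolding L_def radon_add[OF \<nu> LC LC, symmetric] by (simp add: ring_distribs)
    show "L (r *\<^sub>R u) = r *\<^sub>R L u" for r u
      unfolding L_def scaleR_conv_of_real[of r "\<nu> _"] radon_scale[OF \<nu> LC, symmetric]
      by (simp add: scaleR_conv_of_real mult.assoc)
    show "norm (L u) \<le> norm u * V" for u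
    proof -
      have "ennreal (norm (L u)) \<le> variation \<nu> (\<lambda>x. apply_bcontfun u x * cutoff S x)"
        unfolding L_def by (rule variation_upper[OF LC]) simp
      also have "\<dots> \<le> ennreal (norm u) * variation \<nu> (cutoff S)"
        by (rule variation_scale_le[OF \<nu>]) (auto simp: norm_mult norm_bounded intro: mult_right_mono)
      also have "\<dots> = ennreal (norm u * V)" using V by (simp add: ennreal_mult)
      finally show ?thesis using V ennreal_le_iff[of "norm u * V"] by (simp add: mult_nonneg_nonneg)
    qed
  qed
  have LF: "L (F t) = \<nu> (G t)" for t
  proof -
    have "(\<lambda>x. F t x * cutoff S x) = G t"
    proof
      fix x show "F t x * cutoff S x = G t x"
        using zero[of t x] unfolding F by (cases "norm x \<le> S") (auto simp: cutoff_eq_1)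
    qed
    then show ?thesis by (simp add: L_def)
  qed
  have "continuous_on UNIV (\<lambda>t. L (F t))"
    by (rule bounded_linear.continuous_on[OF L Fc])
  moreover have "\<nu> (G t) = 0" if "R < norm t" for t
  proof -
    have "G t = (\<lambda>x. 0 * G t x)" using zero that by (auto simp: fun_eq_iff)
    then have "\<nu> (G t) = 0 * \<nu> (G t)" using radon_scale[OF \<nu> GC, of 0 t] by metis
    then show ?thesis by simp
  qed
  ultimately show 1: "(\<lambda>t. \<nu> (G t)) \<in> C_c" unfolding LF by (intro C_cI[of _ R]) auto
  obtain a :: "real^'n" where a: "cball 0 R \<subseteq> cbox (- a) a"
    using bounded_subset_cbox_symmetric[OF bounded_cball] by blast
  have out: "R < norm t" if "t \<notin> cbox (- a) a" for t using a that by (force simp: not_le[symmetric])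
  have Fint: "F integrable_on cbox (- a) a"
    using continuous_on_subset[OF Fc subset_UNIV] by (rule integrable_continuous)
  define J where "J = integral (cbox (- a) a) F"
  have Jx: "J x = (\<integral>t. G t x \<partial>lborel)" for x
  proof -
    have "bounded_linear (\<lambda>u :: (real^'n) \<Rightarrow>\<^sub>C complex. apply_bcontfun u x)"
      by (rule bounded_linear_intro[where K = 1]) (auto simp: norm_bounded)
    from integral_linear[OF Fint this] have "J x = integral (cbox (- a) a) (\<lambda>t. G t x)"
      by (simp add: J_def comp_def F)
    then show ?thesis using C_c_integral_cbox[OF GtC] zero out by simp
  qed
  have J0: "J x = 0" if "S < norm x" for x unfolding Jx using zero that by simp
  have Jc: "(\<lambda>x. J x) \<in> C_c" using J0 by (intro C_cI[of _ S]) auto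
  then show "(\<lambda>x. \<integral>t. G t x \<partial>lborel) \<in> C_c" by (simp add: Jx)
  have "(\<lambda>x. J x * cutoff S x) = (\<lambda>x. J x)"
  proof
    fix x show "J x * cutoff S x = J x"
      using J0[of x] by (cases "norm x \<le> S") (auto simp: cutoff_eq_1)
  qed
  then have "\<nu> (\<lambda>x. J x) = L J" by (simp add: L_def)
  also have "\<dots> = integral (cbox (- a) a) (\<lambda>t. \<nu> (G t))"
    using integral_linear[OF Fint L] by (simp add: J_def comp_def LF)
  also have "\<dots> = (\<integral>t. \<nu> (G t) \<partial>lborel)"
    using 1 out \<open>\<And>t. R < norm t \<Longrightarrow> \<nu> (G t) = 0\<close> by (intro C_c_integral_cbox) auto
  finally show "\<nu> (\<lambda>x. \<integral>t. G t x \<partial>lborel) = (\<integral>t. \<nu> (G t) \<partial>lborel)" by (simp add: Jx)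
qed


section \<open>Translation bounded measures integrate the weight\<close>

lemma variation_le_total_variation:
  fixes f :: "'n::finite cfun"
  assumes "\<And>x. ennreal (norm (f x)) \<le> indicator A x"
  shows "variation \<nu> f \<le> total_variation \<nu> A"
  unfolding total_variation_def variation_upper_integral_def variation_def variation_lsc_def
proof (intro INF_greatest SUP_subset_mono order_refl subsetI, clarify)
  fix g :: "real^'n \<Rightarrow> ennreal" and \<psi> x assume "\<forall>x. indicator A x \<le> g x" "\<forall>x. ennreal (norm (\<psi> x)) \<le> ennreal (norm (f x))"
  then show "ennreal (norm (\<psi> x)) \<le> g x" using assms[of x] by (meson order_trans)
qed

text \<open>The cutoff is at least \<open>1/2\<close> on the ball of radius \<open>1/2\<close>.\<close>

lemma integral_cutoff_pos:
  obtains c where "0 < c" "integral\<^sup>L lborel (cutoff 0 :: 'n::finite cfun) = of_real c"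
proof -
  define k where "k x = max 0 (min 1 (1 - norm x))" for x :: "real^'n"
  have ck: "cutoff 0 = (\<lambda>x. complex_of_real (k x))" by (simp add: cutoff_def k_def fun_eq_iff)
  have "integrable lborel (cutoff 0 :: 'n cfun)" by (rule C_c_integrable[OF cutoff_C_c])
  from integrable_Re[OF this] have kint: "integrable lborel k" by (simp add: ck)
  have "measure lborel (ball 0 (1/2) :: (real^'n) set) * (1/2) = (\<integral>x. indicator (ball 0 (1/2)) x * (1/2) \<partial>(lborel :: (real^'n) measure))"
    by simp
  also have "\<dots> \<le> integral\<^sup>L lborel k"
  proof (rule integral_mono[OF _ kint])
    show "integrable lborel (\<lambda>x::real^'n. indicator (ball 0 (1/2)) x * (1/2) :: real)"
      by (intro integrable_mult_left integrable_real_indicator emeasure_bounded_finite bounded_ball) simp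
  qed (auto simp: k_def indicator_def)
  finally have "measure lborel (ball 0 (1/2) :: (real^'n) set) * (1/2) \<le> integral\<^sup>L lborel k" .
  moreover have "0 < measure lborel (ball 0 (1/2) :: (real^'n) set)"
    by (rule content_ball_pos) simp
  ultimately have "0 < integral\<^sup>L lborel k" by linarith
  then show ?thesis using that[of "integral\<^sup>L lborel k"] kint by (simp add: ck)
qed

text \<open>With \<open>c = \<integral> cutoff 0\<close>, every \<open>\<psi> \<in> C\<^sub>c\<close> is the average \<open>\<integral> G\<^sub>t dt\<close> of the localised functions
  \<open>G\<^sub>t(x) = \<psi>(x) cutoff 0 (x - t) / c\<close>, hence \<open>|\<nu> \<psi>| \<le> \<integral> |\<nu> G\<^sub>t| dt\<close>. Suppose \<open>|\<psi>| \<le> weight\<close>. On the unit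
  ball about \<open>t\<close>, which carries \<open>G\<^sub>t\<close>, the weight is at most \<open>3\<^sup>d weight(t)\<close>, and the total
  variation of that ball is bounded independently of \<open>t\<close>. So \<open>|\<nu> G\<^sub>t|\<close> is at most a constant times
  \<open>weight(t)\<close>, which is integrable.\<close>

lemma variation_weight_finite:
  fixes \<nu> :: "'n::finite functional"
  assumes "\<nu> \<in> translation_bounded_measures"
  shows "variation \<nu> (\<lambda>x. of_real (weight x)) < \<infinity>"
proof -
  have \<nu>: "radon_measure \<nu>"
    and tb: "\<forall>K. compact K \<longrightarrow> (SUP t. total_variation \<nu> ((\<lambda>x. t + x) ` K)) < \<infinity>"
    using assms unfolding translation_bounded_measures_def by simp_all
  have "(SUP t. total_variation \<nu> ((\<lambda>x. t + x) ` cball 0 1)) < \<infinity>"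
    by (rule tb[rule_format, OF compact_cball])
  then obtain M where M0: "0 \<le> M" and M: "(SUP t. total_variation \<nu> ((\<lambda>x. t + x) ` cball 0 1)) = ennreal M"
    by (metis ennreal_cases infinity_ennreal_def less_irrefl)
  have Varcut: "variation \<nu> (\<lambda>x. cutoff 0 (x - t)) \<le> ennreal M" for t
  proof -
    have img: "(\<lambda>x. t + x) ` cball 0 1 = cball t 1" using image_add_cball[of t 0 1] by simp
    have "variation \<nu> (\<lambda>x. cutoff 0 (x - t)) \<le> total_variation \<nu> ((\<lambda>x. t + x) ` cball 0 1)"
    proof (rule variation_le_total_variation, unfold img)
      fix x show "ennreal (norm (cutoff 0 (x - t))) \<le> indicator (cball t 1) x"
        using norm_cutoff_le_1[of 0 "x - t"] cutoff_eq_0[of 0 "x - t"]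
        by (cases "x \<in> cball t 1") (auto simp: dist_norm norm_minus_commute)
    qed
    also have "\<dots> \<le> ennreal M" unfolding M[symmetric] by (rule SUP_upper) simp
    finally show ?thesis .
  qed
  obtain c where c: "0 < c" "integral\<^sup>L lborel (cutoff 0 :: 'n cfun) = of_real c" using integral_cutoff_pos .
  define A where "A = 3 ^ CARD('n) * M / c"
  have A0: "0 \<le> A" using M0 c by (simp add: A_def)
  have "variation \<nu> (\<lambda>x. of_real (weight x)) \<le> ennreal (A * pi ^ CARD('n))"
  proof (rule variation_least, rule ennreal_leI)
    fix \<psi> :: "'n cfun" assume \<psi>: "\<psi> \<in> C_c" and le: "\<And>x. norm (\<psi> x) \<le> norm (complex_of_real (weight x))"
    obtain S where S: "\<And>x. S < norm x \<Longrightarrow> \<psi> x = 0" using C_cE[OF \<psi>] by blast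
    define G where "G t x = (1 / of_real c) * \<psi> x * cutoff 0 (x - t)" for t x
    have Gcont: "continuous_on UNIV (\<lambda>(t, x). G t x)"
      unfolding G_def case_prod_beta using C_cD_cont[OF \<psi>]
      by (intro continuous_intros continuous_on_compose2[OF C_cD_cont[OF \<psi>]]
          continuous_on_compose2[OF cutoff_cont[of UNIV 0]]) auto
    have Gzero: "G t x = 0" if "S + 1 < norm t \<or> S < norm x" for t x
    proof (cases "S < norm x")
      case False
      then have "1 \<le> norm (x - t)" using that norm_triangle_ineq2[of t x] by (simp add: norm_minus_commute)
      then show ?thesis using cutoff_eq_0[of 0 "x - t"] by (simp add: G_def)
    qed (simp add: G_def S)
    note I = radon_lebesgue_interchange[OF \<nu> Gcont Gzero]
    have avg: "(\<integral>t. G t x \<partial>lborel) = \<psi> x" for x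
    proof -
      have "(\<integral>t. cutoff 0 (x - t) \<partial>lborel) = integral\<^sup>L lborel (cutoff 0 :: 'n cfun)"
        using integral_affine[OF C_c_integrable[OF cutoff_C_c[of 0]], of "-1" x] by simp
      then show ?thesis using c by (simp add: G_def)
    qed
    have Gle: "norm (\<nu> (G t)) \<le> A * weight t" for t
    proof -
      have GC: "G t \<in> C_c"
        using continuous_on_compose2[OF Gcont, of UNIV "\<lambda>x. (t, x)"] Gzero
        by (intro C_cI[of _ S]) (auto simp: continuous_intros)
      have "ennreal (norm (\<nu> (G t))) \<le> variation \<nu> (G t)" by (rule variation_upper[OF GC]) simp
      also have "\<dots> \<le> ennreal (3 ^ CARD('n) * weight t / c) * variation \<nu> (\<lambda>x. cutoff 0 (x - t))"
      proof (rule variation_scale_le[OF \<nu>])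
        show "0 \<le> 3 ^ CARD('n) * weight t / c" using c weight_nonneg[of t] by simp
        fix x
        show "norm (G t x) \<le> 3 ^ CARD('n) * weight t / c * norm (cutoff 0 (x - t))"
        proof (cases "norm (x - t) \<le> 1")
          case True
          have "norm (\<psi> x) \<le> weight x" using le[of x] weight_nonneg[of x] by simp
          also have "\<dots> \<le> 3 ^ CARD('n) * weight t" by (rule weight_slowly_varying[OF True])
          finally have "norm (\<psi> x) / c \<le> 3 ^ CARD('n) * weight t / c" using c by (simp add: divide_right_mono)
          then have "norm (\<psi> x) / c * norm (cutoff 0 (x - t)) \<le> 3 ^ CARD('n) * weight t / c * norm (cutoff 0 (x - t))"
            by (rule mult_right_mono) simp
          then show ?thesis using c by (simp add: G_def norm_mult norm_divide)
        qed (simp add: G_def cutoff_eq_0)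
      qed
      also have "\<dots> \<le> ennreal (3 ^ CARD('n) * weight t / c) * ennreal M"
        by (rule mult_left_mono[OF Varcut]) simp
      also have "\<dots> = ennreal (A * weight t)"
        using c M0 weight_nonneg[of t] by (simp add: A_def ennreal_mult[symmetric] field_simps)
      finally show ?thesis using A0 weight_nonneg[of t] ennreal_le_iff[of "A * weight t"] by simp
    qed
    have "norm (\<nu> \<psi>) = norm (\<integral>t. \<nu> (G t) \<partial>lborel)" using I(3) by (simp add: avg)
    also have "\<dots> \<le> (\<integral>t. norm (\<nu> (G t)) \<partial>lborel)" by (rule integral_norm_bound)
    also have "\<dots> \<le> (\<integral>t. A * weight t \<partial>(lborel :: (real^'n) measure))"
      by (intro integral_mono integrable_norm C_c_integrable[OF I(1)] integrable_mult_right weight_integrable Gle)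
    also have "\<dots> = A * pi ^ CARD('n)" by (simp add: weight_integral)
    finally show "norm (\<nu> \<psi>) \<le> A * pi ^ CARD('n)" .
  qed
  then show ?thesis by (simp add: le_less_trans)
qed

lemma variation_finite_of_weight:
  fixes \<nu> :: "'n::finite functional"
  assumes "\<nu> \<in> translation_bounded_measures" "0 \<le> C" "\<And>x. norm (f x) \<le> C * weight x"
  shows "variation \<nu> f < \<infinity>"
proof -
  have "variation \<nu> f \<le> ennreal C * variation \<nu> (\<lambda>x. of_real (weight x))"
    using assms by (intro variation_scale_le) (simp_all add: translation_bounded_measures_def abs_of_nonneg weight_nonneg)
  also have "\<dots> < \<infinity>" using variation_weight_finite[OF assms(1)] by (simp add: ennreal_mult_less_top)
  finally show ?thesis .
qed


section \<open>Finite measures and their Fourier transforms\<close>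

lemma finite_radon_measure_iff:
  "finite_radon_measure \<rho> \<longleftrightarrow> radon_measure \<rho> \<and> variation \<rho> (\<lambda>_. 1) < \<infinity>"
proof -
  have "(indicator UNIV :: _ \<Rightarrow> ennreal) = (\<lambda>x. ennreal (norm (1::complex)))" by (auto simp: fun_eq_iff)
  then have "total_variation \<rho> UNIV = variation \<rho> (\<lambda>_. 1)"
    using variation_upper_integral_continuous[of "\<lambda>_. 1" \<rho>] by (simp add: total_variation_def)
  then show ?thesis by (simp add: finite_radon_measure_def)
qed

lemma finite_radon_measureE:
  assumes "finite_radon_measure \<rho>"
  obtains M where "radon_measure \<rho>" "0 \<le> M" "variation \<rho> (\<lambda>_. 1) = ennreal M"
  using assms unfolding finite_radon_measure_iff by (metis ennreal_cases infinity_ennreal_def less_irrefl)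

lemma variation_bounded_le:
  fixes F :: "'n::finite cfun"
  assumes "radon_measure \<rho>" "0 \<le> M" "variation \<rho> (\<lambda>_. 1) = ennreal M" "\<And>x. norm (F x) \<le> B"
  shows "variation \<rho> F \<le> ennreal (B * M)"
proof -
  have B: "0 \<le> B" using assms(4) norm_ge_zero order_trans by blast
  then have "variation \<rho> F \<le> ennreal B * variation \<rho> (\<lambda>_. 1)" using assms by (intro variation_scale_le) auto
  then show ?thesis using assms B by (simp add: ennreal_mult)
qed

lemma radon_integral_bounded_le:
  fixes F :: "'n::finite cfun"
  assumes \<rho>: "radon_measure \<rho>" "0 \<le> M" "variation \<rho> (\<lambda>_. 1) = ennreal M"
    and F: "continuous_on UNIV F" "\<And>x. norm (F x) \<le> B"
  shows "norm (radon_integral \<rho> F) \<le> B * M"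
proof -
  have B: "0 \<le> B" using F(2) norm_ge_zero order_trans by blast
  have le: "variation \<rho> F \<le> ennreal (B * M)" by (rule variation_bounded_le[OF \<rho> F(2)])
  then have "variation \<rho> F < \<infinity>" by (simp add: le_less_trans)
  then have "ennreal (norm (radon_integral \<rho> F)) \<le> ennreal (B * M)"
    using radon_integral_bound[OF \<rho>(1) F(1)] le by simp
  then show ?thesis using B \<rho>(2) by (simp add: ennreal_le_iff)
qed

text \<open>The tail of \<open>F\<close> is at most \<open>B\<close> times that of the constant \<open>1\<close>, so one \<open>R\<close> serves all \<open>F\<close>.\<close>

lemma finite_radon_measure_tight:
  fixes \<rho> :: "'n::finite functional"
  assumes \<rho>: "finite_radon_measure \<rho>" and e: "0 < e"
  shows "\<exists>R\<ge>0. \<forall>F B. continuous_on UNIV F \<longrightarrow> (\<forall>x. norm (F x) \<le> B) \<longrightarrow>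
    norm (radon_integral \<rho> F - \<rho> (\<lambda>x. F x * cutoff R x)) \<le> B * e"
proof -
  obtain M where M: "radon_measure \<rho>" "0 \<le> M" "variation \<rho> (\<lambda>_. 1) = ennreal M"
    using finite_radon_measureE[OF \<rho>] .
  have "variation \<rho> (\<lambda>_. 1) < \<infinity>" using M by simp
  from variation_tail_le[OF M(1) this e]
  obtain R where R: "\<And>S. R \<le> S \<Longrightarrow> variation \<rho> (\<lambda>x. (1 - cutoff S x) * 1) \<le> ennreal e" by blast
  define S where "S = max R 0"
  have S: "variation \<rho> (\<lambda>x. 1 - cutoff S x) \<le> ennreal e" using R[of S] by (simp add: S_def)
  have "norm (radon_integral \<rho> F - \<rho> (\<lambda>x. F x * cutoff S x)) \<le> B * e"
    if F: "continuous_on UNIV F" "\<And>x. norm (F x) \<le> B" for F B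
  proof (rule radon_integral_truncation_bound[OF M(1) F(1)])
    have B: "0 \<le> B" using F(2) norm_ge_zero order_trans by blast
    then show "0 \<le> B * e" using e by simp
    show "variation \<rho> F < \<infinity>" using variation_bounded_le[OF M, of F B] F(2) by (simp add: le_less_trans)
    have "variation \<rho> (\<lambda>x. (1 - cutoff S x) * F x) \<le> ennreal B * variation \<rho> (\<lambda>x. 1 - cutoff S x)"
      using F(2) B by (intro variation_scale_le[OF M(1)]) (auto simp: norm_mult mult.commute intro: mult_right_mono)
    also have "\<dots> \<le> ennreal B * ennreal e" by (rule mult_left_mono[OF S]) simp
    finally show "variation \<rho> (\<lambda>x. (1 - cutoff S x) * F x) \<le> ennreal (B * e)"
      using B e by (simp add: ennreal_mult)
  qed
  then show ?thesis by (intro exI[of _ S]) (auto simp: S_def)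
qed

lemma wave_cont: "continuous_on S (wave x)"
  using wave_continuous[of S "\<lambda>_. x" "\<lambda>y. y"] by simp

lemma fourier_measure_bounded:
  fixes \<rho> :: "'n::finite functional"
  assumes "radon_measure \<rho>" "0 \<le> M" "variation \<rho> (\<lambda>_. 1) = ennreal M"
  shows "norm (fourier_measure \<rho> x) \<le> M"
  unfolding fourier_measure_wave
  using radon_integral_bounded_le[OF assms wave_cont, of x 1] by simp

text \<open>Up to a small error the measure lives on a ball, where \<open>wave x'\<close> and \<open>wave x\<close> are uniformly close
  if \<open>x\<close> and \<open>x'\<close> are.\<close>

lemma fourier_stieltjes_subset_C_u: "(fourier_stieltjes :: 'n::finite cfun set) \<subseteq> C_u"
proof
  fix h :: "'n cfun" assume "h \<in> fourier_stieltjes"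
  then obtain \<rho> where h: "h = fourier_measure \<rho>" and \<rho>: "finite_radon_measure \<rho>"
    by (auto simp: fourier_stieltjes_def)
  obtain M where M: "radon_measure \<rho>" "0 \<le> M" "variation \<rho> (\<lambda>_. 1) = ennreal M"
    using finite_radon_measureE[OF \<rho>] .
  have "bounded (range h)"
    unfolding h bounded_iff using fourier_measure_bounded[OF M] by auto
  moreover have "uniformly_continuous_on UNIV h"
  proof (unfold uniformly_continuous_on_def, intro allI impI)
    fix e :: real assume e: "0 < e"
    then have e4: "0 < e / 4" by simp
    obtain R where R0: "0 \<le> R" and R: "\<forall>F B. continuous_on UNIV F \<longrightarrow> (\<forall>x. norm (F x) \<le> B) \<longrightarrow>
        norm (radon_integral \<rho> F - \<rho> (\<lambda>x. F x * cutoff R x)) \<le> B * (e / 4)"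
      using finite_radon_measure_tight[OF \<rho> e4] by auto
    note R = R[rule_format]
    define K where "K = 2 * pi * (R + 1) * M"
    have K: "0 \<le> K" using M R0 by (simp add: K_def)
    define d where "d = e / 2 / (K + 1)"
    have d: "d > 0" using e K by (simp add: d_def)
    have "dist (h x') (h x) < e" if xx: "dist x' x < d" for x x'
    proof -
      define F where "F y = wave x' y + (-1) * wave x y" for y
      have Fc: "continuous_on UNIV F" unfolding F_def by (intro continuous_intros wave_cont)
      have F2: "norm (F y) \<le> 2" for y
        unfolding F_def by (rule order_trans[OF norm_triangle_ineq]) simp
      have fin: "variation \<rho> (wave x) < \<infinity>" for x
        using variation_bounded_le[OF M, of "wave x" 1] by (simp add: le_less_trans)
      have "h x' - h x = radon_integral \<rho> F"
        unfolding h fourier_measure_wave F_def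
        by (subst radon_integral_add_scale[OF M(1) wave_cont fin wave_cont fin]) simp
      moreover have "norm (\<rho> (\<lambda>y. F y * cutoff R y)) \<le> K * dist x' x"
      proof -
        have C: "(\<lambda>y. F y * cutoff R y) \<in> C_c" by (intro C_c_mult cutoff_C_c Fc)
        have "norm (F y * cutoff R y) \<le> 2 * pi * dist x' x * (R + 1)" for y
        proof (cases "norm y \<le> R + 1")
          case True
          have "norm (F y) \<le> 2 * pi * norm (x' - x) * norm y" using wave_lipschitz[of x' y x] by (simp add: F_def)
          also have "\<dots> \<le> 2 * pi * norm (x' - x) * (R + 1)" using True by (intro mult_left_mono) auto
          finally have "norm (F y) * norm (cutoff R y) \<le> 2 * pi * norm (x' - x) * (R + 1) * 1"
            using R0 by (intro mult_mono norm_cutoff_le_1) auto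
          then show ?thesis by (simp add: norm_mult dist_norm)
        qed (use R0 in \<open>simp add: cutoff_eq_0\<close>)
        then have "norm (radon_integral \<rho> (\<lambda>y. F y * cutoff R y)) \<le> 2 * pi * dist x' x * (R + 1) * M"
          by (intro radon_integral_bounded_le[OF M] C_cD_cont[OF C])
        then show ?thesis by (simp add: radon_integral_C_c[OF M(1) C] K_def algebra_simps)
      qed
      moreover have "norm (radon_integral \<rho> F - \<rho> (\<lambda>x. F x * cutoff R x)) \<le> 2 * (e / 4)"
        by (rule R[OF Fc F2])
      moreover have "K * dist x' x < e / 2"
      proof -
        have "K * dist x' x \<le> K * d" using xx K by (intro mult_left_mono) auto
        also have "\<dots> < (K + 1) * d" using d by simp
        also have "\<dots> = e / 2" using K by (simp add: d_def field_simps)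
        finally show ?thesis .
      qed
      ultimately show ?thesis
        using norm_triangle_sub[of "radon_integral \<rho> F" "\<rho> (\<lambda>y. F y * cutoff R y)"] by (simp add: dist_norm)
    qed
    then show "\<exists>d>0. \<forall>x\<in>UNIV. \<forall>x'\<in>UNIV. dist x' x < d \<longrightarrow> dist (h x') (h x) < e" using d by blast
  qed
  ultimately show "h \<in> C_u" by (simp add: C_u_def)
qed

lemma L1_norm_nonneg: "0 \<le> L1_norm f"
  by (simp add: L1_norm_def)

lemma L1_norm_cutoff_tendsto_zero:
  fixes f :: "'n::finite cfun"
  assumes "integrable lborel f"
  shows "(\<lambda>k. L1_norm (\<lambda>x. f x - f x * cutoff (real k) x)) \<longlonglongrightarrow> 0"
proof -
  have [measurable]: "f \<in> borel_measurable borel" "(cutoff R :: 'n cfun) \<in> borel_measurable borel" for R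
    using assms by (auto intro: borel_measurable_continuous_onI cutoff_cont)
  have "(\<lambda>k. \<integral>x. norm (f x - f x * cutoff (real k) x) \<partial>lborel) \<longlonglongrightarrow> (\<integral>x. 0 \<partial>(lborel :: (real^'n) measure))"
  proof (rule integral_dominated_convergence[where w = "\<lambda>x. norm (f x)"])
    show "AE x in lborel. (\<lambda>k. norm (f x - f x * cutoff (real k) x)) \<longlonglongrightarrow> 0"
    proof (rule always_eventually, rule allI, rule tendsto_eventually)
      fix x show "\<forall>\<^sub>F k in sequentially. norm (f x - f x * cutoff (real k) x) = 0"
        using eventually_ge_at_top[of "nat \<lceil>norm x\<rceil>"]
        by eventually_elim (simp add: cutoff_eq_1 nat_ceiling_le_eq)
    qed
    show "AE x in lborel. norm (norm (f x - f x * cutoff (real k) x)) \<le> norm (f x)" for k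
    proof (intro always_eventually allI)
      fix x
      have "norm (f x - f x * cutoff (real k) x) = norm (f x) * norm (1 - cutoff (real k) x)"
        by (simp flip: norm_mult add: algebra_simps)
      also have "\<dots> \<le> norm (f x) * 1" by (intro mult_left_mono norm_one_minus_cutoff_le_1) simp
      finally show "norm (norm (f x - f x * cutoff (real k) x)) \<le> norm (f x)" by simp
    qed
  qed (use assms in auto)
  then show ?thesis by (simp add: L1_norm_def)
qed

lemma integrable_mult_bounded:
  fixes f h :: "'n::finite cfun"
  assumes "integrable lborel f" "continuous_on UNIV h" "\<And>x. norm (h x) \<le> H"
  shows "integrable lborel (\<lambda>x. f x * h x)"
    and "norm (\<integral>x. f x * h x \<partial>lborel) \<le> H * L1_norm f"
proof -
  have [measurable]: "f \<in> borel_measurable borel" "h \<in> borel_measurable borel"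
    using assms by (auto intro: borel_measurable_continuous_onI)
  have le: "norm (f x * h x) \<le> H * norm (f x)" for x
    using assms(3)[of x] mult_right_mono[of "norm (h x)" H "norm (f x)"] by (simp add: norm_mult mult.commute)
  show "integrable lborel (\<lambda>x. f x * h x)"
  proof (rule Bochner_Integration.integrable_bound[of _ "\<lambda>x. H * norm (f x)"])
    show "AE x in lborel. norm (f x * h x) \<le> norm (H * norm (f x))"
      by (intro always_eventually allI) (metis abs_ge_self le order_trans real_norm_def)
  qed (use assms in auto)
  then have "(\<integral>x. norm (f x * h x) \<partial>lborel) \<le> (\<integral>x. H * norm (f x) \<partial>lborel)"
    by (intro integral_mono le) (use assms(1) in auto)
  then show "norm (\<integral>x. f x * h x \<partial>lborel) \<le> H * L1_norm f"
    using order_trans[OF integral_norm_bound[of lborel "\<lambda>x. f x * h x"]] by (simp add: L1_norm_def)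
qed

lemma C_u_D: "h \<in> C_u \<Longrightarrow> continuous_on UNIV h" "h \<in> C_u \<Longrightarrow> norm (h x) \<le> sup_norm h"
  by (auto simp: C_u_def uniformly_continuous_imp_continuous intro: sup_norm_upper)

text \<open>The waves do not have compact support, so the interchange applies only after multiplication with a
  cutoff. By tightness this changes both sides by at most \<open>\<parallel>\<phi>\<parallel>\<^sub>1 e\<close> for arbitrary \<open>e\<close>.\<close>

lemma fourier_duality_C_c:
  fixes \<rho> :: "'n::finite functional"
  assumes \<rho>: "finite_radon_measure \<rho>" and \<phi>: "\<phi> \<in> C_c"
  shows "(\<integral>y. \<phi> y * fourier_measure \<rho> y \<partial>lborel) = radon_integral \<rho> (fourier \<phi>)"
proof -
  have \<rho>r: "radon_measure \<rho>" using \<rho> by (simp add: finite_radon_measure_def)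
  have hC: "fourier_measure \<rho> \<in> C_u" using \<rho> fourier_stieltjes_subset_C_u by (auto simp: fourier_stieltjes_def)
  obtain S where S: "\<And>x. S < norm x \<Longrightarrow> \<phi> x = 0" using C_cE[OF \<phi>] by blast
  have int: "integrable lborel \<phi>" by (rule C_c_integrable[OF \<phi>])
  have "norm ((\<integral>y. \<phi> y * fourier_measure \<rho> y \<partial>lborel) - radon_integral \<rho> (fourier \<phi>)) \<le> 2 * L1_norm \<phi> * e"
    if e: "0 < e" for e
  proof -
    obtain R where R0: "0 \<le> R" and R: "\<forall>F B. continuous_on UNIV F \<longrightarrow> (\<forall>x. norm (F x) \<le> B) \<longrightarrow>
        norm (radon_integral \<rho> F - \<rho> (\<lambda>x. F x * cutoff R x)) \<le> B * e"
      using finite_radon_measure_tight[OF \<rho> e] by auto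
    note R = R[rule_format]
    define G where "G y x = \<phi> y * (wave y x * cutoff R x)" for y x
    have Gc: "continuous_on UNIV (\<lambda>(y, x). G y x)"
      unfolding G_def case_prod_beta
      by (intro continuous_intros continuous_on_compose2[OF C_cD_cont[OF \<phi>]]
          continuous_on_compose2[OF cutoff_cont[of UNIV R]]) auto
    have G0: "G y x = 0" if "S < norm y \<or> R + 1 < norm x" for y x
      using that S[of y] cutoff_eq_0[of R x] by (auto simp: G_def)
    note I = radon_lebesgue_interchange[OF \<rho>r Gc G0]
    have wC: "(\<lambda>x. wave y x * cutoff R x) \<in> C_c" for y by (intro C_c_mult cutoff_C_c wave_cont)
    have \<rho>G: "\<rho> (G y) = \<phi> y * \<rho> (\<lambda>x. wave y x * cutoff R x)" for y
      unfolding G_def by (rule radon_scale[OF \<rho>r wC])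
    have IG: "(\<integral>y. G y x \<partial>lborel) = fourier \<phi> x * cutoff R x" for x
    proof -
      have "(\<integral>y. G y x \<partial>lborel) = (\<integral>y. (wave x y * \<phi> y) * cutoff R x \<partial>lborel)"
        by (simp add: G_def wave_commute[of x] mult_ac)
      then show ?thesis by (simp add: fourier_wave)
    qed
    define u where "u y = fourier_measure \<rho> y - \<rho> (\<lambda>x. wave y x * cutoff R x)" for y
    have u: "norm (u y) \<le> e" for y
      unfolding u_def fourier_measure_wave using R[OF wave_cont[of UNIV y], of 1] by simp
    have i1: "integrable lborel (\<lambda>y. \<phi> y * fourier_measure \<rho> y)"
      by (rule integrable_mult_bounded[OF int C_u_D[OF hC]])
    have i2: "integrable lborel (\<lambda>y. \<phi> y * \<rho> (\<lambda>x. wave y x * cutoff R x))"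
      using C_c_integrable[OF I(1)] by (simp add: \<rho>G)
    have "(\<integral>y. \<phi> y * fourier_measure \<rho> y \<partial>lborel) - \<rho> (\<lambda>x. fourier \<phi> x * cutoff R x)
        = (\<integral>y. \<phi> y * fourier_measure \<rho> y \<partial>lborel) - (\<integral>y. \<phi> y * \<rho> (\<lambda>x. wave y x * cutoff R x) \<partial>lborel)"
      using I(3) by (simp add: IG \<rho>G)
    also have "\<dots> = (\<integral>y. \<phi> y * u y \<partial>lborel)"
      using i1 i2 by (simp add: u_def ring_distribs)
    also have "norm \<dots> \<le> (\<integral>y. e * norm (\<phi> y) \<partial>lborel)"
    proof (rule order_trans[OF integral_norm_bound integral_mono])
      show "integrable lborel (\<lambda>y. norm (\<phi> y * u y))"
        using i1 i2 by (intro integrable_norm) (simp add: u_def ring_distribs)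
      show "norm (\<phi> y * u y) \<le> e * norm (\<phi> y)" for y
        using mult_right_mono[OF u[of y], of "norm (\<phi> y)"] by (simp add: norm_mult mult.commute)
    qed (use int in auto)
    finally have "norm ((\<integral>y. \<phi> y * fourier_measure \<rho> y \<partial>lborel) - \<rho> (\<lambda>x. fourier \<phi> x * cutoff R x)) \<le> L1_norm \<phi> * e"
      by (simp add: L1_norm_def mult.commute)
    moreover have "norm (radon_integral \<rho> (fourier \<phi>) - \<rho> (\<lambda>x. fourier \<phi> x * cutoff R x)) \<le> L1_norm \<phi> * e"
      by (rule R[OF fourier_continuous[OF int] fourier_bounded])
    ultimately show ?thesis
      using norm_triangle_ineq4[of "(\<integral>y. \<phi> y * fourier_measure \<rho> y \<partial>lborel) - \<rho> (\<lambda>x. fourier \<phi> x * cutoff R x)"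
          "radon_integral \<rho> (fourier \<phi>) - \<rho> (\<lambda>x. fourier \<phi> x * cutoff R x)"]
      by (simp add: algebra_simps)
  qed
  note * = this
  have "norm ((\<integral>y. \<phi> y * fourier_measure \<rho> y \<partial>lborel) - radon_integral \<rho> (fourier \<phi>)) \<le> 0"
  proof (rule field_le_epsilon)
    fix e :: real assume e: "0 < e"
    have p: "0 < 2 * L1_norm \<phi> + 1" using L1_norm_nonneg[of \<phi>] by linarith
    have "norm ((\<integral>y. \<phi> y * fourier_measure \<rho> y \<partial>lborel) - radon_integral \<rho> (fourier \<phi>))
        \<le> 2 * L1_norm \<phi> * (e / (2 * L1_norm \<phi> + 1))"
      by (rule *) (use e p in simp)
    also have "\<dots> \<le> (2 * L1_norm \<phi> + 1) * (e / (2 * L1_norm \<phi> + 1))"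
      using e p by (intro mult_right_mono) auto
    also have "\<dots> = 0 + e" using p by simp
    finally show "norm ((\<integral>y. \<phi> y * fourier_measure \<rho> y \<partial>lborel) - radon_integral \<rho> (fourier \<phi>)) \<le> 0 + e" .
  qed
  then show ?thesis by simp
qed

text \<open>Both sides are continuous in \<open>f\<close> with respect to the \<open>L\<^sup>1\<close> norm.\<close>

lemma fourier_duality:
  fixes \<rho> :: "'n::finite functional"
  assumes \<rho>: "finite_radon_measure \<rho>" and f: "continuous_on UNIV f" "integrable lborel f"
  shows "(\<integral>y. f y * fourier_measure \<rho> y \<partial>lborel) = radon_integral \<rho> (fourier f)"
proof -
  obtain M where M: "radon_measure \<rho>" "0 \<le> M" "variation \<rho> (\<lambda>_. 1) = ennreal M"
    using finite_radon_measureE[OF \<rho>] .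
  have hC: "fourier_measure \<rho> \<in> C_u" using \<rho> fourier_stieltjes_subset_C_u by (auto simp: fourier_stieltjes_def)
  define g where "g k x = f x * cutoff (real k) x" for k x
  have g: "g k \<in> C_c" for k unfolding g_def by (intro C_c_mult cutoff_C_c f)
  \<comment> \<open>The defect of the formula; it is linear in \<open>u\<close> and vanishes on \<open>C\<^sub>c\<close>.\<close>
  define D where "D u = (\<integral>y. u y * fourier_measure \<rho> y \<partial>lborel) - radon_integral \<rho> (fourier u)" for u
  have le: "norm (D f) \<le> 2 * M * L1_norm (\<lambda>x. f x - g k x)" for k
  proof -
    have ig: "integrable lborel (g k)" by (rule C_c_integrable[OF g])
    have id: "integrable lborel (\<lambda>x. f x - g k x)" using ig f by simp
    have b: "\<And>x. norm (fourier_measure \<rho> x) \<le> M" by (rule fourier_measure_bounded[OF M])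
    have fd: "fourier (\<lambda>x. f x - g k x) = (\<lambda>x. fourier f x + (-1) * fourier (g k) x)"
      using fourier_add_scale[OF f(2) ig, of "-1"] by (simp add: fun_eq_iff)
    have fin: "variation \<rho> (fourier u) < \<infinity>" for u
      by (rule le_less_trans[OF variation_bounded_le[OF M fourier_bounded]]) simp
    have "D f = D f - D (g k)" using fourier_duality_C_c[OF \<rho> g] by (simp add: D_def)
    also have "\<dots> = D (\<lambda>x. f x - g k x)"
      using integrable_mult_bounded(1)[OF f(2) C_u_D(1)[OF hC] b] integrable_mult_bounded(1)[OF ig C_u_D(1)[OF hC] b]
      unfolding D_def fd
      by (subst radon_integral_add_scale[OF M(1) fourier_continuous[OF f(2)] fin fourier_continuous[OF ig] fin])
        (simp add: left_diff_distrib)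
    also have "norm \<dots> \<le> M * L1_norm (\<lambda>x. f x - g k x) + L1_norm (\<lambda>x. f x - g k x) * M"
      unfolding D_def
      by (rule order_trans[OF norm_triangle_ineq4], intro add_mono integrable_mult_bounded(2)[OF id C_u_D(1)[OF hC] b]
          radon_integral_bounded_le[OF M fourier_continuous[OF id] fourier_bounded])
    finally show ?thesis by simp
  qed
  have lim: "(\<lambda>k. 2 * M * L1_norm (\<lambda>x. f x - g k x)) \<longlonglongrightarrow> 2 * M * 0"
    unfolding g_def by (intro tendsto_mult tendsto_const L1_norm_cutoff_tendsto_zero f)
  have "norm (D f) \<le> 2 * M * 0"
    by (rule LIMSEQ_le_const[OF lim]) (use le in blast)
  then show ?thesis by (simp add: D_def)
qed


section \<open>Measures with a bounded continuous density\<close>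

lemma L1_norm_le_supp:
  fixes f :: "'n::finite cfun"
  assumes f: "f \<in> C_c" and K: "compact K" "supp f \<subseteq> K"
  shows "L1_norm f \<le> measure lborel K * sup_norm f"
proof -
  have s: "norm (f x) \<le> indicator K x * sup_norm f" for x
    using sup_norm_upper[OF C_c_bounded[OF f], of x] supp_zero[of x f] K(2) by (auto simp: indicator_def)
  have fin: "emeasure lborel K < \<infinity>" by (intro emeasure_bounded_finite compact_imp_bounded K)
  have "L1_norm f \<le> (\<integral>x. indicator K x * sup_norm f \<partial>lborel)"
    unfolding L1_norm_def
    using fin K(1) by (intro integral_mono s integrable_norm C_c_integrable[OF f] integrable_mult_left)
      (auto intro!: integrable_real_indicator borel_compact)
  also have "\<dots> = measure lborel K * sup_norm f" using K(1) by (simp add: borel_compact)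
  finally show ?thesis .
qed

lemma
  fixes h :: "'n::finite cfun"
  assumes h: "continuous_on UNIV h" "\<And>x. norm (h x) \<le> H"
  shows radon_measure_lebesgue_density: "radon_measure (lebesgue_density h)"
    and variation_lebesgue_density: "\<And>f. integrable lborel f \<Longrightarrow> variation (lebesgue_density h) f \<le> ennreal (H * L1_norm f)"
proof -
  have H: "0 \<le> H" using h(2) norm_ge_zero order_trans by blast
  have int: "integrable lborel (\<lambda>x. f x * h x)" if "f \<in> C_c" for f
    by (rule integrable_mult_bounded[OF C_c_integrable[OF that] h])
  show "radon_measure (lebesgue_density h)"
    unfolding radon_measure_def linear_functional_on_def
  proof (intro conjI ballI allI impI)
    fix f g :: "'n cfun" and c assume "f \<in> C_c"
    then show "lebesgue_density h (\<lambda>x. c * f x) = c * lebesgue_density h f"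
      by (simp add: lebesgue_density_def mult.assoc)
    assume "g \<in> C_c"
    then show "lebesgue_density h (\<lambda>x. f x + g x) = lebesgue_density h f + lebesgue_density h g"
      using int[OF \<open>f \<in> C_c\<close>] int[OF \<open>g \<in> C_c\<close>] by (simp add: lebesgue_density_def ring_distribs)
  next
    fix K :: "(real^'n) set" assume K: "compact K"
    have "norm (lebesgue_density h \<phi>) \<le> (H * measure lborel K) * sup_norm \<phi>" if "\<phi> \<in> C_c" "supp \<phi> \<subseteq> K" for \<phi>
    proof -
      have "norm (lebesgue_density h \<phi>) \<le> H * L1_norm \<phi>"
        unfolding lebesgue_density_def by (rule integrable_mult_bounded[OF C_c_integrable[OF that(1)] h])
      also have "\<dots> \<le> H * (measure lborel K * sup_norm \<phi>)"
        by (intro mult_left_mono L1_norm_le_supp that K H)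
      finally show ?thesis by (simp add: mult.assoc)
    qed
    then show "\<exists>C. \<forall>\<phi>\<in>C_c. supp \<phi> \<subseteq> K \<longrightarrow> norm (lebesgue_density h \<phi>) \<le> C * sup_norm \<phi>" by blast
  qed
  fix f :: "'n cfun" assume f: "integrable lborel f"
  show "variation (lebesgue_density h) f \<le> ennreal (H * L1_norm f)"
  proof (rule variation_least, rule ennreal_leI)
    fix \<psi> :: "'n cfun" assume \<psi>: "\<psi> \<in> C_c" and le: "\<And>x. norm (\<psi> x) \<le> norm (f x)"
    have "norm (lebesgue_density h \<psi>) \<le> H * L1_norm \<psi>"
      unfolding lebesgue_density_def by (rule integrable_mult_bounded[OF C_c_integrable[OF \<psi>] h])
    also have "\<dots> \<le> H * L1_norm f"
      unfolding L1_norm_def by (intro mult_left_mono integral_mono integrable_norm C_c_integrable \<psi> f le H)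
    finally show "norm (lebesgue_density h \<psi>) \<le> H * L1_norm f" .
  qed
qed

lemma lebesgue_density_has_integral:
  fixes h :: "'n::finite cfun"
  assumes h: "continuous_on UNIV h" "\<And>x. norm (h x) \<le> H"
    and f: "continuous_on UNIV f" "integrable lborel f"
  shows "radon_has_integral (lebesgue_density h) f (\<integral>x. f x * h x \<partial>lborel)"
proof -
  define \<phi> where "\<phi> k x = f x * cutoff (real k) x" for k x
  have \<phi>: "\<phi> k \<in> C_c" for k unfolding \<phi>_def by (intro C_c_mult cutoff_C_c f)
  have dc: "continuous_on UNIV (\<lambda>x. f x - \<phi> k x)" and di: "integrable lborel (\<lambda>x. f x - \<phi> k x)" for k
    using f C_cD_cont[OF \<phi>] C_c_integrable[OF \<phi>] by (auto intro: continuous_on_diff)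
  have L1: "(\<lambda>k. H * L1_norm (\<lambda>x. f x - \<phi> k x)) \<longlonglongrightarrow> 0"
    unfolding \<phi>_def using tendsto_mult[OF tendsto_const L1_norm_cutoff_tendsto_zero[OF f(2)], of H] by simp
  have "(\<lambda>k. variation (lebesgue_density h) (\<lambda>x. f x - \<phi> k x)) \<longlonglongrightarrow> 0"
  proof (rule tendsto_sandwich[OF _ _ tendsto_const])
    show "(\<lambda>k. ennreal (H * L1_norm (\<lambda>x. f x - \<phi> k x))) \<longlonglongrightarrow> 0"
      using tendsto_ennrealI[OF L1] by simp
  qed (simp_all add: variation_lebesgue_density[OF h di])
  moreover have "(\<lambda>k. lebesgue_density h (\<phi> k)) \<longlonglongrightarrow> (\<integral>x. f x * h x \<partial>lborel)"
  proof (rule LIM_zero_cancel, rule Lim_null_comparison[OF _ L1], intro always_eventually allI)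
    fix k
    have "lebesgue_density h (\<phi> k) - (\<integral>x. f x * h x \<partial>lborel) = - (\<integral>x. (f x - \<phi> k x) * h x \<partial>lborel)"
      using integrable_mult_bounded(1)[OF f(2) h] integrable_mult_bounded(1)[OF C_c_integrable[OF \<phi>] h]
      by (simp add: lebesgue_density_def left_diff_distrib)
    then show "norm (lebesgue_density h (\<phi> k) - (\<integral>x. f x * h x \<partial>lborel)) \<le> H * L1_norm (\<lambda>x. f x - \<phi> k x)"
      using integrable_mult_bounded(2)[OF di h] by simp
  qed
  ultimately show ?thesis
    unfolding radon_has_integral_def using \<phi> variation_upper_integral_continuous[OF dc]
    by (intro exI[of _ \<phi>]) simp
qed

text \<open>The total variation of \<open>t + K\<close> is at most \<open>H\<close> times the Lebesgue measure of an open ball about \<open>t\<close>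
  whose radius depends only on \<open>K\<close>. An open ball is used since its indicator is lower semicontinuous.\<close>

lemma lebesgue_density_translation_bounded:
  fixes h :: "'n::finite cfun"
  assumes h: "continuous_on UNIV h" "\<And>x. norm (h x) \<le> H"
  shows "lebesgue_density h \<in> translation_bounded_measures"
proof -
  have H: "0 \<le> H" using h(2) norm_ge_zero order_trans by blast
  have "(SUP t. total_variation (lebesgue_density h) ((\<lambda>x. t + x) ` K)) < \<infinity>" if K: "compact K" for K
  proof -
    obtain R where R: "0 < R" "K \<subseteq> ball 0 R"
      using compact_imp_bounded[OF K] by (metis bounded_subset_ballD)
    define V where "V = measure lborel (ball (0::real^'n) R)"
    have "total_variation (lebesgue_density h) ((\<lambda>x. t + x) ` K) \<le> ennreal (H * V)" for t
    proof -
      define g :: "real^'n \<Rightarrow> ennreal" where "g = indicator (ball t R)"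
      have "open {x. c < g x}" for c
      proof -
        have "{x. c < g x} = (if c < 0 then UNIV else if c < 1 then ball t R else {})"
          by (auto simp: g_def indicator_def split: if_splits)
        then show ?thesis by simp
      qed
      then have lsc: "lower_semicontinuous g" by (simp add: lower_semicontinuous_def)
      have ge: "indicator ((\<lambda>x. t + x) ` K) x \<le> g x" for x
        using R(2) by (auto simp: g_def indicator_def dist_norm subset_iff)
      have "total_variation (lebesgue_density h) ((\<lambda>x. t + x) ` K) \<le> variation_lsc (lebesgue_density h) g"
        unfolding total_variation_def variation_upper_integral_def
        by (rule INF_lower) (use lsc ge in blast)
      also have "\<dots> \<le> ennreal (H * V)"
        unfolding variation_lsc_def
      proof (rule SUP_least, rule ennreal_leI, clarify)
        fix \<psi> :: "'n cfun" assume \<psi>: "\<psi> \<in> C_c" and le: "\<forall>x. ennreal (norm (\<psi> x)) \<le> g x"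
        have le': "norm (\<psi> x) \<le> indicator (ball t R) x" for x
          using le[rule_format, of x] by (cases "x \<in> ball t R") (simp_all add: g_def ennreal_le_1)
        have "norm (lebesgue_density h \<psi>) \<le> H * L1_norm \<psi>"
          unfolding lebesgue_density_def by (rule integrable_mult_bounded[OF C_c_integrable[OF \<psi>] h])
        also have "L1_norm \<psi> \<le> (\<integral>x. indicator (ball t R) x \<partial>lborel)"
          unfolding L1_norm_def
          by (intro integral_mono le' integrable_norm C_c_integrable \<psi> integrable_real_indicator
              emeasure_bounded_finite bounded_ball) simp
        also have "\<dots> = V" using R(1) by (simp add: V_def content_ball)
        finally show "norm (lebesgue_density h \<psi>) \<le> H * V" using H by (simp add: mult_left_mono)
      qed
      finally show ?thesis .
    qed
    then have "(SUP t. total_variation (lebesgue_density h) ((\<lambda>x. t + x) ` K)) \<le> ennreal (H * V)"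
      by (rule SUP_least)
    then show ?thesis by (simp add: le_less_trans)
  qed
  then show ?thesis
    unfolding translation_bounded_measures_def using radon_measure_lebesgue_density[OF h] by blast
qed


section \<open>Reflecting and damping a translation bounded measure\<close>

text \<open>A translation bounded measure multiplied by a continuous function that is dominated by the weight is
  finite. The reflection turns the integral of a wave into the value of an inverse transform.\<close>

lemma
  fixes \<nu> :: "'n::finite functional" and q :: "'n cfun"
  assumes \<nu>: "\<nu> \<in> translation_bounded_measures"
    and q: "continuous_on UNIV q" "0 \<le> C" "\<And>x. norm (q x) \<le> C * weight x"
  defines "\<rho> \<equiv> \<lambda>\<phi>. \<nu> (\<lambda>x. \<phi> (- x) * q x)"
  shows finite_radon_measure_damped: "finite_radon_measure \<rho>"
    and damped_integrable:
      "\<And>F B. continuous_on UNIV F \<Longrightarrow> (\<And>x. norm (F x) \<le> B) \<Longrightarrow> radon_integrable \<nu> (\<lambda>x. F (- x) * q x)"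
    and radon_integral_damped:
      "\<And>F B. continuous_on UNIV F \<Longrightarrow> (\<And>x. norm (F x) \<le> B) \<Longrightarrow>
        radon_integral \<rho> F = radon_integral \<nu> (\<lambda>x. F (- x) * q x)"
proof -
  have \<nu>r: "radon_measure \<nu>" using \<nu> by (simp add: translation_bounded_measures_def)
  have refl_cont: "continuous_on UNIV (\<lambda>x. F (- x) * q x)" if "continuous_on UNIV F" for F :: "'n cfun"
    using that q(1) by (intro continuous_intros continuous_on_compose2[OF that]) auto
  have refl_C: "(\<lambda>x. \<phi> (- x) * q x) \<in> C_c" if \<phi>: "\<phi> \<in> C_c" for \<phi>
  proof -
    obtain R where "\<And>x. R < norm x \<Longrightarrow> \<phi> x = 0" using C_cE[OF \<phi>] by blast
    then show ?thesis using refl_cont[OF C_cD_cont[OF \<phi>]] by (intro C_cI[of _ R]) auto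
  qed
  obtain V where V: "0 \<le> V" "variation \<nu> q = ennreal V"
    using variation_finite_of_weight[OF \<nu> q(2,3)] by (metis ennreal_cases infinity_ennreal_def less_irrefl)
  have bound: "norm (\<rho> \<phi>) \<le> B * V" if \<phi>: "\<phi> \<in> C_c" and B: "\<And>x. norm (\<phi> x) \<le> B" for \<phi> B
  proof -
    have B0: "0 \<le> B" using B norm_ge_zero order_trans by blast
    have "ennreal (norm (\<rho> \<phi>)) \<le> variation \<nu> (\<lambda>x. \<phi> (- x) * q x)"
      unfolding \<rho>_def by (rule variation_upper[OF refl_C[OF \<phi>]]) simp
    also have "\<dots> \<le> ennreal B * variation \<nu> q"
      using B B0 by (intro variation_scale_le[OF \<nu>r]) (auto simp: norm_mult intro: mult_right_mono)
    also have "\<dots> = ennreal (B * V)" using V B0 by (simp add: ennreal_mult)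
    finally show ?thesis using B0 V by (simp add: ennreal_le_iff)
  qed
  have lin: "linear_functional_on C_c \<rho>"
    unfolding linear_functional_on_def \<rho>_def
    using radon_add[OF \<nu>r refl_C refl_C] radon_scale[OF \<nu>r refl_C]
    by (simp add: ring_distribs mult.assoc)
  have "\<forall>\<phi>\<in>C_c. supp \<phi> \<subseteq> K \<longrightarrow> norm (\<rho> \<phi>) \<le> V * sup_norm \<phi>" for K
  proof (intro ballI impI)
    fix \<phi> :: "'n cfun" assume \<phi>: "\<phi> \<in> C_c"
    show "norm (\<rho> \<phi>) \<le> V * sup_norm \<phi>"
      using bound[OF \<phi> sup_norm_upper[OF C_c_bounded[OF \<phi>]]] by (simp add: mult.commute)
  qed
  then have "\<exists>C. \<forall>\<phi>\<in>C_c. supp \<phi> \<subseteq> K \<longrightarrow> norm (\<rho> \<phi>) \<le> C * sup_norm \<phi>" for K by blast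
  with lin have \<rho>r: "radon_measure \<rho>" by (simp add: radon_measure_def)
  have V1: "variation \<rho> (\<lambda>_. 1) \<le> ennreal (1 * V)"
    by (intro variation_least ennreal_leI bound) auto
  then have "variation \<rho> (\<lambda>_. 1) < \<infinity>" by (simp add: le_less_trans)
  with \<rho>r show fin: "finite_radon_measure \<rho>" by (simp add: finite_radon_measure_iff)
  obtain M where M: "0 \<le> M" "variation \<rho> (\<lambda>_. 1) = ennreal M"
    using finite_radon_measureE[OF fin] by metis
  fix F :: "'n cfun" and B assume F: "continuous_on UNIV F" "\<And>x. norm (F x) \<le> B"
  have B0: "0 \<le> B" using F(2) norm_ge_zero order_trans by blast
  have "variation \<nu> (\<lambda>x. F (- x) * q x) \<le> ennreal B * variation \<nu> q"
    using F B0 by (intro variation_scale_le[OF \<nu>r]) (auto simp: norm_mult intro: mult_right_mono)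
  also have "\<dots> < \<infinity>" using V by (simp add: ennreal_mult_less_top)
  finally have fin\<nu>: "variation \<nu> (\<lambda>x. F (- x) * q x) < \<infinity>" .
  then show "radon_integrable \<nu> (\<lambda>x. F (- x) * q x)"
    by (intro radon_integrable_continuous[OF \<nu>r refl_cont[OF F(1)]])
  have fin\<rho>: "variation \<rho> F < \<infinity>" using variation_bounded_le[OF \<rho>r M, of F B] F(2) by (simp add: le_less_trans)
  have "\<rho> (\<lambda>x. F x * cutoff (real k) x) = \<nu> (\<lambda>x. F (- x) * q x * cutoff (real k) x)" for k
    by (simp add: \<rho>_def cutoff_def mult_ac)
  then show "radon_integral \<rho> F = radon_integral \<nu> (\<lambda>x. F (- x) * q x)"
    using radon_integral_limit_cutoff[OF \<rho>r F(1) fin\<rho>]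
      radon_integral_limit_cutoff[OF \<nu>r refl_cont[OF F(1)] fin\<nu>] LIMSEQ_unique by simp
qed


section \<open>Rapidly decreasing functions\<close>

text \<open>The decay condition in the definition of Schwartz functions, for a single derivative. It has a name
  of its own because it implies integrability and makes the Fourier transform smooth.\<close>

definition rapid :: "'n::finite cfun \<Rightarrow> bool" where
  "rapid f \<longleftrightarrow> continuous_on UNIV f \<and> (\<forall>\<beta>. bounded (range (\<lambda>x. of_real (monomial \<beta> x) * f x)))"

lemma monomial_zero[simp]: "monomial (\<lambda>_. 0) x = 1"
  by (simp add: monomial_def)

lemma monomial_add: "monomial (\<lambda>j. \<alpha> j + \<beta> j) x = monomial \<alpha> x * monomial \<beta> x"
  by (simp add: monomial_def power_add prod.distrib)

lemma monomial_single: "monomial (\<lambda>i. if i = j then k else 0) x = (x $ j) ^ k"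
  unfolding monomial_def by (simp add: if_distrib prod.delta cong: if_cong)

lemma monomial_step: "0 < \<beta> i \<Longrightarrow> monomial \<beta> x = x $ i * monomial (\<beta>(i := \<beta> i - 1)) x"
proof -
  assume "0 < \<beta> i"
  then have "\<beta> = (\<lambda>l. (if l = i then 1 else 0) + (\<beta>(i := \<beta> i - 1)) l)" by (auto simp: fun_eq_iff)
  then have "monomial \<beta> x = monomial (\<lambda>l. (if l = i then 1 else 0) + (\<beta>(i := \<beta> i - 1)) l) x" by simp
  also have "\<dots> = x $ i * monomial (\<beta>(i := \<beta> i - 1)) x"
    unfolding monomial_add monomial_single by (simp add: fun_upd_def)
  finally show ?thesis .
qed

lemma monomial_continuous[continuous_intros]: "continuous_on S (monomial \<beta>)"
  unfolding monomial_def[abs_def] by (intro continuous_intros)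

lemma norm_monomial_minus: "\<bar>monomial \<beta> (- x)\<bar> = \<bar>monomial \<beta> x\<bar>"
  by (simp add: monomial_def abs_prod power_abs)

text \<open>The exponents that occur when \<open>\<Prod>\<^sub>j (1 + x\<^sub>j\<^sup>2)\<close> is multiplied out.\<close>

definition corner_indices :: "('n::finite \<Rightarrow> nat) set" where
  "corner_indices = PiE UNIV (\<lambda>_. {0, 2})"

lemma weight_expansion:
  "weight (x :: real^'n::finite) * (\<Sum>\<beta>\<in>corner_indices. monomial \<beta> x) = 1"
proof -
  have "(\<Sum>\<beta>\<in>corner_indices. monomial \<beta> x) = (\<Prod>j\<in>UNIV. \<Sum>k\<in>{0,2::nat}. (x $ j) ^ k)"
    unfolding monomial_def corner_indices_def by (subst prod_sum_PiE) auto
  also have "\<dots> = (\<Prod>j\<in>UNIV. 1 + (x $ j)\<^sup>2)" by simp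
  finally show ?thesis
    unfolding weight_def by (simp add: prod.distrib[symmetric] add_nonneg_eq_0_iff)
qed

lemma norm_le_weight:
  fixes f :: "'n::finite cfun"
  assumes "\<And>\<beta>. bounded (range (\<lambda>x. of_real (monomial \<beta> x) * f x))"
  shows "norm (f x) \<le> (\<Sum>\<beta>\<in>corner_indices. sup_norm (\<lambda>x. of_real (monomial \<beta> x) * f x)) * weight x"
proof -
  have "f x = of_real (weight x * (\<Sum>\<beta>\<in>corner_indices. monomial \<beta> x)) * f x"
    by (simp add: weight_expansion)
  also have "\<dots> = of_real (weight x) * (\<Sum>\<beta>\<in>corner_indices. of_real (monomial \<beta> x) * f x)"
    by (simp add: sum_distrib_right mult.assoc)
  also have "norm \<dots> \<le> weight x * (\<Sum>\<beta>\<in>corner_indices. sup_norm (\<lambda>x. of_real (monomial \<beta> x) * f x))"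
    unfolding norm_mult norm_of_real abs_of_nonneg[OF weight_nonneg]
    by (intro mult_left_mono weight_nonneg order_trans[OF norm_sum] sum_mono sup_norm_upper assms)
  finally show ?thesis by (simp add: mult.commute)
qed

lemma rapid_weight:
  fixes f :: "'n::finite cfun"
  assumes "rapid f"
  obtains C where "0 \<le> C" "\<And>x. norm (f x) \<le> C * weight x"
proof (rule that)
  show "norm (f x) \<le> (\<Sum>\<beta>\<in>corner_indices. sup_norm (\<lambda>x. of_real (monomial \<beta> x) * f x)) * weight x" for x
    using assms by (intro norm_le_weight) (simp add: rapid_def)
  show "0 \<le> (\<Sum>\<beta>\<in>corner_indices. sup_norm (\<lambda>x. of_real (monomial \<beta> x) * f x))"
    using assms by (intro sum_nonneg sup_norm_nonneg) (simp add: rapid_def)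
qed

lemma rapid_cont: "rapid f \<Longrightarrow> continuous_on UNIV f"
  by (simp add: rapid_def)

lemma rapid_integrable: "rapid f \<Longrightarrow> integrable lborel f"
  by (metis integrable_weight_dominated rapid_cont rapid_weight)

lemma rapid_add:
  assumes "rapid f" "rapid g"
  shows "rapid (\<lambda>x. f x + g x)"
  unfolding rapid_def
proof (intro conjI allI)
  show "continuous_on UNIV (\<lambda>x. f x + g x)" using assms by (intro continuous_on_add rapid_cont)
  fix \<beta>
  have "bounded (range (\<lambda>x. of_real (monomial \<beta> x) * f x))" "bounded (range (\<lambda>x. of_real (monomial \<beta> x) * g x))"
    using assms by (auto simp: rapid_def)
  from bounded_plus_comp[OF this]
  show "bounded (range (\<lambda>x. of_real (monomial \<beta> x) * (f x + g x)))" by (simp add: ring_distribs)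
qed

lemma rapid_scale:
  assumes "rapid f"
  shows "rapid (\<lambda>x. c * f x)"
  unfolding rapid_def
proof (intro conjI allI)
  show "continuous_on UNIV (\<lambda>x. c * f x)" using assms by (intro continuous_intros rapid_cont)
  fix \<beta>
  have "bounded (range (\<lambda>x. of_real (monomial \<beta> x) * f x))" using assms by (auto simp: rapid_def)
  then obtain B where "\<And>x. norm (of_real (monomial \<beta> x) * f x) \<le> B" by (auto simp: bounded_iff)
  then have "norm (of_real (monomial \<beta> x) * (c * f x)) \<le> norm c * B" for x
    using mult_left_mono[of "norm (of_real (monomial \<beta> x) * f x)" B "norm c"] by (simp add: norm_mult mult_ac)
  then show "bounded (range (\<lambda>x. of_real (monomial \<beta> x) * (c * f x)))" by (auto simp: bounded_iff)
qed

lemma rapid_monomial: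
  assumes "rapid f"
  shows "rapid (\<lambda>x. of_real (monomial \<alpha> x) * f x)"
  unfolding rapid_def
proof (intro conjI allI)
  show "continuous_on UNIV (\<lambda>x. of_real (monomial \<alpha> x) * f x)"
    using assms by (intro continuous_intros rapid_cont)
  fix \<beta>
  show "bounded (range (\<lambda>x. of_real (monomial \<beta> x) * (of_real (monomial \<alpha> x) * f x)))"
    using assms[unfolded rapid_def, THEN conjunct2, rule_format, of "\<lambda>j. \<beta> j + \<alpha> j"]
    by (simp add: monomial_add mult.assoc)
qed

lemma rapid_coord_power: "rapid f \<Longrightarrow> rapid (\<lambda>x. of_real ((x $ j) ^ k) * f x)"
  using rapid_monomial[of f "\<lambda>i. if i = j then k else 0"] by (simp only: monomial_single)

lemma rapid_coord: "rapid f \<Longrightarrow> rapid (\<lambda>x. of_real (x $ j) * f x)"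
  using rapid_coord_power[of f j 1] by simp

lemma rapid_norm_square_integrable:
  fixes f :: "'n::finite cfun"
  assumes "rapid f"
  shows "integrable lborel (\<lambda>x. (norm x)\<^sup>2 * norm (f x))"
proof -
  have "(norm x)\<^sup>2 * norm (f x) = (\<Sum>j\<in>UNIV. norm (of_real ((x $ j)\<^sup>2) * f x))" for x
    by (simp add: norm_mult norm_power sum_distrib_right norm_vec_def L2_set_def sum_nonneg)
  then show ?thesis
    using rapid_integrable[OF rapid_coord_power[OF assms]] by simp
qed


section \<open>Partial derivatives\<close>

lemma partial_deriv_eq: "(f has_derivative f') (at x) \<Longrightarrow> partial_deriv j f x = f' (axis j 1)"
  using frechet_derivative_at[of f f' x] by (simp add: partial_deriv_def)

lemma differentiable_has_derivative:
  "f differentiable (at x) \<Longrightarrow> (f has_derivative frechet_derivative f (at x)) (at x)"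
  by (simp add: frechet_derivative_works)

lemma partial_deriv_frechet: "frechet_derivative f (at x) (axis j 1) = partial_deriv j f x"
  by (simp add: partial_deriv_def)

text \<open>By translation invariance the difference quotients of \<open>G\<close> in direction \<open>j\<close> have integral \<open>0\<close>. They
  converge to the partial derivative and, by the mean value inequality, stay below a multiple of the
  weight, which changes by at most a constant factor along the step.\<close>

lemma integral_partial_deriv_eq_0:
  fixes G :: "'n::finite cfun"
  assumes d: "\<And>x. G differentiable (at x)" and int: "integrable lborel G"
    and c: "continuous_on UNIV (partial_deriv j G)"
    and b: "\<And>x. norm (partial_deriv j G x) \<le> C * weight x" and C: "0 \<le> C"
  shows "(\<integral>x. partial_deriv j G x \<partial>lborel) = 0"
proof -
  let ?e = "axis j 1 :: real^'n"
  define q where "q n y = (G (y + (1 / real (Suc n)) *\<^sub>R ?e) - G y) /\<^sub>R (1 / real (Suc n))" for n y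
  have path: "((\<lambda>s. G (y + s *\<^sub>R ?e)) has_vector_derivative partial_deriv j G (y + s *\<^sub>R ?e)) (at s within S)" for y s S
  proof -
    have "((\<lambda>s. G (y + s *\<^sub>R ?e)) has_derivative (\<lambda>h. frechet_derivative G (at (y + s *\<^sub>R ?e)) (h *\<^sub>R ?e))) (at s within S)"
      by (rule has_derivative_compose[of "\<lambda>s. y + s *\<^sub>R ?e"])
        (auto intro!: derivative_eq_intros differentiable_has_derivative[OF d])
    moreover have "frechet_derivative G (at z) (h *\<^sub>R ?e) = h *\<^sub>R partial_deriv j G z" for h z
      using linear_scale[OF linear_frechet_derivative[OF d]] by (simp add: partial_deriv_def)
    ultimately show ?thesis by (simp add: has_vector_derivative_def)
  qed
  have lim: "(\<lambda>n. q n y) \<longlonglongrightarrow> partial_deriv j G y" for y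
  proof -
    have "((\<lambda>s. G (y + s *\<^sub>R ?e)) has_vector_derivative partial_deriv j G y) (at 0)"
      using path[of y 0 UNIV] by simp
    then have "((\<lambda>h. (G (y + h *\<^sub>R ?e) - G y) /\<^sub>R h) \<longlongrightarrow> partial_deriv j G y) (at 0)"
      unfolding has_vector_derivative_def has_derivative_at
    proof -
      assume "bounded_linear (\<lambda>x. x *\<^sub>R partial_deriv j G y) \<and>
        (\<lambda>h. norm (G (y + (0 + h) *\<^sub>R ?e) - G (y + 0 *\<^sub>R ?e) - h *\<^sub>R partial_deriv j G y) / norm h) \<midarrow>0\<rightarrow> 0"
      then have "(\<lambda>h. norm (G (y + h *\<^sub>R ?e) - G y - h *\<^sub>R partial_deriv j G y) / norm h) \<midarrow>0\<rightarrow> 0" by simp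
      then have "(\<lambda>h. norm ((G (y + h *\<^sub>R ?e) - G y) /\<^sub>R h - partial_deriv j G y)) \<midarrow>0\<rightarrow> 0"
      proof (rule Lim_transform_eventually)
        show "\<forall>\<^sub>F h in at 0. norm (G (y + h *\<^sub>R ?e) - G y - h *\<^sub>R partial_deriv j G y) / norm h
            = norm ((G (y + h *\<^sub>R ?e) - G y) /\<^sub>R h - partial_deriv j G y)"
        proof (rule eventually_at_topological[THEN iffD2], intro exI[of _ UNIV] conjI ballI impI)
          fix h :: real assume h: "h \<noteq> 0"
          have "(G (y + h *\<^sub>R ?e) - G y) /\<^sub>R h - partial_deriv j G y
              = (G (y + h *\<^sub>R ?e) - G y - h *\<^sub>R partial_deriv j G y) /\<^sub>R h"
            using h by (simp add: scaleR_diff_right)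
          then show "norm (G (y + h *\<^sub>R ?e) - G y - h *\<^sub>R partial_deriv j G y) / norm h
            = norm ((G (y + h *\<^sub>R ?e) - G y) /\<^sub>R h - partial_deriv j G y)"
            by (simp add: divide_inverse mult.commute)
        qed auto
      qed
      then show ?thesis by (rule tendsto_norm_zero_cancel[THEN LIM_zero_cancel])
    qed
    then show ?thesis
      unfolding q_def
      by (rule filterlim_compose) (use LIMSEQ_inverse_real_of_nat in
          \<open>auto simp: filterlim_at inverse_eq_divide\<close>)
  qed
  have q_le: "norm (q n y) \<le> C * 3 ^ CARD('n) * weight y" for n y
  proof -
    define t where "t = 1 / real (Suc n)"
    have t: "0 < t" "t \<le> 1" by (auto simp: t_def)
    have "norm (G (y + t *\<^sub>R ?e) - G (y + 0 *\<^sub>R ?e)) \<le> (C * 3 ^ CARD('n) * weight y) * norm (t - 0)"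
    proof (rule differentiable_bound[where S = "{0..t}"])
      fix s assume s: "s \<in> {0..t}"
      show "((\<lambda>s. G (y + s *\<^sub>R ?e)) has_derivative (\<lambda>h. h *\<^sub>R partial_deriv j G (y + s *\<^sub>R ?e))) (at s within {0..t})"
        using path[of y s] by (simp add: has_vector_derivative_def)
      have "norm (partial_deriv j G (y + s *\<^sub>R ?e)) \<le> C * weight (y + s *\<^sub>R ?e)" by (rule b)
      also have "\<dots> \<le> C * (3 ^ CARD('n) * weight y)"
        using s t by (intro mult_left_mono weight_slowly_varying C) (simp add: norm_axis_1)
      finally have "norm (partial_deriv j G (y + s *\<^sub>R ?e)) \<le> C * 3 ^ CARD('n) * weight y" by (simp add: mult.assoc)
      then show "onorm (\<lambda>h. h *\<^sub>R partial_deriv j G (y + s *\<^sub>R ?e)) \<le> C * 3 ^ CARD('n) * weight y"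
        by (intro onorm_le) (simp add: mult.commute mult_left_mono)
    qed (use t in auto)
    then have "norm (G (y + t *\<^sub>R ?e) - G y) / t \<le> C * 3 ^ CARD('n) * weight y" using t by (simp add: field_simps)
    then show ?thesis unfolding q_def t_def[symmetric] using t by (simp add: divide_inverse mult.commute)
  qed
  have shift: "integrable lborel (\<lambda>y. G (y + v))" "(\<integral>y. G (y + v) \<partial>lborel) = integral\<^sup>L lborel G" for v
    using integrable_affine[OF int, of 1 v] integral_affine[OF int, of 1 v] by (simp_all add: add.commute)
  have qi: "integrable lborel (q n)" "integral\<^sup>L lborel (q n) = 0" for n
    unfolding q_def using int by (simp_all add: shift)
  have "(\<lambda>n. integral\<^sup>L lborel (q n)) \<longlonglongrightarrow> (\<integral>x. partial_deriv j G x \<partial>lborel)"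
  proof (rule integral_dominated_convergence[where w = "\<lambda>y. C * 3 ^ CARD('n) * weight y"])
    show "integrable lborel (\<lambda>y::real^'n. C * 3 ^ CARD('n) * weight y)"
      by (intro integrable_mult_right weight_integrable)
    show "partial_deriv j G \<in> borel_measurable lborel" using c by (simp add: borel_measurable_continuous_onI)
    show "q n \<in> borel_measurable lborel" for n using qi(1)[of n] by simp
  qed (use lim q_le in auto)
  then show ?thesis using LIMSEQ_unique[OF _ tendsto_const[of 0]] by (simp add: qi)
qed

text \<open>Integration by parts: the derivative of \<open>y \<mapsto> wave x y * g y\<close> has integral \<open>0\<close>.\<close>

lemma fourier_partial_deriv:
  fixes g :: "'n::finite cfun"
  assumes g: "rapid g" and d: "\<And>x. g differentiable (at x)" and g': "rapid (partial_deriv j g)"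
  shows "fourier (partial_deriv j g) x = 2 * of_real pi * \<i> * of_real (x $ j) * fourier g x"
proof -
  define k where "k = - (2 * of_real pi * \<i>)"
  define G where "G y = wave x y * g y" for y
  have wd: "(wave x has_derivative (\<lambda>v. wave x y * (k * of_real (x \<bullet> v)))) (at y)" for y
  proof -
    have "((\<lambda>y. k * of_real (x \<bullet> y)) has_derivative (\<lambda>v. k * of_real (x \<bullet> v))) (at y)"
      by (intro has_derivative_mult_right has_derivative_of_real has_derivative_inner_right has_derivative_ident)
    from has_derivative_compose[OF this DERIV_exp[unfolded has_field_derivative_def]]
    show ?thesis unfolding wave_def[abs_def] k_def by (simp add: mult_ac)
  qed
  have Gd: "(G has_derivative (\<lambda>v. wave x y * frechet_derivative g (at y) v + wave x y * (k * of_real (x \<bullet> v)) * g y)) (at y)" for y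
    unfolding G_def by (intro has_derivative_mult wd differentiable_has_derivative d)
  have Gp: "partial_deriv j G = (\<lambda>y. wave x y * (partial_deriv j g y + (k * of_real (x $ j)) * g y))"
    using partial_deriv_eq[OF Gd] by (simp add: fun_eq_iff partial_deriv_frechet inner_axis' inner_axis ring_distribs mult.assoc)
  have r: "rapid (\<lambda>y. partial_deriv j g y + (k * of_real (x $ j)) * g y)"
    by (intro rapid_add g' rapid_scale g)
  obtain C where C: "0 \<le> C" "\<And>y. norm (partial_deriv j g y + (k * of_real (x $ j)) * g y) \<le> C * weight y"
    using rapid_weight[OF r] by blast
  have "(\<integral>y. partial_deriv j G y \<partial>lborel) = 0"
  proof (rule integral_partial_deriv_eq_0[OF _ _ _ _ C(1)])
    show "G differentiable (at y)" for y using Gd by (auto simp: differentiable_def)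
    show "integrable lborel G" unfolding G_def by (intro wave_integrable rapid_integrable g)
    show "continuous_on UNIV (partial_deriv j G)" unfolding Gp by (intro continuous_on_mult wave_cont rapid_cont r)
    show "norm (partial_deriv j G y) \<le> C * weight y" for y unfolding Gp norm_mult norm_wave using C(2) by simp
  qed
  then have "fourier (\<lambda>y. partial_deriv j g y + (k * of_real (x $ j)) * g y) x = 0"
    by (simp add: Gp fourier_wave)
  then have "fourier (partial_deriv j g) x + k * of_real (x $ j) * fourier g x = 0"
    using fourier_add_scale[OF rapid_integrable[OF g'] rapid_integrable[OF g]] by simp
  then show ?thesis by (simp add: k_def add_eq_0_iff)
qed

text \<open>The second order Taylor remainder of the wave is at most \<open>(2\<pi> |v| |y|)\<^sup>2\<close>, and \<open>|y|\<^sup>2 f(y)\<close> is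
  integrable.\<close>

lemma fourier_has_derivative:
  fixes f :: "'n::finite cfun"
  assumes f: "rapid f"
  shows "(fourier f has_derivative
    (\<lambda>v. \<Sum>j\<in>UNIV. of_real (v $ j) * fourier (\<lambda>y. - (2 * of_real pi * \<i>) * (of_real (y $ j) * f y)) x)) (at x)"
    (is "(_ has_derivative ?D) _")
proof -
  define k where "k = - (2 * of_real pi * \<i>)"
  define K where "K = (\<integral>y. (norm y)\<^sup>2 * norm (f y) \<partial>lborel)"
  have fi: "integrable lborel (\<lambda>y. wave x y * f y)" for x by (intro wave_integrable rapid_integrable f)
  have fji: "integrable lborel (\<lambda>y. wave x y * (k * (of_real (y $ j) * f y)))" for j
    by (intro wave_integrable rapid_integrable rapid_scale rapid_coord f)
  have rem: "norm (fourier f (x + v) - fourier f x - ?D v) \<le> (2 * pi * norm v)\<^sup>2 * K" for v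
  proof -
    have Dv: "?D v = (\<integral>y. (\<Sum>j\<in>UNIV. of_real (v $ j) * (wave x y * (k * (of_real (y $ j) * f y)))) \<partial>lborel)"
      unfolding fourier_wave k_def[symmetric] using fji by simp
    have Di: "integrable lborel (\<lambda>y. \<Sum>j\<in>UNIV. of_real (v $ j) * (wave x y * (k * (of_real (y $ j) * f y))))"
      using fji by simp
    have lin: "(\<Sum>j\<in>UNIV. of_real (v $ j) * (wave x y * (k * (of_real (y $ j) * f y))))
        = wave x y * (k * of_real (v \<bullet> y)) * f y" for y
      unfolding inner_vec_def by (simp add: sum_distrib_left sum_distrib_right mult_ac)
    have "wave (x + v) y * f y - wave x y * f y - (\<Sum>j\<in>UNIV. of_real (v $ j) * (wave x y * (k * (of_real (y $ j) * f y))))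
        = wave x y * (wave v y - 1 + 2 * of_real pi * \<i> * of_real (v \<bullet> y)) * f y" for y
      unfolding lin by (simp add: wave_add k_def algebra_simps)
    note integrand = this
    note i2 = Bochner_Integration.integrable_diff[OF fi[of "x + v"] fi[of x]]
    have i: "integrable lborel (\<lambda>y. wave x y * (wave v y - 1 + 2 * of_real pi * \<i> * of_real (v \<bullet> y)) * f y)"
      using Bochner_Integration.integrable_diff[OF i2 Di] unfolding integrand .
    have "fourier f (x + v) - fourier f x - ?D v
        = (\<integral>y. wave x y * (wave v y - 1 + 2 * of_real pi * \<i> * of_real (v \<bullet> y)) * f y \<partial>lborel)"
      unfolding Dv integrand[symmetric] Bochner_Integration.integral_diff[OF i2 Di]
        Bochner_Integration.integral_diff[OF fi[of "x + v"] fi[of x]] by (simp add: fourier_wave)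
    also have "norm (\<integral>y. wave x y * (wave v y - 1 + 2 * of_real pi * \<i> * of_real (v \<bullet> y)) * f y \<partial>lborel)
        \<le> (\<integral>y. (2 * pi * norm v)\<^sup>2 * ((norm y)\<^sup>2 * norm (f y)) \<partial>lborel)"
    proof (rule order_trans[OF integral_norm_bound integral_mono])
      show "integrable lborel (\<lambda>y. (2 * pi * norm v)\<^sup>2 * ((norm y)\<^sup>2 * norm (f y)))"
        by (intro integrable_mult_right rapid_norm_square_integrable f)
      fix y
      have "norm (wave v y - 1 + 2 * of_real pi * \<i> * of_real (v \<bullet> y)) \<le> (2 * pi * \<bar>v \<bullet> y\<bar>)\<^sup>2" by (rule wave_taylor)
      also have "\<dots> \<le> (2 * pi * (norm v * norm y))\<^sup>2"
        using Cauchy_Schwarz_ineq2[of v y] by (intro power_mono mult_left_mono) auto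
      finally have "norm (wave v y - 1 + 2 * of_real pi * \<i> * of_real (v \<bullet> y)) * norm (f y)
          \<le> (2 * pi * (norm v * norm y))\<^sup>2 * norm (f y)" by (rule mult_right_mono) simp
      then show "norm (wave x y * (wave v y - 1 + 2 * of_real pi * \<i> * of_real (v \<bullet> y)) * f y)
          \<le> (2 * pi * norm v)\<^sup>2 * ((norm y)\<^sup>2 * norm (f y))"
        by (simp add: norm_mult power_mult_distrib mult_ac)
    qed (use i in simp)
    finally show ?thesis by (simp add: K_def)
  qed
  have "((\<lambda>v. norm (fourier f (x + v) - fourier f x - ?D v) / norm v) \<longlongrightarrow> 0) (at 0)"
  proof (rule Lim_null_comparison)
    show "((\<lambda>v::real^'n. ((2 * pi)\<^sup>2 * K) * norm v) \<longlongrightarrow> 0) (at 0)"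
      by (rule tendsto_eq_intros | simp)+
    show "\<forall>\<^sub>F v in at 0. norm (norm (fourier f (x + v) - fourier f x - ?D v) / norm v) \<le> ((2 * pi)\<^sup>2 * K) * norm v"
    proof (intro always_eventually allI)
      fix v
      show "norm (norm (fourier f (x + v) - fourier f x - ?D v) / norm v) \<le> ((2 * pi)\<^sup>2 * K) * norm v"
        using rem[of v] by (cases "v = 0") (simp_all add: field_simps power2_eq_square)
    qed
  qed
  moreover have "bounded_linear ?D"
    by (intro bounded_linear_sum bounded_linear_mult_const bounded_linear_compose[OF bounded_linear_of_real bounded_linear_vec_nth])
  ultimately show ?thesis unfolding has_derivative_at by blast
qed

lemma partial_deriv_fourier:
  fixes f :: "'n::finite cfun"
  assumes "rapid f"
  shows "partial_deriv j (fourier f) = fourier (\<lambda>y. - (2 * of_real pi * \<i>) * (of_real (y $ j) * f y))"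
proof
  fix x
  have pick: "(\<Sum>i\<in>UNIV. of_real (axis j 1 $ i) * c i) = c j" for c :: "'n \<Rightarrow> complex"
  proof -
    have "of_real (axis j 1 $ i) * c i = (if i = j then c i else 0)" for i by (simp add: axis_def)
    then show ?thesis by simp
  qed
  show "partial_deriv j (fourier f) x = fourier (\<lambda>y. - (2 * of_real pi * \<i>) * (of_real (y $ j) * f y)) x"
    unfolding partial_deriv_eq[OF fourier_has_derivative[OF assms]] pick ..
qed

lemma smooth_fourier:
  fixes f :: "'n::finite cfun"
  assumes "rapid f"
  shows "smooth (fourier f)"
proof -
  have "\<exists>g. rapid g \<and> foldr partial_deriv js (fourier f) = fourier g" for js
  proof (induction js)
    case (Cons j js)
    then obtain g where g: "rapid g" "foldr partial_deriv js (fourier f) = fourier g" by blast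
    then show ?case using partial_deriv_fourier[OF g(1), of j]
      by (intro exI[of _ "\<lambda>y. - (2 * of_real pi * \<i>) * (of_real (y $ j) * g y)"] conjI rapid_scale rapid_coord) simp_all
  qed (use assms in auto)
  moreover have "fourier g differentiable (at x)" if "rapid g" for g :: "'n cfun" and x
    using fourier_has_derivative[OF that] by (auto simp: differentiable_def)
  ultimately show ?thesis unfolding smooth_def by metis
qed


section \<open>The Schwartz space\<close>

lemma smoothD: "smooth f \<Longrightarrow> foldr partial_deriv js f differentiable (at x)"
  by (simp add: smooth_def)

lemma smooth_differentiable: "smooth f \<Longrightarrow> f differentiable (at x)"
  using smoothD[of f "[]"] by simp

lemma smooth_foldr: "smooth f \<Longrightarrow> smooth (foldr partial_deriv ks f)"
  unfolding smooth_def by (metis comp_apply foldr_append)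

lemma smooth_partial_deriv: "smooth f \<Longrightarrow> smooth (partial_deriv j f)"
  using smooth_foldr[of f "[j]"] by simp

lemma smooth_continuous: "smooth f \<Longrightarrow> continuous_on S f"
  by (intro continuous_at_imp_continuous_on ballI differentiable_imp_continuous_within smooth_differentiable)

lemma partial_deriv_add_scale:
  assumes "f differentiable (at x)" "g differentiable (at x)"
  shows "partial_deriv j (\<lambda>x. f x + c * g x) x = partial_deriv j f x + c * partial_deriv j g x"
proof -
  have "((\<lambda>x. f x + c * g x) has_derivative
      (\<lambda>v. frechet_derivative f (at x) v + c * frechet_derivative g (at x) v)) (at x)"
    by (intro has_derivative_add has_derivative_mult_right differentiable_has_derivative assms)
  from partial_deriv_eq[OF this] show ?thesis by (simp add: partial_deriv_frechet)
qed

lemma foldr_partial_deriv_add_scale: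
  assumes "smooth f" "smooth g"
  shows "foldr partial_deriv js (\<lambda>x. f x + c * g x) = (\<lambda>x. foldr partial_deriv js f x + c * foldr partial_deriv js g x)"
proof (induction js)
  case (Cons j js)
  show ?case
    unfolding foldr.simps comp_apply Cons
    by (rule ext) (rule partial_deriv_add_scale[OF smoothD[OF assms(1)] smoothD[OF assms(2)]])
qed simp

lemma smooth_add_scale: "smooth f \<Longrightarrow> smooth g \<Longrightarrow> smooth (\<lambda>x. f x + c * g x)"
  by (subst smooth_def) (auto simp: foldr_partial_deriv_add_scale intro!: derivative_intros smoothD)

lemma partial_deriv_coord:
  assumes "f differentiable (at x)"
  shows "partial_deriv i (\<lambda>x. of_real (x $ j) * f x) x
    = of_real (x $ j) * partial_deriv i f x + (if i = j then f x else 0)"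
    and "(\<lambda>x. of_real (x $ j) * f x) differentiable (at x)"
proof -
  have D: "((\<lambda>x. of_real (x $ j) * f x) has_derivative
      (\<lambda>v. of_real (x $ j) * frechet_derivative f (at x) v + of_real (v $ j) * f x)) (at x)"
    by (intro has_derivative_mult differentiable_has_derivative[OF assms] has_derivative_of_real
        bounded_linear_imp_has_derivative bounded_linear_vec_nth)
  show "partial_deriv i (\<lambda>x. of_real (x $ j) * f x) x
    = of_real (x $ j) * partial_deriv i f x + (if i = j then f x else 0)"
    unfolding partial_deriv_eq[OF D] partial_deriv_frechet by (simp add: axis_def)
  show "(\<lambda>x. of_real (x $ j) * f x) differentiable (at x)" using D by (auto simp: differentiable_def)
qed

text \<open>The functions \<open>x\<^sub>j u + v\<close> with smooth \<open>u\<close>, \<open>v\<close> are differentiable, and the class of these functions is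
  closed under partial derivatives.\<close>

lemma smooth_coord:
  fixes f :: "'n::finite cfun"
  assumes "smooth f"
  shows "smooth (\<lambda>x. of_real (x $ j) * f x)"
proof -
  have "\<forall>(u :: 'n cfun) v x. smooth u \<longrightarrow> smooth v \<longrightarrow>
      foldr partial_deriv js (\<lambda>x. of_real (x $ j) * u x + 1 * v x) differentiable (at x)" for js
  proof (induction js rule: rev_induct)
    case Nil
    show ?case
    proof (intro allI impI)
      fix u v :: "'n cfun" and x assume "smooth u" "smooth v"
      then have "(\<lambda>x. of_real (x $ j) * u x + v x) differentiable (at x)"
        by (intro differentiable_add partial_deriv_coord(2) smooth_differentiable)
      then show "foldr partial_deriv [] (\<lambda>x. of_real (x $ j) * u x + 1 * v x) differentiable (at x)" by simp
    qed
  next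
    case (snoc i js)
    show ?case
    proof (intro allI impI)
      fix u v :: "'n cfun" and x assume u: "smooth u" and v: "smooth v"
      have "partial_deriv i (\<lambda>x. of_real (x $ j) * u x + 1 * v x)
          = (\<lambda>x. of_real (x $ j) * partial_deriv i u x + 1 * ((partial_deriv i v x) + (if i = j then 1 else 0) * u x))"
        unfolding partial_deriv_add_scale[OF partial_deriv_coord(2)[OF smooth_differentiable[OF u]] smooth_differentiable[OF v]]
          partial_deriv_coord(1)[OF smooth_differentiable[OF u]] fun_eq_iff by simp
      then show "foldr partial_deriv (js @ [i]) (\<lambda>x. of_real (x $ j) * u x + 1 * v x) differentiable at x"
        using snoc[rule_format, OF smooth_partial_deriv[OF u, of i] smooth_add_scale[OF smooth_partial_deriv[OF v, of i] u]]
        by simp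
    qed
  qed
  moreover have "smooth (\<lambda>x. 0 * f x)"
  proof -
    have "(\<lambda>x. 0 * f x) = (\<lambda>x. f x + (-1) * f x)" by simp
    then show ?thesis using smooth_add_scale[OF assms assms, of "-1"] by simp
  qed
  ultimately show ?thesis using assms unfolding smooth_def[of "\<lambda>x. of_real (x $ j) * f x"] by fastforce
qed

lemma
  fixes f :: "'n::finite cfun"
  assumes "smooth f"
  shows foldr_partial_deriv_reflect:
      "foldr partial_deriv js (\<lambda>x. f (- x)) = (\<lambda>x. (-1) ^ length js * foldr partial_deriv js f (- x))"
    and smooth_reflect: "smooth (\<lambda>x. f (- x))"
proof -
  have D: "((\<lambda>x. c * g (- x)) has_derivative (\<lambda>v. c * frechet_derivative g (at (- x)) (- v))) (at x)"
    if "g differentiable (at (- x))" for g :: "'n cfun" and c x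
    by (intro has_derivative_mult_right has_derivative_compose[of uminus uminus, OF _ differentiable_has_derivative[OF that]])
      (auto intro!: derivative_eq_intros)
  show eq: "foldr partial_deriv js (\<lambda>x. f (- x)) = (\<lambda>x. (-1) ^ length js * foldr partial_deriv js f (- x))" for js
  proof (induction js)
    case (Cons j js)
    have "frechet_derivative g (at y) (- v) = - frechet_derivative g (at y) v" if "g differentiable (at y)"
      for g :: "'n cfun" and y v
      using linear_frechet_derivative[OF that] by (rule linear_neg)
    note neg = this[OF smoothD[OF assms]]
    show ?case
      unfolding foldr.simps comp_apply Cons partial_deriv_eq[OF D[OF smoothD[OF assms]]] neg partial_deriv_frechet
      by simp
  qed simp
  show "smooth (\<lambda>x. f (- x))"
    unfolding smooth_def eq using D[OF smoothD[OF assms]] by (auto simp: differentiable_def)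
qed

text \<open>The order in which the coordinates are processed by \<open>multi_deriv\<close>.\<close>

definition index_order :: "'n::finite list" where
  "index_order = (SOME js. distinct js \<and> set js = UNIV)"

lemma index_order: "distinct (index_order :: 'n::finite list)" "set (index_order :: 'n list) = UNIV"
proof -
  have "\<exists>js::'n list. distinct js \<and> set js = UNIV" using finite_distinct_list[of "UNIV :: 'n set"] by auto
  then show "distinct (index_order :: 'n list)" "set (index_order :: 'n list) = UNIV"
    unfolding index_order_def by (metis (mono_tags, lifting) someI_ex)+
qed

lemma multi_deriv_index_order: "multi_deriv \<alpha> = foldr (\<lambda>j. partial_deriv j ^^ \<alpha> j) index_order"
  by (simp add: multi_deriv_def index_order_def)

lemma foldr_replicate_partial: "foldr partial_deriv (replicate k j) f = (partial_deriv j ^^ k) f"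
  by (induction k) auto

lemma multi_deriv_foldr:
  "\<exists>js. \<forall>f. multi_deriv \<alpha> f = foldr partial_deriv js f"
proof -
  have "foldr (\<lambda>j. partial_deriv j ^^ \<alpha> j) ks f = foldr partial_deriv (concat (map (\<lambda>j. replicate (\<alpha> j) j) ks)) f" for ks f
    by (induction ks) (auto simp: foldr_replicate_partial)
  then show ?thesis unfolding multi_deriv_index_order by blast
qed

lemma smooth_multi_deriv:
  assumes "smooth f"
  shows "smooth (multi_deriv \<alpha> f)"
proof -
  obtain js where "\<forall>f. multi_deriv \<alpha> f = foldr partial_deriv js f" using multi_deriv_foldr[of \<alpha>] by blast
  then show ?thesis using smooth_foldr[OF assms] by simp
qed

lemma foldr_power_zero: "(\<And>j. j \<in> set ks \<Longrightarrow> \<alpha> j = 0) \<Longrightarrow> foldr (\<lambda>j. g j ^^ \<alpha> j) ks f = f"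
  by (induction ks) auto

lemma foldr_power_cong: "(\<And>j. j \<in> set ks \<Longrightarrow> \<alpha> j = \<beta> j) \<Longrightarrow> foldr (\<lambda>j. g j ^^ \<alpha> j) ks f = foldr (\<lambda>j. g j ^^ \<beta> j) ks f"
  by (induction ks) auto

lemma multi_deriv_zero: "multi_deriv (\<lambda>_. 0) f = f"
  unfolding multi_deriv_index_order by (rule foldr_power_zero) simp

lemma multi_deriv_single: "multi_deriv (\<lambda>i. if i = j then k else 0) f = (partial_deriv j ^^ k) f"
proof -
  obtain xs ys where s: "index_order = xs @ j # ys" using split_list[of j index_order] by (auto simp: index_order)
  have "distinct (xs @ j # ys)" unfolding s[symmetric] by (rule index_order(1))
  then have "foldr (\<lambda>i. partial_deriv i ^^ (if i = j then k else 0)) xs u = u"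
    "foldr (\<lambda>i. partial_deriv i ^^ (if i = j then k else 0)) ys u = u" for u
    by (auto intro!: foldr_power_zero)
  then show ?thesis unfolding multi_deriv_index_order s by simp
qed

text \<open>Since \<open>multi_deriv\<close> applies the derivatives in a fixed order, the outermost one belongs to the first
  coordinate with a nonzero exponent, and it can be split off without knowing that partial derivatives
  commute. The same coordinate comes first for every multi-index \<open>\<gamma>\<close> whose support lies in that of
  \<open>\<alpha>\<close>.\<close>

lemma leading_index:
  fixes \<alpha> :: "'n::finite \<Rightarrow> nat"
  assumes "\<alpha> \<noteq> (\<lambda>_. 0)"
  obtains i where "0 < \<alpha> i"
    "\<And>\<gamma> f. (\<And>l. \<alpha> l = 0 \<Longrightarrow> \<gamma> l = 0) \<Longrightarrow> 0 < \<gamma> i \<Longrightarrow> multi_deriv \<gamma> f = partial_deriv i (multi_deriv (\<gamma>(i := \<gamma> i - 1)) f)"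
proof -
  have "\<exists>i\<in>set index_order. 0 < \<alpha> i" using assms by (auto simp: index_order fun_eq_iff)
  then obtain xs i ys where s: "index_order = xs @ i # ys" and i: "0 < \<alpha> i" and xs: "\<And>l. l \<in> set xs \<Longrightarrow> \<alpha> l = 0"
    using split_list_first_prop[of index_order "\<lambda>i. 0 < \<alpha> i"] by auto
  have d: "distinct (xs @ i # ys)" unfolding s[symmetric] by (rule index_order(1))
  have "multi_deriv \<gamma> f = partial_deriv i (multi_deriv (\<gamma>(i := \<gamma> i - 1)) f)"
    if z: "\<And>l. \<alpha> l = 0 \<Longrightarrow> \<gamma> l = 0" and g: "0 < \<gamma> i" for \<gamma> f
  proof -
    obtain m where m: "\<gamma> i = Suc m" using g by (cases "\<gamma> i") auto
    have 1: "foldr (\<lambda>j. partial_deriv j ^^ \<gamma> j) xs u = u" for u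
      by (rule foldr_power_zero) (use xs z in auto)
    have 2: "foldr (\<lambda>j. partial_deriv j ^^ (\<gamma>(i := m)) j) xs u = u" for u
      by (rule foldr_power_zero) (use xs z d in auto)
    have 3: "foldr (\<lambda>j. partial_deriv j ^^ (\<gamma>(i := m)) j) ys f = foldr (\<lambda>j. partial_deriv j ^^ \<gamma> j) ys f"
      by (rule foldr_power_cong) (use d in auto)
    show ?thesis
      unfolding multi_deriv_index_order s m foldr_append foldr.simps comp_apply 1 diff_Suc_1 2 3 by simp
  qed
  then show ?thesis using that i by blast
qed

text \<open>Induction on the order, splitting off the outermost derivative. The recursion is provided for all
  \<open>\<gamma>\<close> supported in \<open>\<alpha>\<close> because the Leibniz rule below also needs it for \<open>\<alpha>\<close> lowered in another
  coordinate.\<close>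

lemma multi_index_induct [case_names zero step]:
  fixes \<alpha> :: "'n::finite \<Rightarrow> nat"
  assumes "P (\<lambda>_. 0)"
    and "\<And>\<alpha> i. 0 < \<alpha> i \<Longrightarrow> (\<And>\<gamma> f. (\<And>l. \<alpha> l = 0 \<Longrightarrow> \<gamma> l = 0) \<Longrightarrow> 0 < \<gamma> i \<Longrightarrow>
        multi_deriv \<gamma> f = partial_deriv i (multi_deriv (\<gamma>(i := \<gamma> i - 1)) f)) \<Longrightarrow>
      P (\<alpha>(i := \<alpha> i - 1)) \<Longrightarrow> P \<alpha>"
  shows "P \<alpha>"
proof (induction "\<Sum>i\<in>UNIV. \<alpha> i" arbitrary: \<alpha> rule: less_induct)
  case less
  show ?case
  proof (cases "\<alpha> = (\<lambda>_. 0)")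
    case False
    obtain i where i: "0 < \<alpha> i"
      "\<And>\<gamma> f. (\<And>l. \<alpha> l = 0 \<Longrightarrow> \<gamma> l = 0) \<Longrightarrow> 0 < \<gamma> i \<Longrightarrow> multi_deriv \<gamma> f = partial_deriv i (multi_deriv (\<gamma>(i := \<gamma> i - 1)) f)"
      using leading_index[OF False] by metis
    have "(\<Sum>l\<in>UNIV. (\<alpha>(i := \<alpha> i - 1)) l) < (\<Sum>l\<in>UNIV. \<alpha> l)"
      using i(1) by (intro sum_strict_mono_ex1) auto
    then have "P (\<alpha>(i := \<alpha> i - 1))" by (rule less)
    then show ?thesis using i by (intro assms(2)[of \<alpha> i]) blast+
  qed (use assms in simp)
qed

text \<open>The Leibniz rule for a coordinate function, all of whose second derivatives vanish.\<close>

lemma multi_deriv_coord: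
  fixes f :: "'n::finite cfun"
  assumes f: "smooth f"
  shows "multi_deriv \<alpha> (\<lambda>x. of_real (x $ j) * f x)
    = (\<lambda>x. of_real (x $ j) * multi_deriv \<alpha> f x + of_nat (\<alpha> j) * multi_deriv (\<alpha>(j := \<alpha> j - 1)) f x)"
proof (induction \<alpha> rule: multi_index_induct)
  case zero
  show ?case by (simp add: multi_deriv_zero)
next
  case (step \<alpha> i)
  note diff = smooth_differentiable[OF smooth_multi_deriv[OF f]]
  define \<alpha>' where "\<alpha>' = \<alpha>(i := \<alpha> i - 1)"
  have lead: "multi_deriv \<alpha> g = partial_deriv i (multi_deriv \<alpha>' g)" for g
    unfolding \<alpha>'_def by (rule step(2)) (use step(1) in auto)
  have IH: "multi_deriv \<alpha>' (\<lambda>x. of_real (x $ j) * f x)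
    = (\<lambda>x. of_real (x $ j) * multi_deriv \<alpha>' f x + of_nat (\<alpha>' j) * multi_deriv (\<alpha>'(j := \<alpha>' j - 1)) f x)"
    using step(3) unfolding \<alpha>'_def .
  have "multi_deriv \<alpha> (\<lambda>x. of_real (x $ j) * f x) x
      = of_real (x $ j) * multi_deriv \<alpha> f x + of_nat (\<alpha> j) * multi_deriv (\<alpha>(j := \<alpha> j - 1)) f x" for x
  proof -
    have "multi_deriv \<alpha> (\<lambda>x. of_real (x $ j) * f x) x
        = of_real (x $ j) * multi_deriv \<alpha> f x + (if i = j then multi_deriv \<alpha>' f x else 0)
          + of_nat (\<alpha>' j) * partial_deriv i (multi_deriv (\<alpha>'(j := \<alpha>' j - 1)) f) x"
      unfolding lead[of "\<lambda>x. of_real (x $ j) * f x"] IH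
        partial_deriv_add_scale[OF partial_deriv_coord(2)[OF diff] diff]
        partial_deriv_coord(1)[OF diff] lead[of f] ..
    also have "\<dots> = of_real (x $ j) * multi_deriv \<alpha> f x + of_nat (\<alpha> j) * multi_deriv (\<alpha>(j := \<alpha> j - 1)) f x"
    proof (cases "i = j")
      case True
      show ?thesis
      proof (cases "\<alpha>' j = 0")
        case True
        then show ?thesis using \<open>i = j\<close> step(1) by (simp add: \<alpha>'_def)
      next
        case False
        have "multi_deriv \<alpha>' f = partial_deriv i (multi_deriv (\<alpha>'(i := \<alpha>' i - 1)) f)"
          by (rule step(2)) (use False \<open>i = j\<close> in \<open>auto simp: \<alpha>'_def\<close>)
        then have h: "partial_deriv i (multi_deriv (\<alpha>'(j := \<alpha>' j - 1)) f) = multi_deriv \<alpha>' f"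
          using \<open>i = j\<close> by simp
        have e: "\<alpha>(j := \<alpha> j - 1) = \<alpha>'" using \<open>i = j\<close> by (simp add: \<alpha>'_def)
        have a: "\<alpha> j = Suc (\<alpha>' j)" using step(1) \<open>i = j\<close> by (simp add: \<alpha>'_def)
        show ?thesis unfolding e h unfolding a using \<open>i = j\<close> by (simp add: distrib_right)
      qed
    next
      case False
      have "\<alpha>' j = \<alpha> j" using False by (simp add: \<alpha>'_def)
      show ?thesis
      proof (cases "\<alpha> j = 0")
        case nz: False
        have "multi_deriv (\<alpha>(j := \<alpha> j - 1)) f = partial_deriv i (multi_deriv ((\<alpha>(j := \<alpha> j - 1))(i := (\<alpha>(j := \<alpha> j - 1)) i - 1)) f)"
          by (rule step(2)) (use False step(1) in auto)
        moreover have "(\<alpha>(j := \<alpha> j - 1))(i := (\<alpha>(j := \<alpha> j - 1)) i - 1) = \<alpha>'(j := \<alpha>' j - 1)"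
          using False by (auto simp: \<alpha>'_def fun_eq_iff)
        ultimately show ?thesis using False \<open>\<alpha>' j = \<alpha> j\<close> by simp
      qed (use False \<open>\<alpha>' j = \<alpha> j\<close> in simp)
    qed
    finally show ?thesis .
  qed
  then show ?case by (rule ext)
qed

lemma schwartz_smooth: "f \<in> schwartz \<Longrightarrow> smooth f"
  by (simp add: schwartz_def)

lemma schwartz_rapid: "f \<in> schwartz \<Longrightarrow> rapid (multi_deriv \<alpha> f)"
  unfolding rapid_def by (auto simp: schwartz_def intro: smooth_continuous smooth_multi_deriv)

lemma schwartzI: "smooth f \<Longrightarrow> (\<And>\<alpha>. rapid (multi_deriv \<alpha> f)) \<Longrightarrow> f \<in> schwartz"
  by (simp add: schwartz_def rapid_def)

lemma schwartz_rapid_self: "f \<in> schwartz \<Longrightarrow> rapid f"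
  using schwartz_rapid[of f "\<lambda>_. 0"] by (simp add: multi_deriv_zero)

lemma schwartz_rapid_power: "f \<in> schwartz \<Longrightarrow> rapid ((partial_deriv j ^^ k) f)"
  using schwartz_rapid[of f "\<lambda>i. if i = j then k else 0"] by (simp add: multi_deriv_single)

lemma schwartz_coord: "f \<in> schwartz \<Longrightarrow> (\<lambda>x. of_real (x $ j) * f x) \<in> schwartz"
proof (rule schwartzI)
  fix \<alpha> assume f: "f \<in> schwartz"
  show "rapid (multi_deriv \<alpha> (\<lambda>x. of_real (x $ j) * f x))"
    unfolding multi_deriv_coord[OF schwartz_smooth[OF f]]
    by (rule rapid_add[OF rapid_coord[OF schwartz_rapid[OF f]] rapid_scale[OF schwartz_rapid[OF f]]])
qed (intro smooth_coord schwartz_smooth)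

lemma schwartz_add_scale:
  fixes f g :: "'n::finite cfun"
  shows "f \<in> schwartz \<Longrightarrow> g \<in> schwartz \<Longrightarrow> (\<lambda>x. f x + c * g x) \<in> schwartz"
proof (rule schwartzI)
  fix \<alpha> :: "'n \<Rightarrow> nat" assume fg: "f \<in> schwartz" "g \<in> schwartz"
  obtain js where js: "\<forall>f. multi_deriv \<alpha> f = foldr partial_deriv js f" using multi_deriv_foldr[of \<alpha>] by blast
  have "multi_deriv \<alpha> (\<lambda>x. f x + c * g x) = (\<lambda>x. multi_deriv \<alpha> f x + c * multi_deriv \<alpha> g x)"
    using fg by (simp add: js foldr_partial_deriv_add_scale schwartz_smooth)
  then show "rapid (multi_deriv \<alpha> (\<lambda>x. f x + c * g x))" using fg by (simp add: rapid_add rapid_scale schwartz_rapid)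
qed (intro smooth_add_scale schwartz_smooth)

lemma schwartz_scale: "f \<in> schwartz \<Longrightarrow> (\<lambda>x. c * f x) \<in> schwartz"
  using schwartz_add_scale[of f f "c - 1"] by (simp add: algebra_simps)

lemma schwartz_reflect:
  fixes f :: "'n::finite cfun"
  assumes f: "f \<in> schwartz"
  shows "(\<lambda>x. f (- x)) \<in> schwartz"
proof (rule schwartzI[OF smooth_reflect[OF schwartz_smooth[OF f]]])
  fix \<alpha> :: "'n \<Rightarrow> nat"
  obtain js where js: "\<forall>f. multi_deriv \<alpha> f = foldr partial_deriv js f" using multi_deriv_foldr[of \<alpha>] by blast
  have eq: "multi_deriv \<alpha> (\<lambda>x. f (- x)) = (\<lambda>x. (-1) ^ length js * multi_deriv \<alpha> f (- x))"
    by (simp add: js foldr_partial_deriv_reflect[OF schwartz_smooth[OF f]])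
  have r: "rapid (multi_deriv \<alpha> f)" by (rule schwartz_rapid[OF f])
  have "rapid (\<lambda>x. multi_deriv \<alpha> f (- x))"
    unfolding rapid_def
  proof (intro conjI allI)
    show "continuous_on UNIV (\<lambda>x. multi_deriv \<alpha> f (- x))"
      by (rule continuous_on_compose2[OF rapid_cont[OF r]]) (auto intro: continuous_intros)
    fix \<beta>
    obtain B where B: "\<And>x. norm (of_real (monomial \<beta> x) * multi_deriv \<alpha> f x) \<le> B"
      using r unfolding rapid_def bounded_iff by (metis rangeI)
    have "norm (of_real (monomial \<beta> x) * multi_deriv \<alpha> f (- x)) \<le> B" for x
      using B[of "- x"] by (simp add: norm_mult norm_monomial_minus)
    then show "bounded (range (\<lambda>x. of_real (monomial \<beta> x) * multi_deriv \<alpha> f (- x)))" by (auto simp: bounded_iff)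
  qed
  then show "rapid (multi_deriv \<alpha> (\<lambda>x. f (- x)))" unfolding eq by (rule rapid_scale)
qed

text \<open>Repeated integration by parts; the constant is \<open>2\<pi>i\<close> to the power \<open>|\<beta>|\<close>.\<close>

lemma fourier_multi_deriv:
  fixes f :: "'n::finite cfun"
  assumes f: "f \<in> schwartz"
  shows "\<exists>c. c \<noteq> 0 \<and> (\<forall>x. fourier (multi_deriv \<beta> f) x = c * (of_real (monomial \<beta> x) * fourier f x))"
proof (induction \<beta> rule: multi_index_induct)
  case zero
  show ?case by (intro exI[of _ 1]) (simp add: multi_deriv_zero)
next
  case (step \<beta> i)
  define \<beta>' where "\<beta>' = \<beta>(i := \<beta> i - 1)"
  have lead: "multi_deriv \<beta> f = partial_deriv i (multi_deriv \<beta>' f)"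
    unfolding \<beta>'_def by (rule step(2)) (use step(1) in auto)
  obtain c where c: "c \<noteq> 0" "\<And>x. fourier (multi_deriv \<beta>' f) x = c * (of_real (monomial \<beta>' x) * fourier f x)"
    using step(3) unfolding \<beta>'_def by blast
  have "fourier (multi_deriv \<beta> f) x = (2 * of_real pi * \<i> * c) * (of_real (monomial \<beta> x) * fourier f x)" for x
  proof -
    have "fourier (multi_deriv \<beta> f) x = 2 * of_real pi * \<i> * of_real (x $ i) * fourier (multi_deriv \<beta>' f) x"
      unfolding lead
      by (intro fourier_partial_deriv schwartz_rapid[OF f] smooth_differentiable smooth_multi_deriv schwartz_smooth[OF f])
        (use schwartz_rapid[OF f, of \<beta>] lead in simp)
    also have "\<dots> = (2 * of_real pi * \<i> * c) * (of_real (monomial \<beta> x) * fourier f x)"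
      unfolding c(2) monomial_step[of \<beta> i x, OF step(1)] \<beta>'_def[symmetric] by (simp add: mult_ac)
    finally show ?thesis .
  qed
  then show ?case using c(1) by (intro exI[of _ "2 * of_real pi * \<i> * c"]) auto
qed

lemma fourier_partial_deriv_power:
  fixes f :: "'n::finite cfun"
  assumes f: "f \<in> schwartz"
  shows "fourier ((partial_deriv j ^^ k) f) x = (2 * of_real pi * \<i> * of_real (x $ j)) ^ k * fourier f x"
proof (induction k)
  case (Suc k)
  have sm: "smooth ((partial_deriv j ^^ k) f)"
    using smooth_multi_deriv[OF schwartz_smooth[OF f], of "\<lambda>i. if i = j then k else 0"] by (simp add: multi_deriv_single)
  have "fourier ((partial_deriv j ^^ Suc k) f) x = 2 * of_real pi * \<i> * of_real (x $ j) * fourier ((partial_deriv j ^^ k) f) x"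
    using fourier_partial_deriv[OF schwartz_rapid_power[OF f] smooth_differentiable[OF sm]]
      schwartz_rapid_power[OF f, where j = j and k = "Suc k"]
    by simp
  then show ?case by (simp add: Suc)
qed simp

text \<open>Derivatives of a transform are transforms of Schwartz functions, by \<open>partial_deriv_fourier\<close>. A
  monomial times the transform of a Schwartz function \<open>g\<close> is, up to a constant, the transform of a
  derivative of \<open>g\<close>, hence bounded.\<close>

lemma fourier_schwartz:
  fixes f :: "'n::finite cfun"
  assumes f: "f \<in> schwartz"
  shows "fourier f \<in> schwartz"
proof (rule schwartzI[OF smooth_fourier[OF schwartz_rapid_self[OF f]]])
  fix \<alpha> :: "'n \<Rightarrow> nat"
  have "\<exists>g\<in>schwartz. foldr partial_deriv js (fourier f) = fourier g" for js
  proof (induction js)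
    case (Cons j js)
    then obtain g where g: "g \<in> schwartz" "foldr partial_deriv js (fourier f) = fourier g" by blast
    show ?case
      using partial_deriv_fourier[OF schwartz_rapid_self[OF g(1)], of j]
      by (intro bexI[of _ "\<lambda>y. - (2 * of_real pi * \<i>) * (of_real (y $ j) * g y)"] schwartz_scale schwartz_coord g(1))
        (simp add: g(2))
  qed (use f in auto)
  moreover obtain js where "\<forall>f. multi_deriv \<alpha> f = foldr partial_deriv js f" using multi_deriv_foldr[of \<alpha>] by blast
  ultimately obtain g where g: "g \<in> schwartz" "multi_deriv \<alpha> (fourier f) = fourier g" by metis
  have "rapid (fourier g)"
    unfolding rapid_def
  proof (intro conjI allI)
    show "continuous_on UNIV (fourier g)" by (intro fourier_continuous rapid_integrable schwartz_rapid_self g)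
    fix \<beta>
    obtain c where c: "c \<noteq> 0" "\<And>x. fourier (multi_deriv \<beta> g) x = c * (of_real (monomial \<beta> x) * fourier g x)"
      using fourier_multi_deriv[OF g(1)] by blast
    have "norm (of_real (monomial \<beta> x) * fourier g x) \<le> L1_norm (multi_deriv \<beta> g) / norm c" for x
    proof -
      have "norm (c * (of_real (monomial \<beta> x) * fourier g x)) \<le> L1_norm (multi_deriv \<beta> g)"
        unfolding c(2)[symmetric] by (rule fourier_bounded)
      then show ?thesis using c(1) by (simp add: norm_mult field_simps)
    qed
    then show "bounded (range (\<lambda>x. of_real (monomial \<beta> x) * fourier g x))" by (auto simp: bounded_iff)
  qed
  then show "rapid (multi_deriv \<alpha> (fourier f))" by (simp add: g)
qed

lemma inv_fourier_schwartz: "f \<in> schwartz \<Longrightarrow> inv_fourier f \<in> schwartz"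
  using schwartz_reflect[OF fourier_schwartz] by (simp add: inv_fourier_def[abs_def])


section \<open>Fourier inversion\<close>

lemma integral_exp_half_line:
  fixes z :: complex
  assumes z: "0 < Re z"
  shows "integrable lborel (\<lambda>x::real. indicator {0<..} x *\<^sub>R exp (- (z * of_real x)))"
    and "(\<integral>x. indicator {0<..} x *\<^sub>R exp (- (z * of_real x)) \<partial>(lborel :: real measure)) = 1 / z"
proof -
  have z0: "z \<noteq> 0" using z by auto
  have n: "norm (exp (- (z * of_real x))) = exp (- (x * Re z))" for x by (simp add: norm_exp_eq_Re mult.commute)
  have "integrable lborel (\<lambda>x::real. indicator {0<..} x *\<^sub>R exp (- (x * Re z)))"
    using integrable_I0i_exp_mscale[OF z] by (simp add: set_integrable_def)
  then show int: "integrable lborel (\<lambda>x::real. indicator {0<..} x *\<^sub>R exp (- (z * of_real x)))"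
    by (rule Bochner_Integration.integrable_bound) (auto simp: n mult.commute[of _ "Re z"])
  have "(LBINT x=0..\<infinity>. exp (- (z * of_real x))) = 0 - (- 1 / z)"
  proof (rule interval_integral_FTC_integrable)
    show "((\<lambda>x. - exp (- (z * of_real x)) / z) has_vector_derivative exp (- (z * of_real x))) (at x)" for x :: real
    proof -
      have "((\<lambda>w. - exp (- (z * w)) / z) has_field_derivative exp (- (z * of_real x))) (at (of_real x))"
        using z0 by (auto intro!: derivative_eq_intros)
      then show ?thesis by (rule has_vector_derivative_real_field)
    qed
    show "isCont (\<lambda>x. exp (- (z * of_real x))) x" for x :: real by (intro continuous_intros)
    show "set_integrable lborel (einterval 0 \<infinity>) (\<lambda>x. exp (- (z * of_real x)))"
      using int by (simp add: set_integrable_def einterval_def greaterThan_def zero_ereal_def)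
    have "((\<lambda>x. - exp (- (z * of_real x)) / z) \<longlongrightarrow> - 1 / z) (at_right (0::real))"
      by (auto intro!: tendsto_eq_intros simp: z0)
    then show "(((\<lambda>x. - exp (- (z * of_real x)) / z) \<circ> real_of_ereal) \<longlongrightarrow> - 1 / z) (at_right 0)"
      unfolding zero_ereal_def ereal_tendsto_simps .
    have "((\<lambda>x. exp (- (x * Re z)) / norm z) \<longlongrightarrow> 0) at_top"
    proof -
      have "((\<lambda>x. exp (- (x * Re z))) \<longlongrightarrow> 0) at_top"
        using z by (auto intro!: exp_at_bot[THEN filterlim_compose] filterlim_tendsto_pos_mult_at_top filterlim_ident
             simp: filterlim_uminus_at_bot mult.commute[of _ "Re z"])
      from tendsto_divide[OF this tendsto_const, of "norm z"] z0 show ?thesis by simp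
    qed
    then have "((\<lambda>x. - exp (- (z * of_real x)) / z) \<longlongrightarrow> 0) at_top"
      by (rule Lim_null_comparison[rotated]) (auto simp: norm_divide n mult.commute[of _ "Re z"])
    then show "(((\<lambda>x. - exp (- (z * of_real x)) / z) \<circ> real_of_ereal) \<longlongrightarrow> 0) (at_left \<infinity>)"
      unfolding ereal_tendsto_simps .
  qed simp
  then show "(\<integral>x. indicator {0<..} x *\<^sub>R exp (- (z * of_real x)) \<partial>(lborel :: real measure)) = 1 / z"
    by (simp add: interval_lebesgue_integral_0_infty set_lebesgue_integral_def)
qed

text \<open>The Fourier integral of \<open>exp(-a|x|)\<close>: the two half lines contribute \<open>1/z\<close> and \<open>1/cnj z\<close> with
  \<open>z = a - ib\<close>.\<close>

lemma
  fixes a b :: real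
  assumes a: "0 < a"
  shows integrable_exp_abs: "integrable lborel (\<lambda>x. exp (\<i> * of_real (b * x)) * of_real (exp (- a * \<bar>x\<bar>)))"
    and integral_exp_abs:
      "(\<integral>x. exp (\<i> * of_real (b * x)) * of_real (exp (- a * \<bar>x\<bar>)) \<partial>lborel) = of_real (2 * a / (a\<^sup>2 + b\<^sup>2))"
proof -
  define h where "h z x = indicator {0<..} x *\<^sub>R exp (- (z * complex_of_real x))" for z x
  define z where "z = Complex a (- b)"
  have z: "0 < Re z" "0 < Re (cnj z)" using a by (auto simp: z_def)
  then have "z \<noteq> 0" by auto
  have hi: "integrable lborel (h z)" "integrable lborel (h (cnj z))"
    "integral\<^sup>L lborel (h z) = 1 / z" "integral\<^sup>L lborel (h (cnj z)) = 1 / cnj z"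
    unfolding h_def[abs_def] by (rule integral_exp_half_line z)+
  have ref: "integrable lborel (\<lambda>x. h (cnj z) (- x))" "(\<integral>x. h (cnj z) (- x) \<partial>lborel) = 1 / cnj z"
    using hi(2,4) lborel_integrable_real_affine[OF hi(2), of "-1" 0]
      lborel_integral_real_affine[of "-1" "h (cnj z)" 0] by simp_all
  have ae: "AE x in lborel. exp (\<i> * of_real (b * x)) * of_real (exp (- a * \<bar>x\<bar>)) = h z x + h (cnj z) (- x)"
    using AE_lborel_singleton[of "0::real"]
  proof eventually_elim
    case (elim x)
    have e: "exp (\<i> * of_real (b * x)) * of_real (exp (- a * \<bar>x\<bar>)) = exp (Complex (- a * \<bar>x\<bar>) (b * x))"
      by (simp add: exp_of_real[symmetric] mult_exp_exp complex_eq_iff Complex_eq algebra_simps)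
    show ?case
    proof (cases "0 < x")
      case True
      then have "Complex (- a * \<bar>x\<bar>) (b * x) = - (z * of_real x)" by (simp add: z_def complex_eq_iff)
      then show ?thesis unfolding e using True by (simp add: h_def)
    next
      case False
      then have "x < 0" using elim by auto
      then have "Complex (- a * \<bar>x\<bar>) (b * x) = cnj z * of_real x" by (simp add: z_def complex_eq_iff)
      then show ?thesis unfolding e using \<open>x < 0\<close> by (simp add: h_def)
    qed
  qed
  have hsum: "integrable lborel (\<lambda>x. h z x + h (cnj z) (- x))" using hi ref by simp
  have m: "(\<lambda>x. exp (\<i> * of_real (b * x)) * of_real (exp (- a * \<bar>x\<bar>))) \<in> borel_measurable lborel"
    by measurable
  have m2: "(\<lambda>x. h z x + h (cnj z) (- x)) \<in> borel_measurable lborel" using hsum by simp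
  show "integrable lborel (\<lambda>x. exp (\<i> * of_real (b * x)) * of_real (exp (- a * \<bar>x\<bar>)))"
    using integrable_cong_AE[OF m m2 ae] hsum by simp
  have "(\<integral>x. exp (\<i> * of_real (b * x)) * of_real (exp (- a * \<bar>x\<bar>)) \<partial>lborel) = 1 / z + 1 / cnj z"
    using integral_cong_AE[OF m m2 ae] hi ref by simp
  also have "\<dots> = (z + cnj z) / (z * cnj z)" using \<open>z \<noteq> 0\<close> by (simp add: field_simps)
  also have "\<dots> = of_real (2 * a / (a\<^sup>2 + b\<^sup>2))"
    by (simp add: complex_add_cnj complex_mult_cnj) (simp add: z_def)
  finally show "(\<integral>x. exp (\<i> * of_real (b * x)) * of_real (exp (- a * \<bar>x\<bar>)) \<partial>lborel) = of_real (2 * a / (a\<^sup>2 + b\<^sup>2))" .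
qed

definition exp_kernel :: "real \<Rightarrow> 'n::finite cfun" where
  "exp_kernel e x = (\<Prod>j\<in>UNIV. of_real (exp (- e * \<bar>x $ j\<bar>)))"

lemma norm_exp_kernel_le_1: "0 \<le> e \<Longrightarrow> norm (exp_kernel e x) \<le> 1"
  unfolding exp_kernel_def prod_norm[symmetric] by (intro prod_le_1) auto

lemma exp_kernel_continuous: "continuous_on S (exp_kernel e)"
  unfolding exp_kernel_def[abs_def] by (intro continuous_intros)

lemma wave_prod: "wave s x = (\<Prod>j\<in>UNIV. exp (\<i> * of_real (- 2 * pi * (s $ j) * x $ j)))"
  unfolding wave_exp inner_vec_def
  by (subst exp_sum[symmetric]) (auto simp: sum_distrib_left mult.assoc)

lemma
  fixes s :: "real^'n::finite"
  assumes e: "0 < e"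
  shows exp_kernel_integrable: "integrable lborel (exp_kernel e :: 'n cfun)"
    and fourier_exp_kernel: "fourier (exp_kernel e) s = (\<Prod>j\<in>UNIV. of_real (2 * e / (e\<^sup>2 + (2 * pi * (s $ j))\<^sup>2)))"
proof -
  let ?g = "\<lambda>s j t. exp (\<i> * of_real ((- 2 * pi * (s $ j)) * t)) * complex_of_real (exp (- e * \<bar>t\<bar>))"
  have gi: "integrable lborel (?g s j)" for s :: "real^'n" and j by (rule integrable_exp_abs[OF e])
  have eq: "wave s x * exp_kernel e x = (\<Prod>j\<in>UNIV. ?g s j (x $ j))" for s x :: "real^'n"
    unfolding exp_kernel_def wave_prod prod.distrib[symmetric] ..
  have "exp_kernel e = (\<lambda>x::real^'n. \<Prod>j\<in>UNIV. ?g 0 j (x $ j))"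
    using eq[of 0] by (simp add: fun_eq_iff)
  then show "integrable lborel (exp_kernel e :: 'n cfun)"
    using integrable_prod_coordinates[OF gi[of 0]] by simp
  have "fourier (exp_kernel e) s = (\<Prod>j\<in>UNIV. integral\<^sup>L lborel (?g s j))"
    unfolding fourier_wave eq by (rule integral_prod_coordinates[OF gi])
  also have "\<dots> = (\<Prod>j\<in>UNIV. of_real (2 * e / (e\<^sup>2 + (2 * pi * (s $ j))\<^sup>2)))"
    unfolding integral_exp_abs[OF e] by simp
  finally show "fourier (exp_kernel e) s = (\<Prod>j\<in>UNIV. of_real (2 * e / (e\<^sup>2 + (2 * pi * (s $ j))\<^sup>2)))" .
qed

text \<open>The transform of the kernel is a product of Poisson kernels. In the scaled variable
  \<open>u = 2\<pi>s/e\<close> it is a multiple of the weight, whatever \<open>e\<close>.\<close>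

lemma fourier_exp_kernel_weight:
  fixes u :: "real^'n::finite"
  assumes e: "0 < e"
  shows "fourier (exp_kernel e) ((e / (2 * pi)) *\<^sub>R u) = of_real ((2 / e) ^ CARD('n) * weight u)"
proof -
  have "2 * e / (e\<^sup>2 + (2 * pi * (((e / (2 * pi)) *\<^sub>R u) $ j))\<^sup>2) = (2 / e) * inverse (1 + (u $ j)\<^sup>2)" for j
  proof -
    have "e\<^sup>2 + (2 * pi * (((e / (2 * pi)) *\<^sub>R u) $ j))\<^sup>2 = e\<^sup>2 * (1 + (u $ j)\<^sup>2)"
      by (simp add: power_mult_distrib ring_distribs)
    moreover have "2 * e / (e\<^sup>2 * q) = (2 / e) * inverse q" for q
      using e by (cases "q = 0") (simp_all add: field_simps power2_eq_square)
    ultimately show ?thesis by simp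
  qed
  then have "(\<Prod>j\<in>UNIV. 2 * e / (e\<^sup>2 + (2 * pi * (((e / (2 * pi)) *\<^sub>R u) $ j))\<^sup>2)) = (2 / e) ^ CARD('n) * weight u"
    unfolding weight_def by (simp only: prod.distrib) simp
  then show ?thesis unfolding fourier_exp_kernel[OF e] of_real_prod[symmetric] by simp
qed

text \<open>The kernel makes the double integral over the definition of \<open>inv_fourier f\<close> absolutely convergent.
  Fubini turns it into a convolution of \<open>f\<close> with the transform of the kernel, and rescaling the
  variable turns that transform into the weight.\<close>

lemma fourier_inversion_regularised:
  fixes f :: "'n::finite cfun"
  assumes f: "integrable lborel f" and e: "0 < e"
  shows "(\<integral>x. wave y x * inv_fourier f x * exp_kernel e x \<partial>lborel)
    = of_real (1 / pi ^ CARD('n)) * (\<integral>u. f (y - (e / (2 * pi)) *\<^sub>R u) * of_real (weight u) \<partial>lborel)"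
proof -
  have [measurable]: "f \<in> borel_measurable borel" using f by simp
  have [measurable]: "(exp_kernel e :: 'n cfun) \<in> borel_measurable borel"
    by (intro borel_measurable_continuous_onI exp_kernel_continuous)
  define H where "H x t = wave (y - t) x * f t * exp_kernel e x" for x t
  have Hm: "case_prod H \<in> borel_measurable (lborel \<Otimes>\<^sub>M lborel)"
    unfolding H_def case_prod_beta by measurable
  have Hn: "norm (H x t) = norm (f t) * norm (exp_kernel e x)" for x t by (simp add: H_def norm_mult)
  have HI: "integrable (lborel \<Otimes>\<^sub>M lborel) (case_prod H)"
  proof (rule lborel_pair.Fubini_integrable[OF Hm])
    show "integrable lborel (\<lambda>x. \<integral>t. norm (case_prod H (x, t)) \<partial>lborel)"
      unfolding prod.case Hn by (simp only: integral_mult_left_zero)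
        (rule integrable_mult_right[OF integrable_norm[OF exp_kernel_integrable[OF e]]])
    show "AE x in lborel. integrable lborel (\<lambda>t. case_prod H (x, t))"
    proof (intro always_eventually allI)
      fix x
      show "integrable lborel (\<lambda>t. case_prod H (x, t))"
      proof (rule Bochner_Integration.integrable_bound)
        show "integrable lborel (\<lambda>t. norm (f t) * norm (exp_kernel e x))"
          by (intro integrable_mult_left integrable_norm f)
        show "(\<lambda>t. case_prod H (x, t)) \<in> borel_measurable lborel" by (simp add: H_def)
      qed (simp add: Hn)
    qed
  qed
  have "(\<integral>x. wave y x * inv_fourier f x * exp_kernel e x \<partial>lborel) = (\<integral>x. (\<integral>t. H x t \<partial>lborel) \<partial>lborel)"
  proof (rule Bochner_Integration.integral_cong[OF refl])
    fix x
    have "H x t = (wave y x * exp_kernel e x) * (wave (- x) t * f t)" for t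
    proof -
      have "wave (y - t) x = wave y x * wave (- x) t"
        using wave_add[of y "- t" x] wave_commute[of "- t" x] wave_minus_left[of x t] by simp
      then show ?thesis by (simp add: H_def)
    qed
    then show "wave y x * inv_fourier f x * exp_kernel e x = (\<integral>t. H x t \<partial>lborel)"
      by (simp add: inv_fourier_wave)
  qed
  also have "\<dots> = (\<integral>t. (\<integral>x. H x t \<partial>lborel) \<partial>lborel)"
    by (rule lborel_pair.Fubini_integral[OF HI, symmetric])
  also have "\<dots> = (\<integral>t. f t * fourier (exp_kernel e) (y - t) \<partial>lborel)"
    by (rule Bochner_Integration.integral_cong[OF refl]) (simp add: H_def fourier_wave mult.left_commute mult.assoc)
  also have "\<dots> = \<bar>- (e / (2 * pi))\<bar> ^ CARD('n) *\<^sub>R (\<integral>u. f (y + (- (e / (2 * pi))) *\<^sub>R u)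
      * fourier (exp_kernel e) (y - (y + (- (e / (2 * pi))) *\<^sub>R u)) \<partial>lborel)"
  proof (rule integral_affine)
    have ec: "continuous_on UNIV (fourier (exp_kernel e :: 'n cfun))"
      by (rule fourier_continuous[OF exp_kernel_integrable[OF e]])
    show "integrable lborel (\<lambda>t. f t * fourier (exp_kernel e) (y - t))"
      by (rule integrable_mult_bounded(1)[OF f _ fourier_bounded])
        (auto intro!: continuous_on_compose2[OF ec] continuous_intros)
  qed (use e in simp)
  also have "\<dots> = (e / (2 * pi)) ^ CARD('n) *\<^sub>R (\<integral>u. of_real ((2 / e) ^ CARD('n)) * (f (y - (e / (2 * pi)) *\<^sub>R u) * of_real (weight u)) \<partial>lborel)"
  proof -
    have "y - (y + (- (e / (2 * pi))) *\<^sub>R u) = (e / (2 * pi)) *\<^sub>R u" for u by simp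
    then have "f (y + (- (e / (2 * pi))) *\<^sub>R u) * fourier (exp_kernel e) (y - (y + (- (e / (2 * pi))) *\<^sub>R u))
        = of_real ((2 / e) ^ CARD('n)) * (f (y - (e / (2 * pi)) *\<^sub>R u) * of_real (weight u))" for u
      by (simp only: fourier_exp_kernel_weight[OF e] of_real_mult) simp
    moreover have "\<bar>- (e / (2 * pi))\<bar> = e / (2 * pi)" using e by simp
    ultimately show ?thesis by (simp only:)
  qed
  also have "\<dots> = of_real ((e / (2 * pi)) ^ CARD('n) * (2 / e) ^ CARD('n)) * (\<integral>u. f (y - (e / (2 * pi)) *\<^sub>R u) * of_real (weight u) \<partial>lborel)"
    by (simp add: scaleR_conv_of_real)
  also have "(e / (2 * pi)) ^ CARD('n) * (2 / e) ^ CARD('n) = 1 / pi ^ CARD('n)"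
    using e by (simp add: power_mult_distrib[symmetric] power_one_over)
  finally show ?thesis .
qed

text \<open>Let the parameter of the kernel tend to \<open>0\<close> in \<open>fourier_inversion_regularised\<close>: on the left the
  kernel tends to \<open>1\<close>, on the right the integrand tends to \<open>f y\<close> times the weight, whose integral is
  \<open>\<pi>\<^sup>d\<close>.\<close>

theorem fourier_inversion:
  fixes f :: "'n::finite cfun"
  assumes f: "continuous_on UNIV f" "integrable lborel f" and bd: "\<And>x. norm (f x) \<le> B"
    and fi: "integrable lborel (inv_fourier f)"
  shows "fourier (inv_fourier f) y = f y"
proof -
  define e where "e n = 1 / real (Suc n)" for n
  have e: "0 < e n" for n by (simp add: e_def)
  have elim: "e \<longlonglongrightarrow> 0" unfolding e_def using LIMSEQ_inverse_real_of_nat by (simp add: inverse_eq_divide)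
  have [measurable]: "f \<in> borel_measurable borel" using f by simp
  have [measurable]: "inv_fourier f \<in> borel_measurable borel" using fi by simp
  have [measurable]: "(exp_kernel e :: 'n cfun) \<in> borel_measurable borel" for e
    by (intro borel_measurable_continuous_onI exp_kernel_continuous)
  have [measurable]: "(weight :: real^'n \<Rightarrow> real) \<in> borel_measurable borel"
    by (intro borel_measurable_continuous_onI weight_continuous)
  have B: "0 \<le> B" using bd norm_ge_zero order_trans by blast
  have lim1: "(\<lambda>n. \<integral>x. wave y x * inv_fourier f x * exp_kernel (e n) x \<partial>lborel) \<longlonglongrightarrow> (\<integral>x. wave y x * inv_fourier f x \<partial>lborel)"
  proof (rule integral_dominated_convergence[where w = "\<lambda>x. norm (inv_fourier f x)"])
    have "(\<lambda>n. exp_kernel (e n) x) \<longlonglongrightarrow> (\<Prod>j\<in>UNIV. of_real (exp (- 0 * \<bar>x $ j\<bar>)))" for x :: "real^'n"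
      unfolding exp_kernel_def by (intro tendsto_intros elim)
    then have "(\<lambda>n. wave y x * inv_fourier f x * exp_kernel (e n) x) \<longlonglongrightarrow> wave y x * inv_fourier f x" for x
      using tendsto_mult[OF tendsto_const, of "\<lambda>n. exp_kernel (e n) x" 1 sequentially "wave y x * inv_fourier f x"] by simp
    then show "AE x in lborel. (\<lambda>n. wave y x * inv_fourier f x * exp_kernel (e n) x) \<longlonglongrightarrow> wave y x * inv_fourier f x" by simp
    show "AE x in lborel. norm (wave y x * inv_fourier f x * exp_kernel (e n) x) \<le> norm (inv_fourier f x)" for n
    proof (intro always_eventually allI)
      fix x
      have "norm (inv_fourier f x) * norm (exp_kernel (e n) x) \<le> norm (inv_fourier f x) * 1"
        using e[of n] by (intro mult_left_mono norm_exp_kernel_le_1) auto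
      then show "norm (wave y x * inv_fourier f x * exp_kernel (e n) x) \<le> norm (inv_fourier f x)"
        by (simp add: norm_mult)
    qed
  qed (use fi in auto)
  have lim2: "(\<lambda>n. \<integral>u. f (y - (e n / (2 * pi)) *\<^sub>R u) * of_real (weight u) \<partial>lborel) \<longlonglongrightarrow> (\<integral>u. f y * of_real (weight u) \<partial>(lborel :: (real^'n) measure))"
  proof (rule integral_dominated_convergence[where w = "\<lambda>u::real^'n. B * weight u"])
    have "(\<lambda>n. f (y - (e n / (2 * pi)) *\<^sub>R u)) \<longlonglongrightarrow> f y" for u
    proof -
      have "(\<lambda>n. y - (e n / (2 * pi)) *\<^sub>R u) \<longlonglongrightarrow> y - (0 / (2 * pi)) *\<^sub>R u" by (intro tendsto_intros elim) simp
      then have "(\<lambda>n. y - (e n / (2 * pi)) *\<^sub>R u) \<longlonglongrightarrow> y" by simp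
      moreover have "isCont f y" using f(1) by (simp add: continuous_on_eq_continuous_at)
      ultimately show ?thesis using isCont_tendsto_compose by blast
    qed
    then show "AE u in lborel. (\<lambda>n. f (y - (e n / (2 * pi)) *\<^sub>R u) * of_real (weight u)) \<longlonglongrightarrow> f y * of_real (weight u)"
      by (intro always_eventually allI tendsto_intros)
    show "AE u in lborel. norm (f (y - (e n / (2 * pi)) *\<^sub>R u) * of_real (weight u)) \<le> B * weight u" for n
      using bd by (intro always_eventually)
        (simp add: norm_mult abs_of_nonneg weight_nonneg mult_right_mono)
    show "integrable lborel (\<lambda>u::real^'n. B * weight u)" by (intro integrable_mult_right weight_integrable)
  qed measurable
  have "(\<integral>u. f y * of_real (weight u) \<partial>(lborel :: (real^'n) measure)) = f y * of_real (pi ^ CARD('n))"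
    by (simp add: weight_integral)
  with tendsto_mult[OF tendsto_const lim2, of "of_real (1 / pi ^ CARD('n))"]
  have "(\<lambda>n. \<integral>x. wave y x * inv_fourier f x * exp_kernel (e n) x \<partial>lborel) \<longlonglongrightarrow> f y"
    unfolding fourier_inversion_regularised[OF f(2) e] by (simp add: weight_integral)
  from LIMSEQ_unique[OF lim1 this] show ?thesis by (simp add: fourier_wave)
qed

lemma fourier_inversion_schwartz:
  fixes f :: "'n::finite cfun"
  assumes f: "f \<in> schwartz"
  shows "fourier (inv_fourier f) = f"
proof
  fix y
  have r: "rapid f" by (rule schwartz_rapid_self[OF f])
  obtain B where "\<And>x. norm (f x) \<le> B"
    using r[unfolded rapid_def, THEN conjunct2, rule_format, of "\<lambda>_. 0"] by (auto simp: bounded_iff)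
  then show "fourier (inv_fourier f) y = f y"
    by (rule fourier_inversion[OF rapid_cont[OF r] rapid_integrable[OF r] _
        rapid_integrable[OF schwartz_rapid_self[OF inv_fourier_schwartz[OF f]]]])
qed


section \<open>The symbol of the differential operator\<close>

definition Psi_symbol :: "'n::finite cfun" where
  "Psi_symbol x = (\<Sum>j\<in>UNIV. (2 * of_real pi * \<i> * of_real (x $ j)) ^ (2 * CARD('n))) + (- 1) ^ CARD('n)"

lemma Psi_symbol_eq:
  "Psi_symbol (x :: real^'n::finite) = (- 1) ^ CARD('n) * of_real (1 + (\<Sum>j\<in>UNIV. (2 * pi * x $ j) ^ (2 * CARD('n))))"
proof -
  have "(2 * of_real pi * \<i> * of_real (x $ j)) ^ (2 * CARD('n))
      = (- 1) ^ CARD('n) * complex_of_real ((2 * pi * x $ j) ^ (2 * CARD('n)))" for j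
  proof -
    have "2 * of_real pi * \<i> * of_real (x $ j) = \<i> * complex_of_real (2 * pi * x $ j)" by simp
    then have "(2 * of_real pi * \<i> * of_real (x $ j)) ^ (2 * CARD('n))
        = \<i> ^ (2 * CARD('n)) * complex_of_real (2 * pi * x $ j) ^ (2 * CARD('n))"
      by (simp only: power_mult_distrib)
    then show ?thesis by (simp only: power_mult[of \<i>] power2_i of_real_power)
  qed
  then show ?thesis by (simp add: Psi_symbol_def sum_distrib_left ring_distribs)
qed

lemma Psi_symbol_summand_nonneg: "0 \<le> (2 * pi * t) ^ (2 * m)"
  by (simp add: power_mult)

lemma norm_Psi_symbol:
  "norm (Psi_symbol (x :: real^'n::finite)) = 1 + (\<Sum>j\<in>UNIV. (2 * pi * x $ j) ^ (2 * CARD('n)))"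
proof -
  have "0 \<le> (\<Sum>j\<in>UNIV. (2 * pi * x $ j) ^ (2 * CARD('n)))" by (intro sum_nonneg Psi_symbol_summand_nonneg)
  then show ?thesis unfolding Psi_symbol_eq norm_mult norm_of_real by (simp add: norm_power)
qed

lemma Psi_symbol_ge_1: "1 \<le> norm (Psi_symbol (x :: real^'n::finite))"
  unfolding norm_Psi_symbol using sum_nonneg[of UNIV "\<lambda>j. (2 * pi * x $ j) ^ (2 * CARD('n))"] Psi_symbol_summand_nonneg
  by simp

lemma Psi_symbol_nonzero: "Psi_symbol x \<noteq> 0"
  using Psi_symbol_ge_1[of x] by auto

lemma Psi_symbol_continuous: "continuous_on S Psi_symbol"
  unfolding Psi_symbol_def[abs_def] by (intro continuous_intros)

text \<open>If \<open>m\<close> is the largest of \<open>1\<close> and all \<open>x\<^sub>j\<^sup>2\<close>, then \<open>\<Prod>\<^sub>j (1 + x\<^sub>j\<^sup>2) \<le> (2m)\<^sup>d\<close>, and \<open>m\<^sup>d\<close> is either \<open>1\<close>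
  or one of the \<open>x\<^sub>j\<^sup>2\<^sup>d\<close>. So the order \<open>2d\<close> is the degree of a product of
  \<open>d\<close> quadratic factors.\<close>

lemma inverse_Psi_symbol_le_weight:
  fixes x :: "real^'n::finite"
  shows "norm (inverse (Psi_symbol x)) \<le> 2 ^ CARD('n) * weight x"
proof -
  let ?d = "CARD('n)"
  define M where "M = insert 1 (range (\<lambda>j. (x $ j)\<^sup>2))"
  have M: "finite M" "M \<noteq> {}" by (auto simp: M_def)
  define m where "m = Max M"
  have m: "m \<in> M" "1 \<le> m" "\<And>j. (x $ j)\<^sup>2 \<le> m"
    unfolding m_def by (rule Max_in[OF M], (rule Max_ge[OF M(1)], simp add: M_def)+)
  have "inverse (weight x) = (\<Prod>j\<in>UNIV. 1 + (x $ j)\<^sup>2)" by (simp add: weight_def prod_inversef[symmetric] comp_def)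
  also have "\<dots> \<le> (\<Prod>j\<in>(UNIV :: 'n set). 2 * m)"
  proof (rule prod_mono, intro conjI)
    fix j
    show "0 \<le> 1 + (x $ j)\<^sup>2" by (simp add: add_nonneg_nonneg)
    show "1 + (x $ j)\<^sup>2 \<le> 2 * m" using m(2) m(3)[of j] by linarith
  qed
  also have "\<dots> = 2 ^ ?d * m ^ ?d" by (simp add: power_mult_distrib)
  also have "m ^ ?d \<le> norm (Psi_symbol x)"
  proof (cases "m = 1")
    case True
    then show ?thesis using Psi_symbol_ge_1[of x] by simp
  next
    case False
    then obtain j where j: "m = (x $ j)\<^sup>2" using m(1) by (auto simp: M_def)
    have "m ^ ?d = 1 * (x $ j) ^ (2 * ?d)" by (simp add: j power_mult)
    also have "\<dots> \<le> (2 * pi) ^ (2 * ?d) * (x $ j) ^ (2 * ?d)"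
      using pi_ge_two by (intro mult_right_mono one_le_power) (auto simp: power_mult)
    also have "\<dots> = (2 * pi * x $ j) ^ (2 * ?d)" by (simp add: power_mult_distrib)
    also have "\<dots> \<le> (\<Sum>j\<in>UNIV. (2 * pi * x $ j) ^ (2 * ?d))"
      by (rule member_le_sum) (auto simp: Psi_symbol_summand_nonneg)
    finally show ?thesis by (simp add: norm_Psi_symbol)
  qed
  finally have "inverse (weight x) \<le> 2 ^ ?d * norm (Psi_symbol x)" by simp
  then have "1 / norm (Psi_symbol x) \<le> 2 ^ ?d * weight x"
    using weight_pos[of x] Psi_symbol_nonzero[of x] by (simp add: field_simps)
  then show ?thesis by (simp add: norm_inverse inverse_eq_divide norm_divide)
qed


section \<open>The operator on distributions\<close>

lemma dist_partial_deriv_power: "(dist_partial_deriv j ^^ k) T f = (- 1) ^ k * T ((partial_deriv j ^^ k) f)"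
proof (induction k arbitrary: f)
  case (Suc k)
  have "(dist_partial_deriv j ^^ Suc k) T f = - ((dist_partial_deriv j ^^ k) T (partial_deriv j f))"
    by (simp add: dist_partial_deriv_def)
  then show ?case by (simp add: Suc funpow_swap1)
qed simp

lemma Psi_apply:
  "Psi T f = (\<Sum>j\<in>UNIV. T ((partial_deriv j ^^ (2 * CARD('n))) f)) + (- 1) ^ CARD('n) * T f"
  for f :: "'n::finite cfun"
  by (simp add: Psi_def dist_partial_deriv_power)

text \<open>The operator \<open>\<Psi>\<^sub>d\<close> on functions. It is its own transpose since all derivatives have even order.\<close>

definition Psi_fun :: "'n::finite cfun \<Rightarrow> 'n cfun" where
  "Psi_fun f x = (\<Sum>j\<in>UNIV. (partial_deriv j ^^ (2 * CARD('n))) f x) + (- 1) ^ CARD('n) * f x"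

lemma
  fixes f :: "'n::finite cfun"
  assumes f: "f \<in> schwartz"
  shows Psi_fun_continuous: "continuous_on UNIV (Psi_fun f)"
    and Psi_fun_integrable: "integrable lborel (Psi_fun f)"
    and fourier_Psi_fun: "fourier (Psi_fun f) x = Psi_symbol x * fourier f x"
    and L1_norm_Psi_fun: "L1_norm (Psi_fun f) \<le> L1_norm f + (\<Sum>j\<in>UNIV. L1_norm ((partial_deriv j ^^ (2 * CARD('n))) f))"
proof -
  let ?D = "\<lambda>j. (partial_deriv j ^^ (2 * CARD('n))) f"
  have r: "rapid f" "\<And>j. rapid (?D j)" by (rule schwartz_rapid_self[OF f], rule schwartz_rapid_power[OF f])
  have i: "integrable lborel f" "\<And>j. integrable lborel (?D j)" by (intro rapid_integrable r)+
  show "continuous_on UNIV (Psi_fun f)"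
    unfolding Psi_fun_def[abs_def] by (intro continuous_intros rapid_cont r)
  show pi: "integrable lborel (Psi_fun f)"
    unfolding Psi_fun_def[abs_def] using i by simp
  have "fourier (Psi_fun f) x = (\<Sum>j\<in>UNIV. fourier (?D j) x) + (- 1) ^ CARD('n) * fourier f x"
    unfolding fourier_wave Psi_fun_def using i
    by (simp add: ring_distribs sum_distrib_left wave_integrable mult.left_commute[of _ "(-1) ^ CARD('n)"])
  then show "fourier (Psi_fun f) x = Psi_symbol x * fourier f x"
    by (simp add: fourier_partial_deriv_power[OF f] Psi_symbol_def ring_distribs sum_distrib_right)
  have "L1_norm (Psi_fun f) \<le> (\<integral>x. norm (f x) + (\<Sum>j\<in>UNIV. norm (?D j x)) \<partial>lborel)"
    unfolding L1_norm_def
  proof (rule integral_mono)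
    show "integrable lborel (\<lambda>x. norm (Psi_fun f x))" using pi by simp
    show "integrable lborel (\<lambda>x. norm (f x) + (\<Sum>j\<in>UNIV. norm (?D j x)))" using i by simp
    fix x
    have "norm (Psi_fun f x) \<le> norm (\<Sum>j\<in>UNIV. ?D j x) + norm ((- 1) ^ CARD('n) * f x)"
      unfolding Psi_fun_def by (rule norm_triangle_ineq)
    also have "\<dots> \<le> (\<Sum>j\<in>UNIV. norm (?D j x)) + norm (f x)"
      by (intro add_mono norm_sum) (simp add: norm_mult norm_power)
    finally show "norm (Psi_fun f x) \<le> norm (f x) + (\<Sum>j\<in>UNIV. norm (?D j x))" by simp
  qed
  also have "\<dots> = L1_norm f + (\<Sum>j\<in>UNIV. L1_norm (?D j))" using i by (simp add: L1_norm_def)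
  finally show "L1_norm (Psi_fun f) \<le> L1_norm f + (\<Sum>j\<in>UNIV. L1_norm (?D j))" .
qed


section \<open>Temperedness and order\<close>

lemma finite_multi_indices: "finite (multi_indices m :: ('n::finite \<Rightarrow> nat) set)"
proof (rule finite_subset)
  show "multi_indices m \<subseteq> PiE (UNIV :: 'n set) (\<lambda>_. {..m})"
  proof
    fix \<alpha> :: "'n \<Rightarrow> nat" assume "\<alpha> \<in> multi_indices m"
    then have "\<alpha> j \<le> m" for j
      using member_le_sum[of j UNIV \<alpha>] by (simp add: multi_indices_def)
    then show "\<alpha> \<in> PiE UNIV (\<lambda>_. {..m})" by auto
  qed
  show "finite (PiE (UNIV :: 'n set) (\<lambda>_. {..m}))" by (intro finite_PiE) auto
qed

lemma schwartz_bounded: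
  "f \<in> schwartz \<Longrightarrow> bounded (range (\<lambda>x. of_real (monomial \<beta> x) * multi_deriv \<alpha> f x))"
  by (simp add: schwartz_def)

text \<open>The seminorms \<open>sup |x\<^sup>\<beta> f(x)|\<close> with all \<open>\<beta>\<^sub>j \<in> {0, 2}\<close> add up to a bound for \<open>|f| / weight\<close>; these
  \<open>\<beta>\<close> have order at most \<open>2d\<close>, and \<open>\<pi>\<^sup>d\<close> is the integral of the weight.\<close>

lemma schwartz_L1_norm_le:
  fixes f :: "'n::finite cfun"
  assumes f: "f \<in> schwartz"
  shows "L1_norm f \<le> pi ^ CARD('n) * (\<Sum>\<alpha>\<in>multi_indices (2 * CARD('n)). \<Sum>\<beta>\<in>multi_indices (2 * CARD('n)).
               sup_norm (\<lambda>x. of_real (monomial \<beta> x) * multi_deriv \<alpha> f x))"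
proof -
  let ?N = "2 * CARD('n)"
  let ?p = "\<lambda>\<alpha> \<beta>. sup_norm (\<lambda>x. of_real (monomial \<beta> x) * multi_deriv \<alpha> f x)"
  define C where "C = (\<Sum>\<beta>\<in>corner_indices. sup_norm (\<lambda>x. of_real (monomial \<beta> x) * f x))"
  have p0: "0 \<le> ?p \<alpha> \<beta>" for \<alpha> \<beta> by (rule sup_norm_nonneg[OF schwartz_bounded[OF f]])
  have sub: "(corner_indices :: ('n \<Rightarrow> nat) set) \<subseteq> multi_indices ?N"
  proof
    fix \<beta> :: "'n \<Rightarrow> nat" assume "\<beta> \<in> corner_indices"
    then have "\<beta> j \<in> {0, 2}" for j unfolding corner_indices_def by (rule PiE_mem) simp
    then have "\<beta> j \<le> 2" for j by (metis insertE le_refl singletonD zero_le)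
    then have "(\<Sum>j\<in>UNIV. \<beta> j) \<le> (\<Sum>j\<in>(UNIV :: 'n set). 2)" by (intro sum_mono)
    then show "\<beta> \<in> multi_indices ?N" by (simp add: multi_indices_def mult.commute)
  qed
  have "L1_norm f \<le> (\<integral>x. C * weight x \<partial>(lborel :: (real^'n) measure))"
    unfolding L1_norm_def
  proof (rule integral_mono)
    show "integrable lborel (\<lambda>x. norm (f x))"
      by (intro integrable_norm rapid_integrable schwartz_rapid_self f)
    show "integrable lborel (\<lambda>x::real^'n. C * weight x)" by (intro integrable_mult_right weight_integrable)
    show "norm (f x) \<le> C * weight x" for x
      unfolding C_def using schwartz_rapid_self[OF f] by (intro norm_le_weight) (simp add: rapid_def)
  qed
  also have "\<dots> = pi ^ CARD('n) * C" by (simp add: weight_integral)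
  also have "C \<le> (\<Sum>\<beta>\<in>multi_indices ?N. ?p (\<lambda>_. 0) \<beta>)"
  proof -
    have "sup_norm (\<lambda>x. of_real (monomial \<beta> x) * f x) = ?p (\<lambda>_. 0) \<beta>" for \<beta>
      by (simp add: multi_deriv_zero)
    then show ?thesis unfolding C_def by (simp only:) (intro sum_mono2 finite_multi_indices sub p0)
  qed
  also have "\<dots> \<le> (\<Sum>\<alpha>\<in>multi_indices ?N. \<Sum>\<beta>\<in>multi_indices ?N. ?p \<alpha> \<beta>)"
  proof (rule member_le_sum[of "\<lambda>_. 0"])
    show "(\<lambda>_. 0) \<in> multi_indices ?N" by (simp add: multi_indices_def)
  qed (auto intro!: sum_nonneg p0 finite_multi_indices)
  finally show ?thesis by simp
qed

lemma supp_partial_deriv: "supp (partial_deriv j f) \<subseteq> supp f" for f :: "'n::finite cfun"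
proof -
  have "partial_deriv j f x = 0" if "x \<notin> supp f" for x
  proof -
    have "open (- supp f)" unfolding supp_def by (simp add: open_Compl)
    moreover have "((\<lambda>_. 0) has_derivative (\<lambda>_. 0)) (at x)" by (rule has_derivative_const)
    ultimately have "(f has_derivative (\<lambda>_. 0)) (at x)"
      using that by (rule_tac has_derivative_transform_within_open[of "\<lambda>_. 0" _ x UNIV "- supp f"]) (auto simp: supp_zero)
    then show ?thesis by (rule partial_deriv_eq)
  qed
  then have "{x. partial_deriv j f x \<noteq> 0} \<subseteq> supp f" by auto
  then show ?thesis unfolding supp_def by (rule closure_minimal) simp
qed

lemma supp_multi_deriv: "supp (multi_deriv \<alpha> f) \<subseteq> supp f" for f :: "'n::finite cfun"
proof -
  have "supp (foldr partial_deriv js f) \<subseteq> supp f" for js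
    by (induction js) (use supp_partial_deriv in \<open>force+\<close>)
  then show ?thesis using multi_deriv_foldr[of \<alpha>] by metis
qed

lemma test_function_multi_deriv:
  fixes \<phi> :: "'n::finite cfun"
  assumes "\<phi> \<in> test_functions"
  shows "multi_deriv \<alpha> \<phi> \<in> C_c"
proof -
  have "compact (supp (multi_deriv \<alpha> \<phi>))"
    using assms supp_multi_deriv[of \<alpha> \<phi>] unfolding test_functions_def
    by (simp add: supp_def compact_eq_bounded_closed) (meson bounded_subset)
  then show ?thesis
    using assms by (simp add: C_c_def test_functions_def smooth_continuous smooth_multi_deriv)
qed

lemma test_functions_schwartz: "test_functions \<subseteq> schwartz"
proof
  fix \<phi> :: "'n::finite cfun" assume \<phi>: "\<phi> \<in> test_functions"
  then show "\<phi> \<in> schwartz"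
    unfolding schwartz_def
    by (auto simp: test_functions_def
        intro!: C_c_bounded[OF C_c_mult[OF test_function_multi_deriv[OF \<phi>]]] continuous_intros)
qed

text \<open>On a fixed compact set \<open>K\<close> the \<open>L\<^sup>1\<close> norm is at most \<open>\<lambda>(K)\<close> times the supremum norm, and differentiation does
  not enlarge supports.\<close>

lemma has_order_at_mostI:
  fixes T :: "'n::finite functional"
  assumes "0 \<le> H" and T: "\<And>f. f \<in> schwartz \<Longrightarrow>
    norm (T f) \<le> H * (L1_norm f + (\<Sum>j\<in>UNIV. L1_norm ((partial_deriv j ^^ m) f)))"
  shows "has_order_at_most m T"
  unfolding has_order_at_most_def
proof (intro allI impI)
  fix K :: "(real^'n) set" assume K: "compact K"
  define V where "V = measure lborel K"
  have V: "0 \<le> V" by (simp add: V_def)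
  have "norm (T \<phi>) \<le> (H * (V * (1 + CARD('n)))) * (\<Sum>\<alpha>\<in>multi_indices m. sup_norm (multi_deriv \<alpha> \<phi>))"
    if \<phi>: "\<phi> \<in> test_functions" "supp \<phi> \<subseteq> K" for \<phi>
  proof -
    define s where "s = (\<Sum>\<alpha>\<in>multi_indices m. sup_norm (multi_deriv \<alpha> \<phi>))"
    have L1: "L1_norm (multi_deriv \<alpha> \<phi>) \<le> V * s" if "\<alpha> \<in> multi_indices m" for \<alpha>
    proof -
      have "L1_norm (multi_deriv \<alpha> \<phi>) \<le> V * sup_norm (multi_deriv \<alpha> \<phi>)"
        unfolding V_def using supp_multi_deriv[of \<alpha> \<phi>] \<phi>(2)
        by (intro L1_norm_le_supp test_function_multi_deriv \<phi> K) auto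
      also have "\<dots> \<le> V * s"
        unfolding s_def using that
        by (intro mult_left_mono[OF member_le_sum V] finite_multi_indices sup_norm_nonneg
            C_c_bounded[OF test_function_multi_deriv[OF \<phi>(1)]])
      finally show ?thesis .
    qed
    have "L1_norm \<phi> \<le> V * s" using L1[of "\<lambda>_. 0"] by (simp add: multi_deriv_zero multi_indices_def)
    moreover have "L1_norm ((partial_deriv j ^^ m) \<phi>) \<le> V * s" for j
      using L1[of "\<lambda>i. if i = j then m else 0"] by (simp add: multi_deriv_single multi_indices_def)
    then have "(\<Sum>j\<in>UNIV. L1_norm ((partial_deriv j ^^ m) \<phi>)) \<le> (\<Sum>j\<in>(UNIV :: 'n set). V * s)" by (intro sum_mono)
    ultimately have "L1_norm \<phi> + (\<Sum>j\<in>UNIV. L1_norm ((partial_deriv j ^^ m) \<phi>)) \<le> V * (1 + CARD('n)) * s"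
      by (simp add: algebra_simps)
    then have "H * (L1_norm \<phi> + (\<Sum>j\<in>UNIV. L1_norm ((partial_deriv j ^^ m) \<phi>))) \<le> H * (V * (1 + CARD('n)) * s)"
      by (rule mult_left_mono) fact
    moreover have "\<phi> \<in> schwartz" using \<phi>(1) test_functions_schwartz by blast
    ultimately show ?thesis using T[of \<phi>] by (simp add: s_def[symmetric] mult.assoc)
  qed
  then show "\<exists>C. \<forall>\<phi>\<in>test_functions. supp \<phi> \<subseteq> K \<longrightarrow>
      norm (T \<phi>) \<le> C * (\<Sum>\<alpha>\<in>multi_indices m. sup_norm (multi_deriv \<alpha> \<phi>))" by blast
qed

lemma tempered_distributions_cong:
  fixes S T :: "'n::finite functional"
  assumes T: "T \<in> tempered_distributions" and eq: "\<And>f. f \<in> schwartz \<Longrightarrow> S f = T f"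
  shows "S \<in> tempered_distributions"
proof -
  have add: "(\<lambda>x. f x + g x) \<in> schwartz" if "f \<in> schwartz" "g \<in> schwartz" for f g :: "'n cfun"
    using schwartz_add_scale[OF that, of 1] by simp
  have "linear_functional_on schwartz S"
    using T by (auto simp: tempered_distributions_def linear_functional_on_def eq add schwartz_scale)
  moreover have "\<exists>N C. \<forall>f\<in>schwartz. norm (S f) \<le> C * (\<Sum>\<alpha>\<in>multi_indices N. \<Sum>\<beta>\<in>multi_indices N.
               sup_norm (\<lambda>x. of_real (monomial \<beta> x) * multi_deriv \<alpha> f x))"
    using T unfolding tempered_distributions_def by (simp add: eq)
  ultimately show ?thesis by (simp add: tempered_distributions_def)
qed

lemma lebesgue_density_tempered:
  fixes h :: "'n::finite cfun"
  assumes h: "continuous_on UNIV h" "\<And>x. norm (h x) \<le> H"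
  shows "(\<lambda>f. \<integral>x. f x * h x \<partial>lborel) \<in> tempered_distributions"
proof -
  have H: "0 \<le> H" using h(2) norm_ge_zero order_trans by blast
  have int: "integrable lborel (\<lambda>x. f x * h x)" "norm (\<integral>x. f x * h x \<partial>lborel) \<le> H * L1_norm f" if "f \<in> schwartz" for f
    by (rule integrable_mult_bounded[OF rapid_integrable[OF schwartz_rapid_self[OF that]] h])+
  have "linear_functional_on schwartz (\<lambda>f. \<integral>x. f x * h x \<partial>lborel)"
    unfolding linear_functional_on_def using int(1) by (auto simp: ring_distribs mult.assoc)
  moreover have "norm (\<integral>x. f x * h x \<partial>lborel) \<le> (H * pi ^ CARD('n)) *
      (\<Sum>\<alpha>\<in>multi_indices (2 * CARD('n)). \<Sum>\<beta>\<in>multi_indices (2 * CARD('n)).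
               sup_norm (\<lambda>x. of_real (monomial \<beta> x) * multi_deriv \<alpha> f x))" if "f \<in> schwartz" for f
    using order_trans[OF int(2)[OF that] mult_left_mono[OF schwartz_L1_norm_le[OF that] H]] by (simp only: mult.assoc)
  ultimately show ?thesis unfolding tempered_distributions_def by blast
qed


section \<open>Distributions with a translation bounded Fourier transform\<close>

theorem theorem3p4:
  fixes \<omega> \<nu> :: "'n::finite functional"
  assumes "\<omega> \<in> DTBM"
    and "\<nu> \<in> translation_bounded_measures"
    and "fourier_is_measure \<omega> \<nu>"
  shows "(fourier_stieltjes :: 'n cfun set) \<subseteq> C_u \<and>
    (\<exists>h\<in>fourier_stieltjes. \<exists>\<mu>. \<mu> = lebesgue_density h \<and>
      (\<mu> \<in> translation_bounded_measures \<and>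
        (\<forall>f\<in>schwartz. radon_integrable \<mu> f) \<and>
        measure_distribution \<mu> \<in> tempered_distributions) \<and>
      (\<forall>\<phi>\<in>C_c.
        let g = (\<lambda>x. inv_fourier \<phi> x /
              ((\<Sum>j\<in>UNIV. (2 * of_real pi * \<i> * of_real (x $ j)) ^ (2 * CARD('n))) +
               (- 1) ^ CARD('n)))
        in radon_integrable \<nu> g \<and> \<mu> \<phi> = radon_integral \<nu> g) \<and>
      (Psi (measure_distribution \<mu>) \<in> tempered_distributions \<and>
        (\<forall>f\<in>schwartz. Psi (measure_distribution \<mu>) f = \<omega> f)) \<and>
      (\<forall>f\<in>schwartz. norm (\<omega> f) \<le> sup_norm h *
        (L1_norm f + (\<Sum>j\<in>UNIV. L1_norm ((partial_deriv j ^^ (2 * CARD('n))) f)))) \<and>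
      has_order_at_most (2 * CARD('n)) \<omega>)"
proof -
  \<comment> \<open>The finite measure is the reflection of \<open>q \<nu>\<close>.\<close>
  define q :: "'n cfun" where "q x = inverse (Psi_symbol x)" for x
  have qc: "continuous_on UNIV q"
    unfolding q_def by (intro continuous_intros Psi_symbol_continuous) (simp add: Psi_symbol_nonzero)
  have qw: "norm (q x) \<le> 2 ^ CARD('n) * weight x" for x
    unfolding q_def by (rule inverse_Psi_symbol_le_weight)
  have q0: "0 \<le> (2 :: real) ^ CARD('n)" by simp
  define \<rho> where "\<rho> = (\<lambda>\<phi>. \<nu> (\<lambda>x. \<phi> (- x) * q x))"
  have \<rho>: "finite_radon_measure \<rho>"
    unfolding \<rho>_def by (rule finite_radon_measure_damped[OF assms(2) qc q0 qw])
  define h where "h = fourier_measure \<rho>"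
  have hB: "h \<in> fourier_stieltjes" using \<rho> by (auto simp: h_def fourier_stieltjes_def)
  have hC: "h \<in> C_u" using hB fourier_stieltjes_subset_C_u by blast
  note h = C_u_D(1)[OF hC] C_u_D(2)[OF hC]
  define \<mu> where "\<mu> = lebesgue_density h"
  \<comment> \<open>The duality that carries the whole proof, extended from \<open>C\<^sub>c\<close> to continuous integrable functions.\<close>
  have dual: "radon_integrable \<nu> (\<lambda>x. inv_fourier f x / Psi_symbol x)"
      "(\<integral>x. f x * h x \<partial>lborel) = radon_integral \<nu> (\<lambda>x. inv_fourier f x / Psi_symbol x)"
    if f: "continuous_on UNIV f" "integrable lborel f" for f
  proof -
    have fc: "continuous_on UNIV (fourier f)" by (rule fourier_continuous[OF f(2)])
    have eq: "(\<lambda>x. inv_fourier f x / Psi_symbol x) = (\<lambda>x. fourier f (- x) * q x)"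
      by (simp add: inv_fourier_def q_def divide_inverse)
    show "radon_integrable \<nu> (\<lambda>x. inv_fourier f x / Psi_symbol x)"
      unfolding eq by (rule damped_integrable[OF assms(2) qc q0 qw fc fourier_bounded])
    show "(\<integral>x. f x * h x \<partial>lborel) = radon_integral \<nu> (\<lambda>x. inv_fourier f x / Psi_symbol x)"
      unfolding eq h_def fourier_duality[OF \<rho> f] unfolding \<rho>_def
      by (rule radon_integral_damped[OF assms(2) qc q0 qw fc fourier_bounded])
  qed
  have \<mu>r: "radon_measure \<mu>" unfolding \<mu>_def by (rule radon_measure_lebesgue_density[OF h])
  have \<mu>_int: "radon_integrable \<mu> f" "measure_distribution \<mu> f = (\<integral>x. f x * h x \<partial>lborel)" if "rapid f" for f
    using lebesgue_density_has_integral[OF h rapid_cont[OF that] rapid_integrable[OF that]]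
      radon_integral_eqI[OF \<mu>r rapid_cont[OF that]]
    by (auto simp: radon_integrable_def measure_distribution_def \<mu>_def)
  have \<mu>t: "measure_distribution \<mu> \<in> tempered_distributions"
    by (rule tempered_distributions_cong[OF lebesgue_density_tempered[OF h]])
      (rule \<mu>_int(2)[OF schwartz_rapid_self])
  have \<Psi>\<mu>: "Psi (measure_distribution \<mu>) f = (\<integral>x. Psi_fun f x * h x \<partial>lborel)" if f: "f \<in> schwartz" for f
  proof -
    have i: "integrable lborel (\<lambda>x. u x * h x)" if "rapid u" for u
      by (rule integrable_mult_bounded(1)[OF rapid_integrable[OF that] h])
    note r = i[OF schwartz_rapid_self[OF f]] i[OF schwartz_rapid_power[OF f]]
    show ?thesis
      unfolding Psi_apply \<mu>_int(2)[OF schwartz_rapid_self[OF f]] \<mu>_int(2)[OF schwartz_rapid_power[OF f]] Psi_fun_def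
      using r by (simp add: ring_distribs sum_distrib_right mult.assoc)
  qed
  have \<omega>: "(\<integral>x. Psi_fun f x * h x \<partial>lborel) = \<omega> f" if f: "f \<in> schwartz" for f
  proof -
    \<comment> \<open>The transform produces the symbol at \<open>-x\<close>, which equals that at \<open>x\<close> because all powers are even.\<close>
    have "inv_fourier (Psi_fun f) x / Psi_symbol x = inv_fourier f x" for x
    proof -
      have "Psi_symbol (- x) = Psi_symbol x" by (simp add: Psi_symbol_def power_mult)
      then show ?thesis using fourier_Psi_fun[OF f] Psi_symbol_nonzero[of x] by (simp add: inv_fourier_def)
    qed
    then have "(\<integral>x. Psi_fun f x * h x \<partial>lborel) = radon_integral \<nu> (inv_fourier f)"
      by (simp add: dual(2)[OF Psi_fun_continuous[OF f] Psi_fun_integrable[OF f]])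
    also have "\<dots> = \<omega> (fourier (inv_fourier f))"
      using assms(3) inv_fourier_schwartz[OF f]
      by (simp add: fourier_is_measure_def fourier_dist_def measure_distribution_def)
    finally show ?thesis by (simp add: fourier_inversion_schwartz[OF f])
  qed
  have d: "norm (\<omega> f) \<le> sup_norm h * (L1_norm f + (\<Sum>j\<in>UNIV. L1_norm ((partial_deriv j ^^ (2 * CARD('n))) f)))"
    if f: "f \<in> schwartz" for f
  proof -
    have "norm (\<omega> f) \<le> sup_norm h * L1_norm (Psi_fun f)"
      unfolding \<omega>[OF f, symmetric] by (rule integrable_mult_bounded(2)[OF Psi_fun_integrable[OF f] h])
    also have "\<dots> \<le> sup_norm h * (L1_norm f + (\<Sum>j\<in>UNIV. L1_norm ((partial_deriv j ^^ (2 * CARD('n))) f)))"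
      using hC by (intro mult_left_mono L1_norm_Psi_fun[OF f] sup_norm_nonneg) (simp add: C_u_def)
    finally show ?thesis .
  qed
  have "0 \<le> sup_norm h" using hC by (intro sup_norm_nonneg) (simp add: C_u_def)
  then have order: "has_order_at_most (2 * CARD('n)) \<omega>" by (rule has_order_at_mostI) (rule d)
  have b: "radon_integrable \<nu> (\<lambda>x. inv_fourier \<phi> x / Psi_symbol x) \<and>
      \<mu> \<phi> = radon_integral \<nu> (\<lambda>x. inv_fourier \<phi> x / Psi_symbol x)" if "\<phi> \<in> C_c" for \<phi>
    using dual[OF C_cD_cont[OF that] C_c_integrable[OF that]] by (simp add: \<mu>_def lebesgue_density_def)
  have "\<omega> \<in> tempered_distributions" using assms(1) by (simp add: DTBM_def)
  then have \<Psi>t: "Psi (measure_distribution \<mu>) \<in> tempered_distributions"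
    by (rule tempered_distributions_cong) (simp add: \<Psi>\<mu> \<omega>)
  have \<mu>tb: "\<mu> \<in> translation_bounded_measures"
    unfolding \<mu>_def by (rule lebesgue_density_translation_bounded[OF h])
  show ?thesis
    unfolding Let_def
  proof (intro conjI fourier_stieltjes_subset_C_u bexI[OF _ hB] exI[of _ \<mu>] \<mu>_def \<mu>tb \<mu>t \<Psi>t order ballI d)
    show "radon_integrable \<mu> f" if "f \<in> schwartz" for f by (rule \<mu>_int(1)[OF schwartz_rapid_self[OF that]])
    show "Psi (measure_distribution \<mu>) f = \<omega> f" if "f \<in> schwartz" for f by (simp add: \<Psi>\<mu> \<omega> that)
  qed (use b in \<open>auto simp: Psi_symbol_def\<close>)
qed

end
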